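(* Let $R>1$, let $\Sigma\subset B_1(0)\subset\mathbb{R}^2$ be measurable, and let $A:\mathbb{R}^2\to\mathbb{R}$ be given by $A=+1$ outside $B_R(0)$, $A=-1$ in $B_R(0)\setminus\Sigma$, $A=+1$ in $\Sigma$. Let $\eta>0$ and $a_\eta=A+i\eta$. Let $f\in H^{-1}(\mathbb{R}^2)$ be a fixed real-valued source with compact support and with vanishing average. For real-valued $v,\psi\in\dot H^1(\mathbb{R}^2)$ set $J_\eta(v,\psi)=\int f\psi-\frac{\eta}{2}\int|\nabla v|^2-\frac{\eta}{2}\int|\nabla\psi|^2$. Then: 1. The supremum $$\sup\left\{J_\eta(\tilde v,\tilde\psi)\ \middle|\ (\tilde v,\tilde\psi)\in\dot H^1(\mathbb{R}^2)\times\dot H^1(\mathbb{R}^2),\ \nabla\cdot(A\nabla\tilde\psi)+\eta\Delta\tilde v=0\right\}$$ is attained at a pair $(v_\eta,\psi_\eta)\in\dot H^1(\mathbb{R}^2)\times\dot H^1(\mathbb{R}^2)$. 2. The maximizing pair $(v_\eta,\psi_\eta)$ is unique up to an additive constant (in each component). The function $u_\eta:=v_\eta+i\psi_\eta$ is the unique (up to constants) solution of $\nabla\cdot(a_\eta\nabla u_\eta)=f$ on $\mathbb{R}^2$. 3. For the solutions, the energies coincide: $E_\eta(u_\eta)=J_\eta(v_\eta,\psi_\eta)$.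
   Context: $\dot H^1(\mathbb{R}^2)=\{U\in L^2_{\mathrm{loc}}(\mathbb{R}^2):\nabla U\in L^2(\mathbb{R}^2)\}$ (real- or complex-valued), with norm $\|U\|^2=\int_{\mathbb{R}^2}|\nabla U|^2+\int_{B_1(0)}|U|^2$. All PDEs (including the constraint) are understood in the weak (distributional) sense, and solutions $u_\eta$ are sought among complex-valued functions in $\dot H^1(\mathbb{R}^2)$. "Vanishing average" means $\langle f,\mathbf{1}\rangle=0$, where $\mathbf{1}$ is the constant function $1$; since $f$ has compact support it can be applied to functions that are only locally $H^1$, and $\int f\psi$ denotes the pairing $\langle f,\psi\rangle$. The energy is $E_\eta(u_\eta)=\frac{\eta}{2}\int_{\mathbb{R}^2}|\nabla u_\eta|^2\,dx$. Integrals are over $\mathbb{R}^2$ and $B_r(x_0)$ denotes the disk of radius $r$ centered at $x_0$. *)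

theory Defs
  imports "HOL-Analysis.Analysis"
begin

type_synonym plane = "real^2"

primrec Ck :: "nat \<Rightarrow> (plane \<Rightarrow> real) \<Rightarrow> bool" where
  "Ck 0 \<phi> \<longleftrightarrow> continuous_on UNIV \<phi>"
| "Ck (Suc k) \<phi> \<longleftrightarrow> \<phi> differentiable_on UNIV \<and>
     (\<forall>h. Ck k (\<lambda>x. frechet_derivative \<phi> (at x) h))"

definition supp :: "(plane \<Rightarrow> real) \<Rightarrow> plane set" where
  "supp \<phi> = closure {x. \<phi> x \<noteq> 0}"

definition test_functions :: "(plane \<Rightarrow> real) set" where
  "test_functions = {\<phi>. (\<forall>k. Ck k \<phi>) \<and> compact (supp \<phi>)}"

definition partial_deriv :: "2 \<Rightarrow> (plane \<Rightarrow> real) \<Rightarrow> plane \<Rightarrow> real" where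
  "partial_deriv i \<phi> x = frechet_derivative \<phi> (at x) (axis i 1)"

text \<open>Members of the function spaces below are functions, not classes of functions modulo null sets. The target
  type is \<^typ>\<open>real\<close> or \<^typ>\<open>complex\<close>; gradients of complex functions have values in \<^typ>\<open>complex^2\<close>,
  whose norm is the square root of the sum of the squared moduli of the components.\<close>

definition L2 :: "(plane \<Rightarrow> 'b::euclidean_space) set" where
  "L2 = {F \<in> borel_measurable lebesgue. integrable lebesgue (\<lambda>x. (norm (F x))\<^sup>2)}"

definition L2_loc :: "(plane \<Rightarrow> 'b::euclidean_space) set" where
  "L2_loc = {F \<in> borel_measurable lebesgue.
     \<forall>K. compact K \<longrightarrow> set_integrable lebesgue K (\<lambda>x. (norm (F x))\<^sup>2)}"

definition has_weak_gradient ::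
    "(plane \<Rightarrow> 'b::euclidean_space) \<Rightarrow> (plane \<Rightarrow> 'b^2) \<Rightarrow> bool" where
  "has_weak_gradient U G \<longleftrightarrow> (\<forall>\<phi>\<in>test_functions. \<forall>i.
     (\<integral>x. partial_deriv i \<phi> x *\<^sub>R U x \<partial>lebesgue) = - (\<integral>x. \<phi> x *\<^sub>R (G x $ i) \<partial>lebesgue))"

definition H1_dot :: "(plane \<Rightarrow> 'b::euclidean_space) set" where
  "H1_dot = {U \<in> L2_loc. \<exists>G\<in>L2. has_weak_gradient U G}"

text \<open>The square-integrable weak gradient is unique up to null sets; the choice of a representative
  is irrelevant below, since it occurs only under integrals.\<close>

definition weak_grad :: "(plane \<Rightarrow> 'b::euclidean_space) \<Rightarrow> plane \<Rightarrow> 'b^2" where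
  "weak_grad U = (SOME G. G \<in> L2 \<and> has_weak_gradient U G)"

definition dirichlet :: "(plane \<Rightarrow> 'b::euclidean_space) \<Rightarrow> real" where
  "dirichlet U = (\<integral>x. (norm (weak_grad U x))\<^sup>2 \<partial>lebesgue)"

definition H1 :: "(plane \<Rightarrow> real) set" where
  "H1 = L2 \<inter> H1_dot"

definition H1_norm :: "(plane \<Rightarrow> real) \<Rightarrow> real" where
  "H1_norm U = sqrt ((\<integral>x. (U x)\<^sup>2 \<partial>lebesgue) + dirichlet U)"

text \<open>\<open>H_minus1\<close> is the dual of the real space \<open>H1\<close>. Boundedness makes its members
  insensitive to changes of the argument on null sets. Their values outside \<open>H1\<close> are arbitrary
  and never used.\<close>

definition H_minus1 :: "((plane \<Rightarrow> real) \<Rightarrow> real) set" where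
  "H_minus1 = {f.
     (\<forall>U\<in>H1. \<forall>V\<in>H1. f (\<lambda>x. U x + V x) = f U + f V) \<and>
     (\<forall>c. \<forall>U\<in>H1. f (\<lambda>x. c * U x) = c * f U) \<and>
     (\<exists>C. \<forall>U\<in>H1. \<bar>f U\<bar> \<le> C * H1_norm U)}"

definition dist_support :: "((plane \<Rightarrow> real) \<Rightarrow> real) \<Rightarrow> plane set" where
  "dist_support f =
     - \<Union>{W. open W \<and> (\<forall>\<phi>\<in>test_functions. supp \<phi> \<subseteq> W \<longrightarrow> f \<phi> = 0)}"

definition cutoff_on :: "plane set \<Rightarrow> (plane \<Rightarrow> real) \<Rightarrow> bool" where
  "cutoff_on K \<zeta> \<longleftrightarrow> \<zeta> \<in> test_functions \<and> (\<exists>W. open W \<and> K \<subseteq> W \<and> (\<forall>x\<in>W. \<zeta> x = 1))"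

text \<open>The pairing of a compactly supported \<open>f\<close> in \<open>H_minus1\<close> with a function that is only locally
  in \<open>H1\<close>. It does not depend on the cutoff.\<close>

definition pairing :: "((plane \<Rightarrow> real) \<Rightarrow> real) \<Rightarrow> (plane \<Rightarrow> real) \<Rightarrow> real" where
  "pairing f \<psi> = f (\<lambda>x. (SOME \<zeta>. cutoff_on (dist_support f) \<zeta>) x * \<psi> x)"

text \<open>The distributional divergence of a vector field, as a functional on test functions. Real test
  functions suffice also for complex fields, because complex ones are combinations of them.\<close>

definition weak_div :: "(plane \<Rightarrow> 'b::euclidean_space^2) \<Rightarrow> (plane \<Rightarrow> real) \<Rightarrow> 'b" where
  "weak_div F \<phi> = - (\<integral>x. (\<Sum>i\<in>UNIV. partial_deriv i \<phi> x *\<^sub>R (F x $ i)) \<partial>lebesgue)"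

definition coeff_A :: "real \<Rightarrow> plane set \<Rightarrow> plane \<Rightarrow> real" where
  "coeff_A R \<Sigma> x = (if x \<notin> ball 0 R then 1 else if x \<in> \<Sigma> then 1 else - 1)"

definition solves :: "(plane \<Rightarrow> complex) \<Rightarrow> ((plane \<Rightarrow> real) \<Rightarrow> real) \<Rightarrow> (plane \<Rightarrow> complex) \<Rightarrow> bool" where
  "solves a f u \<longleftrightarrow> u \<in> H1_dot \<and>
     (\<forall>\<phi>\<in>test_functions. weak_div (\<lambda>x. a x *s weak_grad u x) \<phi> = of_real (f \<phi>))"

definition admissible :: "(plane \<Rightarrow> real) \<Rightarrow> real \<Rightarrow> ((plane \<Rightarrow> real) \<times> (plane \<Rightarrow> real)) set" where
  "admissible A \<eta> = {(v, \<psi>). v \<in> H1_dot \<and> \<psi> \<in> H1_dot \<and>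
     (\<forall>\<phi>\<in>test_functions.
        weak_div (\<lambda>x. A x *s weak_grad \<psi> x) \<phi> + \<eta> * weak_div (weak_grad v) \<phi> = 0)}"

definition J :: "real \<Rightarrow> ((plane \<Rightarrow> real) \<Rightarrow> real) \<Rightarrow> (plane \<Rightarrow> real) \<Rightarrow> (plane \<Rightarrow> real) \<Rightarrow> real" where
  "J \<eta> f v \<psi> = pairing f \<psi> - \<eta> / 2 * dirichlet v - \<eta> / 2 * dirichlet \<psi>"

definition energy :: "real \<Rightarrow> (plane \<Rightarrow> complex) \<Rightarrow> real" where
  "energy \<eta> u = \<eta> / 2 * dirichlet u"

definition maximizing_pair ::
    "(plane \<Rightarrow> real) \<Rightarrow> real \<Rightarrow> ((plane \<Rightarrow> real) \<Rightarrow> real) \<Rightarrow> (plane \<Rightarrow> real) \<Rightarrow> (plane \<Rightarrow> real) \<Rightarrow> bool" where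
  "maximizing_pair A \<eta> f v \<psi> \<longleftrightarrow> (v, \<psi>) \<in> admissible A \<eta> \<and>
     bdd_above {J \<eta> f v' \<psi>' | v' \<psi>'. (v', \<psi>') \<in> admissible A \<eta>} \<and>
     J \<eta> f v \<psi> = Sup {J \<eta> f v' \<psi>' | v' \<psi>'. (v', \<psi>') \<in> admissible A \<eta>}"

definition eq_up_to_const :: "(plane \<Rightarrow> 'b::euclidean_space) \<Rightarrow> (plane \<Rightarrow> 'b) \<Rightarrow> bool" where
  "eq_up_to_const U V \<longleftrightarrow> (\<exists>c. AE x in lebesgue. U x = V x + c)"

end

theory Submission
  imports Defs
begin

text \<open>Writing \<open>u = v + i \<psi>\<close>, the equation \<open>\<nabla> \<cdot> (a \<nabla> u) = f\<close> splits into the constraint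
  \<open>\<nabla> \<cdot> (A \<nabla> \<psi>) + \<eta> \<Delta> v = 0\<close> and \<open>\<nabla> \<cdot> (A \<nabla> v) - \<eta> \<Delta> \<psi> = f\<close>. Pairs of gradients that satisfy the constraint
  form a closed subspace \<open>S\<close> of \<open>L\<^sup>2\<close>, on which \<open>f\<close>, having vanishing average, is bounded by the Poincare
  inequality. If \<open>g \<in> S\<close> represents \<open>f / \<eta>\<close>, then \<open>J = \<eta>/2 \<parallel>g\<parallel>\<^sup>2 - \<eta>/2 \<parallel>h - g\<parallel>\<^sup>2\<close> at every \<open>h \<in> S\<close>, so the maximizers are
  the pairs with gradient \<open>g\<close>, and the maximum is their energy. Testing \<open>g\<close> against the
  elements of \<open>S\<close> with second component \<open>\<nabla> \<phi>\<close> gives the second equation.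

  Solutions are unique because the equations extend from test functions to all of \<open>H1_dot\<close> (a cutoff at scale
  \<open>n\<close> costs only the part of the field outside \<open>ball 0 n\<close>), so that the difference of two solutions may be
  used as its own test function.

  All estimates on weakly differentiable functions rest on the translation estimate
  \<open>\<parallel>U(\<cdot> + z) - U\<parallel> \<le> \<bar>z\<bar> \<parallel>\<nabla> U\<parallel>\<close>, from which the Poincare inequality on balls follows by integration in \<open>z\<close>.\<close>

section \<open>Smooth functions and cutoffs\<close>

text \<open>Since \<open>A\<close> changes sign, neither equation of the system is coercive by
  itself. Coercivity appears when each equation is tested with the potential of the other:
  multiplication by the real function \<open>A\<close> is symmetric, its two contributions cancel,
  and \<eta> times the sum of the squared norms of both gradients remains. The constraint, in turn,
  can be met for every \<psi>: the gradient part of - A \<nabla>\<psi> / \<eta> serves as \<nabla>v.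
  This is why testing with constrained pairs loses no equation.

  \<open>H1_dot\<close> consists of functions, its Dirichlet integral does not see constants, and
  nothing makes it complete by definition. The Hilbert space arguments therefore take place in sets
  of fields inside \<open>L2\<close>, and potentials are recovered through
  \<open>wgrad_complete\<close>: a limit of gradients is again a gradient. For the same reason the
  source has to act on gradients. Constants drop out of \<open>pairing f\<close> because the average
  vanishes, and the Poincare inequality on one ball around the support of the cutoff then bounds the
  pairing by the gradient alone.\<close>

text \<open>\<open>frechet_derivative\<close> is a choice term; this rule trades it for an explicit
  derivative \<open>D\<close>. The inductions on the order of smoothness below step through
  it.\<close>

lemma Ck_SucI:
  assumes "\<And>x. (\<phi> has_derivative D x) (at x)" "\<And>h. Ck k (\<lambda>x. D x h)"
  shows "Ck (Suc k) \<phi>"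
proof -
  have "frechet_derivative \<phi> (at x) = D x" for x
    using frechet_derivative_at[OF assms(1)] by simp
  then show ?thesis
    using assms by (auto simp: differentiable_on_def differentiable_def intro: has_derivative_at_withinI)
qed

lemma Ck_Suc_has_derivative:
  "Ck (Suc k) \<phi> \<Longrightarrow> (\<phi> has_derivative frechet_derivative \<phi> (at x)) (at x)"
  by (auto simp: differentiable_on_def frechet_derivative_works)

lemma Ck_Suc_frechet: "Ck (Suc k) \<phi> \<Longrightarrow> Ck k (\<lambda>x. frechet_derivative \<phi> (at x) h)"
  by simp

lemma Ck_Suc_D: "Ck (Suc k) \<phi> \<Longrightarrow> Ck k \<phi>"
proof (induction k arbitrary: \<phi>)
  case 0
  then show ?case by (simp add: differentiable_imp_continuous_on)
next
  case (Suc k)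
  then show ?case by (metis Ck.simps(2))
qed

lemma Ck_const: "Ck k (\<lambda>x. c)"
proof (induction k arbitrary: c)
  case (Suc k)
  show ?case by (rule Ck_SucI[where D = "\<lambda>x h. 0"]) (auto simp: Suc)
qed simp

lemma Ck_add: "Ck k \<phi> \<Longrightarrow> Ck k \<psi> \<Longrightarrow> Ck k (\<lambda>x. \<phi> x + \<psi> x)"
proof (induction k arbitrary: \<phi> \<psi>)
  case 0
  then show ?case by (simp add: continuous_on_add)
next
  case (Suc k)
  show ?case
    by (rule Ck_SucI[OF has_derivative_add[OF Suc.prems[THEN Ck_Suc_has_derivative]]])
      (intro Suc.IH Suc.prems[THEN Ck_Suc_frechet])
qed

lemma Ck_mult: "Ck k \<phi> \<Longrightarrow> Ck k \<psi> \<Longrightarrow> Ck k (\<lambda>x. \<phi> x * \<psi> x)"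
proof (induction k arbitrary: \<phi> \<psi>)
  case 0
  then show ?case by (simp add: continuous_on_mult)
next
  case (Suc k)
  show ?case
    by (rule Ck_SucI[OF has_derivative_mult[OF Suc.prems[THEN Ck_Suc_has_derivative]]])
      (intro Ck_add Suc.IH Suc.prems[THEN Ck_Suc_frechet] Suc.prems[THEN Ck_Suc_D])
qed

lemma Ck_diff: "Ck k \<phi> \<Longrightarrow> Ck k \<psi> \<Longrightarrow> Ck k (\<lambda>x. \<phi> x - \<psi> x)"
  using Ck_add[OF _ Ck_mult[OF Ck_const[of k "-1"]], of \<phi> \<psi>] by simp

lemma Ck_sum: "(\<And>i. i \<in> I \<Longrightarrow> Ck k (\<phi> i)) \<Longrightarrow> Ck k (\<lambda>x. \<Sum>i\<in>I. \<phi> i x)"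
  by (induction I rule: infinite_finite_induct) (auto simp: Ck_const Ck_add)

lemma Ck_inverse: "Ck k \<phi> \<Longrightarrow> (\<And>x. \<phi> x \<noteq> 0) \<Longrightarrow> Ck k (\<lambda>x. inverse (\<phi> x))"
proof (induction k arbitrary: \<phi>)
  case 0
  then show ?case by (auto intro!: continuous_intros)
next
  case (Suc k)
  have "Ck k (\<lambda>x. inverse (\<phi> x))"
    using Suc.IH Suc.prems Ck_Suc_D by blast
  then have "Ck k (\<lambda>x. - (inverse (\<phi> x) * frechet_derivative \<phi> (at x) h * inverse (\<phi> x)))" for h
    using Ck_diff[OF Ck_const[of k 0] Ck_mult[OF Ck_mult]] Suc.prems(1)[THEN Ck_Suc_frechet] by simp
  moreover have "((\<lambda>x. inverse (\<phi> x)) has_derivative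
     (\<lambda>h. - (inverse (\<phi> x) * frechet_derivative \<phi> (at x) h * inverse (\<phi> x)))) (at x)" for x
    by (rule Deriv.has_derivative_inverse[OF Suc.prems(2) Ck_Suc_has_derivative[OF Suc.prems(1)]])
  ultimately show ?case by (rule Ck_SucI[rotated])
qed

lemma Ck_affine: "Ck k \<phi> \<Longrightarrow> Ck k (\<lambda>x. \<phi> (c *\<^sub>R x + b))"
proof (induction k arbitrary: \<phi>)
  case 0
  then show ?case unfolding Ck.simps
    by (rule continuous_on_compose2[of UNIV \<phi> UNIV "\<lambda>x. c *\<^sub>R x + b"])
      (simp_all add: continuous_on_add continuous_on_scaleR)
next
  case (Suc k)
  have "((\<lambda>x. \<phi> (c *\<^sub>R x + b)) has_derivative (\<lambda>h. frechet_derivative \<phi> (at (c *\<^sub>R x + b)) (c *\<^sub>R h))) (at x)" for x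
    by (rule has_derivative_compose[OF _ Ck_Suc_has_derivative[OF Suc.prems]])
      (auto intro!: derivative_eq_intros)
  then show ?case
    by (rule Ck_SucI) (rule Suc.IH, rule Ck_Suc_frechet[OF Suc.prems])
qed

text \<open>A polynomial in the coordinates, hence smooth at \<open>p\<close> too, unlike the
  distance itself. This is why \<open>bump\<close> is built from the square.\<close>

lemma Ck_dist_square: "Ck k (\<lambda>x. (dist x p)\<^sup>2)"
proof -
  have lin: "Ck k (\<lambda>x. x $ i)" for k i
  proof (cases k)
    case 0
    then show ?thesis by (simp add: continuous_on_component)
  next
    case (Suc j)
    have "((\<lambda>x. x $ i) has_derivative (\<lambda>h. h $ i)) (at x)" for x :: plane
      by (intro bounded_linear_imp_has_derivative bounded_linear_vec_nth)
    then show ?thesis unfolding Suc by (rule Ck_SucI) (rule Ck_const)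
  qed
  have "(dist x p)\<^sup>2 = (\<Sum>i\<in>UNIV. (x $ i - p $ i) * (x $ i - p $ i))" for x
    by (simp add: dist_norm power2_norm_eq_inner inner_vec_def)
  then show ?thesis
    by (simp only:) (intro Ck_sum Ck_mult Ck_diff lin Ck_const)
qed

text \<open>Up to linear combinations, this family is closed under differentiation, which makes all its members smooth.\<close>

definition exp_inv :: "nat \<Rightarrow> real \<Rightarrow> real" where
  "exp_inv n t = (if t \<le> 0 then 0 else exp (- inverse t) * inverse t ^ n)"

text \<open>One term of the exponential series, x^(n + 2) \<le> (n + 2)! exp x at x = 1 / t, absorbs
  the pole of order \<open>n\<close> and leaves t^2 to spare. The quadratic decay makes the
  difference quotient at 0 vanish, for every \<open>n\<close> alike.\<close>

lemma exp_inv_bound: "\<bar>exp_inv n t\<bar> \<le> fact (n + 2) * t\<^sup>2"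
proof (cases "t \<le> 0")
  case False
  then have t: "t > 0" by simp
  have "x ^ k \<le> fact k * exp x" if "x > 0" for x :: real and k
  proof -
    have "x ^ k /\<^sub>R fact k \<le> exp x"
      unfolding exp_def using that sum_le_suminf[OF summable_exp_generic, of "{k}" x] by simp
    then show ?thesis by (simp add: field_simps)
  qed
  from this[of "inverse t" "n + 2"] have "inverse t ^ n * (inverse t)\<^sup>2 \<le> fact (n + 2) * exp (inverse t)"
    using t by (simp only: power_add) simp
  then have "inverse t ^ n \<le> fact (n + 2) * exp (inverse t) * t\<^sup>2"
    using t mult_right_mono[of "inverse t ^ n * (inverse t)\<^sup>2" "fact (n + 2) * exp (inverse t)" "t\<^sup>2"]
    by (simp only: mult.assoc flip: power_mult_distrib) simp
  then have "exp (- inverse t) * inverse t ^ n \<le> exp (- inverse t) * (fact (n + 2) * exp (inverse t) * t\<^sup>2)"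
    by (rule mult_left_mono) simp
  also have "\<dots> = fact (n + 2) * t\<^sup>2" by (simp add: exp_minus)
  finally show ?thesis using t by (simp add: exp_inv_def)
qed (simp add: exp_inv_def)

lemma exp_inv_has_derivative:
  "(exp_inv n has_real_derivative (exp_inv (n + 2) t - real n * exp_inv (n + 1) t)) (at t)"
proof -
  consider "t < 0" | "t = 0" | "t > 0" by linarith
  then show ?thesis
  proof cases
    case 1
    have "((\<lambda>_. 0) has_real_derivative 0) (at t)" by simp
    then have "(exp_inv n has_real_derivative 0) (at t)"
      by (rule has_field_derivative_transform_within_open[where S = "{..<0}"])
        (use 1 in \<open>auto simp: exp_inv_def\<close>)
    then show ?thesis using 1 by (simp add: exp_inv_def)
  next
    case 2
    have "((\<lambda>h. exp_inv n h / h) \<longlongrightarrow> 0) (at 0)"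
    proof (rule Lim_null_comparison)
      show "\<forall>\<^sub>F h in at 0. norm (exp_inv n h / h) \<le> fact (n + 2) * \<bar>h\<bar>"
      proof (intro always_eventually allI)
        fix h :: real
        have "\<bar>exp_inv n h\<bar> / \<bar>h\<bar> \<le> fact (n + 2) * h\<^sup>2 / \<bar>h\<bar>"
          by (intro divide_right_mono exp_inv_bound) simp
        also have "\<dots> = fact (n + 2) * \<bar>h\<bar>" by (cases "h < 0") (simp_all add: power2_eq_square)
        finally show "norm (exp_inv n h / h) \<le> fact (n + 2) * \<bar>h\<bar>" by simp
      qed
      show "((\<lambda>h::real. fact (n + 2) * \<bar>h\<bar>) \<longlongrightarrow> 0) (at 0)"
        by (auto intro!: tendsto_eq_intros)
    qed
    then show ?thesis using 2 by (simp add: has_field_derivative_iff exp_inv_def)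
  next
    case 3
    have "((\<lambda>t. exp (- inverse t) * inverse t ^ n) has_real_derivative
        (exp_inv (n + 2) t - real n * exp_inv (n + 1) t)) (at t)"
    proof -
      have i: "(inverse has_real_derivative - ((inverse t)\<^sup>2)) (at t)"
        using DERIV_inverse[of t UNIV] 3 by (simp add: numeral_2_eq_2)
      have "((\<lambda>t. exp (- inverse t) * inverse t ^ n) has_real_derivative
        (exp (- inverse t) * - (- ((inverse t)\<^sup>2))) * inverse t ^ n
          + real n * (- ((inverse t)\<^sup>2) * inverse t ^ (n - Suc 0)) * exp (- inverse t)) (at t)"
        by (intro DERIV_mult DERIV_fun_exp DERIV_minus DERIV_power i)
      also have "(exp (- inverse t) * - (- ((inverse t)\<^sup>2))) * inverse t ^ n
          + real n * (- ((inverse t)\<^sup>2) * inverse t ^ (n - Suc 0)) * exp (- inverse t)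
        = exp_inv (n + 2) t - real n * exp_inv (n + 1) t"
        using 3 by (cases n) (simp_all add: exp_inv_def power2_eq_square algebra_simps)
      finally show ?thesis .
    qed
    then show ?thesis
      by (rule has_field_derivative_transform_within_open[where S = "{0<..}"])
        (use 3 in \<open>auto simp: exp_inv_def\<close>)
  qed
qed

lemma Ck_exp_inv_comp: "(\<And>k. Ck k q) \<Longrightarrow> Ck k (\<lambda>x. exp_inv n (q x))"
proof (induction k arbitrary: n)
  case 0
  have "continuous_on UNIV (exp_inv n)"
    by (meson DERIV_continuous_on exp_inv_has_derivative has_field_derivative_at_within)
  then show ?case using 0[of 0] by (auto intro: continuous_on_compose2)
next
  case (Suc k)
  have "((\<lambda>x. exp_inv n (q x)) has_derivative
     (\<lambda>h. (exp_inv (n + 2) (q x) - real n * exp_inv (n + 1) (q x)) * frechet_derivative q (at x) h)) (at x)" for x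
    using has_derivative_compose[OF Ck_Suc_has_derivative[OF Suc.prems]
      exp_inv_has_derivative[unfolded has_field_derivative_def]] .
  then show ?case
    by (rule Ck_SucI) (intro Ck_mult Ck_diff Ck_const Suc.IH Suc.prems Ck_Suc_frechet)
qed

text \<open>The usual smooth transition quotient in the squared distance \<open>q\<close>. For r > 0
  it drops from 1 to 0 between the distances \<open>r\<close> and \<open>2 * r\<close>.\<close>

definition bump :: "plane \<Rightarrow> real \<Rightarrow> plane \<Rightarrow> real" where
  "bump p r x = (let q = (dist x p)\<^sup>2; e = exp_inv 0 in
     e (4 * r\<^sup>2 - q) * inverse (e (4 * r\<^sup>2 - q) + e (q - r\<^sup>2)))"

lemma exp_inv_0_simps:
  "exp_inv 0 t \<ge> 0" "exp_inv 0 t = 0 \<longleftrightarrow> t \<le> 0" "exp_inv 0 t > 0 \<longleftrightarrow> t > 0"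
  by (auto simp: exp_inv_def)

lemma bump_denom_pos:
  assumes "r > 0" shows "exp_inv 0 (4 * r\<^sup>2 - q) + exp_inv 0 (q - r\<^sup>2) > 0"
proof -
  have "r\<^sup>2 > 0" using assms by simp
  then have "4 * r\<^sup>2 - q > 0 \<or> q - r\<^sup>2 > 0" by argo
  then show ?thesis
    by (metis add_nonneg_pos add_pos_nonneg exp_inv_0_simps(1,3))
qed

lemma
  assumes "r > 0"
  shows Ck_bump: "Ck k (bump p r)"
    and bump_nonneg: "bump p r x \<ge> 0"
    and bump_le_1: "bump p r x \<le> 1"
    and bump_eq_1: "dist x p \<le> r \<Longrightarrow> bump p r x = 1"
    and bump_nonzero_iff: "bump p r x \<noteq> 0 \<longleftrightarrow> dist x p < 2 * r"
proof -
  note d = bump_denom_pos[OF assms]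
  have "Ck k (\<lambda>x. exp_inv 0 (4 * r\<^sup>2 - (dist x p)\<^sup>2) *
      inverse (exp_inv 0 (4 * r\<^sup>2 - (dist x p)\<^sup>2) + exp_inv 0 ((dist x p)\<^sup>2 - r\<^sup>2)))"
    using d by (intro Ck_mult Ck_inverse Ck_add Ck_exp_inv_comp Ck_diff Ck_const Ck_dist_square)
      (simp add: less_le)
  then show "Ck k (bump p r)" by (simp add: bump_def[abs_def] Let_def)
  show "bump p r x \<ge> 0" by (simp add: bump_def Let_def exp_inv_0_simps)
  show "bump p r x \<le> 1"
    using d[of "(dist x p)\<^sup>2"] exp_inv_0_simps(1)[of "(dist x p)\<^sup>2 - r\<^sup>2"]
    by (simp add: bump_def Let_def divide_simps flip: divide_inverse)
  show "bump p r x = 1" if "dist x p \<le> r"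
  proof -
    have "(dist x p)\<^sup>2 - r\<^sup>2 \<le> 0" using that by (simp add: power_mono)
    then have "exp_inv 0 ((dist x p)\<^sup>2 - r\<^sup>2) = 0" by (simp add: exp_inv_0_simps)
    then show ?thesis using d[of "(dist x p)\<^sup>2"] by (simp add: bump_def Let_def)
  qed
  have "dist x p < 2 * r \<longleftrightarrow> (dist x p)\<^sup>2 < (2 * r)\<^sup>2"
    using assms power_mono_iff[of "2 * r" "dist x p" 2] by (simp flip: not_le)
  then show "bump p r x \<noteq> 0 \<longleftrightarrow> dist x p < 2 * r"
    using d[of "(dist x p)\<^sup>2"]
    by (auto simp: bump_def Let_def exp_inv_0_simps power2_eq_square)
qed

section \<open>Supports and operations on test functions\<close>

lemma supp_subset: "closed S \<Longrightarrow> (\<And>x. \<phi> x \<noteq> 0 \<Longrightarrow> x \<in> S) \<Longrightarrow> supp \<phi> \<subseteq> S"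
  unfolding supp_def by (rule closure_minimal) auto

lemma not_in_suppD: "x \<notin> supp \<phi> \<Longrightarrow> \<phi> x = 0"
  unfolding supp_def using closure_subset[of "{x. \<phi> x \<noteq> 0}"] by auto

lemma test_functionI:
  assumes "\<And>k. Ck k \<phi>" "compact S" "\<And>x. \<phi> x \<noteq> 0 \<Longrightarrow> x \<in> S"
  shows "\<phi> \<in> test_functions"
proof -
  have "supp \<phi> \<subseteq> S"
    by (rule supp_subset[OF compact_imp_closed[OF assms(2)] assms(3)])
  then have "supp \<phi> = S \<inter> supp \<phi>" by blast
  also have "compact \<dots>"
    by (intro compact_Int_closed assms) (simp add: supp_def)
  finally show ?thesis using assms(1) by (simp add: test_functions_def)
qed

lemma test_Ck: "\<phi> \<in> test_functions \<Longrightarrow> Ck k \<phi>"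
  by (simp add: test_functions_def)

lemma test_compact: "\<phi> \<in> test_functions \<Longrightarrow> compact (supp \<phi>)"
  by (simp add: test_functions_def)

lemma test_bounded_supp:
  assumes "\<phi> \<in> test_functions"
  obtains r where "r > 0" "\<And>x. r \<le> norm x \<Longrightarrow> \<phi> x = 0"
proof -
  from compact_imp_bounded[OF test_compact[OF assms]] obtain r where "\<forall>x\<in>supp \<phi>. norm x < r" "r > 0"
    by (auto simp: bounded_pos_less)
  then show ?thesis using not_in_suppD that by (metis linorder_not_less)
qed

lemma test_mult:
  assumes "\<phi> \<in> test_functions" "\<And>k. Ck k \<psi>"
  shows "(\<lambda>x. \<phi> x * \<psi> x) \<in> test_functions"
  by (rule test_functionI[OF Ck_mult[OF test_Ck[OF assms(1)] assms(2)] test_compact[OF assms(1)]])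
    (use not_in_suppD in force)

lemma test_add:
  assumes "\<phi> \<in> test_functions" "\<psi> \<in> test_functions"
  shows "(\<lambda>x. \<phi> x + \<psi> x) \<in> test_functions"
  by (rule test_functionI[OF Ck_add[OF assms[THEN test_Ck]] compact_Un[OF assms[THEN test_compact]]])
    (metis UnI1 UnI2 add.right_neutral not_in_suppD)

lemma test_scale:
  assumes "\<phi> \<in> test_functions"
  shows "(\<lambda>x. c * \<phi> x) \<in> test_functions"
  using test_mult[OF assms Ck_const[of _ c]] by (simp add: mult.commute)

lemma test_affine:
  assumes "\<phi> \<in> test_functions" "c \<noteq> 0"
  shows "(\<lambda>x. \<phi> (c *\<^sub>R x + b)) \<in> test_functions"
proof (rule test_functionI[OF Ck_affine[OF test_Ck[OF assms(1)]]])
  show "compact ((\<lambda>x. inverse c *\<^sub>R (x - b)) ` supp \<phi>)"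
    by (intro compact_continuous_image continuous_intros test_compact assms)
  show "x \<in> (\<lambda>x. inverse c *\<^sub>R (x - b)) ` supp \<phi>" if "\<phi> (c *\<^sub>R x + b) \<noteq> 0" for x
    using that assms(2) not_in_suppD[of "c *\<^sub>R x + b"]
    by (intro image_eqI[of _ _ "c *\<^sub>R x + b"]) auto
qed

lemma frechet_zero_outside_supp:
  assumes "x \<notin> supp \<phi>"
  shows "frechet_derivative \<phi> (at x) h = 0"
proof -
  have "open (- supp \<phi>)" by (simp add: supp_def open_Compl)
  then have "(\<phi> has_derivative (\<lambda>h. 0)) (at x)"
    using has_derivative_transform_within_open[OF has_derivative_const[of 0], of "- supp \<phi>" x \<phi>]
      assms not_in_suppD by force
  then show ?thesis using frechet_derivative_at by metis
qed

lemma test_frechet: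
  assumes "\<phi> \<in> test_functions"
  shows "(\<lambda>x. frechet_derivative \<phi> (at x) h) \<in> test_functions"
  by (rule test_functionI[OF Ck_Suc_frechet[OF test_Ck[OF assms]] test_compact[OF assms]])
    (use frechet_zero_outside_supp in blast)

lemma test_partial_deriv: "\<phi> \<in> test_functions \<Longrightarrow> partial_deriv i \<phi> \<in> test_functions"
  using test_frechet[of \<phi> "axis i 1"] by (simp add: partial_deriv_def[abs_def])

lemma test_has_derivative:
  "\<phi> \<in> test_functions \<Longrightarrow> (\<phi> has_derivative frechet_derivative \<phi> (at x)) (at x)"
  using Ck_Suc_has_derivative[OF test_Ck] by blast

lemma frechet_eq_sum_partial:
  assumes "(\<phi> has_derivative frechet_derivative \<phi> (at x)) (at x)"
  shows "frechet_derivative \<phi> (at x) h = (\<Sum>i\<in>UNIV. h $ i * partial_deriv i \<phi> x)"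
proof -
  interpret bounded_linear "frechet_derivative \<phi> (at x)"
    using assms has_derivative_bounded_linear by blast
  have "frechet_derivative \<phi> (at x) h = frechet_derivative \<phi> (at x) (\<Sum>i\<in>UNIV. (h $ i) *\<^sub>R axis i 1)"
    using basis_expansion[of h] by (simp add: scalar_mult_eq_scaleR)
  then show ?thesis by (simp add: sum scaleR partial_deriv_def)
qed

lemma test_continuous: "\<phi> \<in> test_functions \<Longrightarrow> continuous_on S \<phi>"
  using test_Ck[of \<phi> 0] continuous_on_subset by auto

lemma test_bounded:
  assumes "\<phi> \<in> test_functions"
  obtains B where "B > 0" "\<And>x. \<bar>\<phi> x\<bar> \<le> B"
proof -
  have "bounded (\<phi> ` supp \<phi>)"
    by (intro compact_imp_bounded compact_continuous_image test_continuous test_compact assms)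
  then obtain B where "B > 0" "\<forall>x\<in>supp \<phi>. \<bar>\<phi> x\<bar> \<le> B" by (auto simp: bounded_pos)
  then have "\<bar>\<phi> x\<bar> \<le> B" for x by (cases "x \<in> supp \<phi>") (auto dest: not_in_suppD)
  then show ?thesis using that \<open>B > 0\<close> by blast
qed

lemma test_bump: "r > 0 \<Longrightarrow> bump p r \<in> test_functions"
  by (rule test_functionI[OF Ck_bump compact_cball[of p "2 * r"]])
    (auto simp: bump_nonzero_iff dist_commute)

lemma partial_deriv_mult:
  assumes "\<phi> \<in> test_functions" "\<psi> \<in> test_functions"
  shows "partial_deriv i (\<lambda>x. \<phi> x * \<psi> x) x = \<phi> x * partial_deriv i \<psi> x + partial_deriv i \<phi> x * \<psi> x"
  using frechet_derivative_at[OF has_derivative_mult[OF assms[THEN test_has_derivative]], of x]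
  by (simp add: partial_deriv_def fun_eq_iff)

lemma partial_deriv_affine:
  assumes "\<phi> \<in> test_functions"
  shows "partial_deriv i (\<lambda>x. \<phi> (c *\<^sub>R x + b)) x = c * partial_deriv i \<phi> (c *\<^sub>R x + b)"
proof -
  have "((\<lambda>x. \<phi> (c *\<^sub>R x + b)) has_derivative (\<lambda>h. frechet_derivative \<phi> (at (c *\<^sub>R x + b)) (c *\<^sub>R h))) (at x)"
    by (rule has_derivative_compose[OF _ test_has_derivative[OF assms]])
      (auto intro!: derivative_eq_intros)
  from frechet_derivative_at[OF this] show ?thesis
    using linear_cmul[OF bounded_linear.linear[OF has_derivative_bounded_linear[OF test_has_derivative[OF assms]]]]
    by (simp add: partial_deriv_def fun_eq_iff)
qed

text \<open>The complementary products \<open>\<Prod>(1 - \<beta>\<^sub>i)\<close> of bumps serve both as smooth Urysohn functions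
  and, telescoping, as partitions of unity.\<close>

lemma Ck_prod: "finite I \<Longrightarrow> (\<And>i. i \<in> I \<Longrightarrow> Ck k (\<phi> i)) \<Longrightarrow> Ck k (\<lambda>x. \<Prod>i\<in>I. \<phi> i x)"
  by (induction I rule: finite_induct) (auto simp: Ck_const Ck_mult)

text \<open>The inner balls cover while the doubled balls stay inside the prescribed sets; these are
  the two radii of \<open>bump\<close>.\<close>

lemma compact_bump_cover:
  assumes "compact K" "\<And>x. x \<in> K \<Longrightarrow> x \<in> V x \<and> open (V x)"
  obtains P r where "finite P" "P \<subseteq> K" "\<And>p. r p > 0" "\<And>p. p \<in> P \<Longrightarrow> cball p (2 * r p) \<subseteq> V p"
    "K \<subseteq> (\<Union>p\<in>P. ball p (r p))"
proof -
  have "\<exists>r>0. p \<in> K \<longrightarrow> cball p (2 * r) \<subseteq> V p" for p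
  proof (cases "p \<in> K")
    case True
    with assms(2) obtain e where "e > 0" "cball p e \<subseteq> V p"
      by (meson open_contains_cball)
    then show ?thesis by (intro exI[of _ "e / 2"]) auto
  \<comment> \<open>Outside \<open>K\<close> the default radius 1 keeps \<open>r\<close> positive
    everywhere, so that the facts on \<open>bump\<close> apply without a side condition on the
    centre.\<close>
  qed (auto intro: exI[of _ 1])
  then obtain r where r: "\<And>p. r p > 0" "\<And>p. p \<in> K \<Longrightarrow> cball p (2 * r p) \<subseteq> V p" by metis
  obtain P where "P \<subseteq> K" "finite P" "K \<subseteq> (\<Union>p\<in>P. ball p (r p))"
    by (rule compactE_image[OF assms(1), of K "\<lambda>p. ball p (r p)"]) (use r(1) in auto)
  then show ?thesis using that r by blast
qed

lemma smooth_urysohn: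
  assumes "compact K" "open V" "K \<subseteq> V"
  obtains \<zeta> W where "\<zeta> \<in> test_functions" "open W" "K \<subseteq> W" "\<And>x. x \<in> W \<Longrightarrow> \<zeta> x = 1"
    "\<And>x. 0 \<le> \<zeta> x" "\<And>x. \<zeta> x \<le> 1" "supp \<zeta> \<subseteq> V"
proof -
  obtain P r where P: "finite P" "P \<subseteq> K" "\<And>p. r p > 0" "\<And>p. p \<in> P \<Longrightarrow> cball p (2 * r p) \<subseteq> V"
    "K \<subseteq> (\<Union>p\<in>P. ball p (r p))"
    by (rule compact_bump_cover[OF assms(1), of "\<lambda>_. V"]) (use assms in auto)
  define \<zeta> where "\<zeta> x = 1 - (\<Prod>p\<in>P. 1 - bump p (r p) x)" for x
  let ?S = "\<Union>p\<in>P. cball p (2 * r p)"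
  have Ck: "Ck k \<zeta>" for k
    unfolding \<zeta>_def by (intro Ck_diff Ck_prod Ck_const Ck_bump P)
  have S: "compact ?S" "?S \<subseteq> V" using P by auto
  have nz: "x \<in> ?S" if "\<zeta> x \<noteq> 0" for x
  proof (rule ccontr)
    assume "x \<notin> ?S"
    then have "bump p (r p) x = 0" if "p \<in> P" for p
      using that bump_nonzero_iff[OF P(3), of p p x] by (force simp: dist_commute)
    then show False using that by (simp add: \<zeta>_def)
  qed
  show ?thesis
  proof
    show "\<zeta> \<in> test_functions" by (rule test_functionI[OF Ck S(1) nz])
    show "open (\<Union>p\<in>P. ball p (r p))" by auto
    show "\<zeta> x = 1" if "x \<in> (\<Union>p\<in>P. ball p (r p))" for x
    proof -
      from that obtain p where "p \<in> P" "bump p (r p) x = 1"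
        using bump_eq_1[OF P(3)] by (auto simp: dist_commute less_imp_le)
      then show ?thesis using P(1) by (auto simp: \<zeta>_def)
    qed
    show "0 \<le> \<zeta> x" for x
      unfolding \<zeta>_def using P(3) by (simp add: prod_le_1 bump_nonneg bump_le_1)
    show "\<zeta> x \<le> 1" for x
      unfolding \<zeta>_def using P(3) by (simp add: prod_nonneg bump_le_1)
    show "supp \<zeta> \<subseteq> V"
      using supp_subset[of ?S \<zeta>] nz S by (auto simp: compact_imp_closed)
  qed (use P in auto)
qed

lemma cutoff_on_ex: "compact K \<Longrightarrow> \<exists>\<zeta>. cutoff_on K \<zeta>"
  using smooth_urysohn[of K UNIV] unfolding cutoff_on_def by (metis open_UNIV subset_UNIV)

text \<open>A distribution that vanishes on each member of an open cover vanishes on the union.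
  Multiplying \<phi> by one more factor 1 - \<beta> removes a part supported in a single member,
  which \<open>f\<close> does not see. After all factors the product is zero, because some \<beta>
  equals 1 at each point of the support.\<close>

lemma test_function_localization:
  assumes \<phi>: "\<phi> \<in> test_functions" "supp \<phi> \<subseteq> \<Union>\<W>" "\<And>W. W \<in> \<W> \<Longrightarrow> open W"
    and add: "\<And>\<phi> \<psi>. \<phi> \<in> test_functions \<Longrightarrow> \<psi> \<in> test_functions \<Longrightarrow> f (\<lambda>x. \<phi> x + \<psi> x) = f \<phi> + f \<psi>"
    and zero: "\<And>W \<phi>. W \<in> \<W> \<Longrightarrow> \<phi> \<in> test_functions \<Longrightarrow> supp \<phi> \<subseteq> W \<Longrightarrow> f \<phi> = (0::real)"
  shows "f \<phi> = 0"
proof -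
  have "\<forall>x\<in>supp \<phi>. \<exists>W\<in>\<W>. x \<in> W" using \<phi>(2) by blast
  then obtain V where V: "\<And>x. x \<in> supp \<phi> \<Longrightarrow> V x \<in> \<W> \<and> x \<in> V x" by metis
  obtain P r where P: "finite P" "P \<subseteq> supp \<phi>" "\<And>p. r p > 0" "\<And>p. p \<in> P \<Longrightarrow> cball p (2 * r p) \<subseteq> V p"
    "supp \<phi> \<subseteq> (\<Union>p\<in>P. ball p (r p))"
    by (rule compact_bump_cover[OF test_compact[OF \<phi>(1)], of V]) (use V \<phi> in auto)
  have "f \<phi> = f (\<lambda>x. \<phi> x * (\<Prod>p\<in>Q. 1 - bump p (r p) x))" if "Q \<subseteq> P" for Q
    using finite_subset[OF that P(1)] that
  proof (induction Q rule: finite_induct)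
    case (insert p Q)
    let ?g = "\<lambda>x. \<phi> x * (\<Prod>p\<in>Q. 1 - bump p (r p) x)"
    have g: "?g \<in> test_functions"
      by (intro test_mult \<phi> Ck_prod Ck_diff Ck_const Ck_bump P insert.hyps)
    have 1: "(\<lambda>x. ?g x * (1 - bump p (r p) x)) \<in> test_functions"
      by (intro test_mult g Ck_diff Ck_const Ck_bump P)
    have 2: "(\<lambda>x. ?g x * bump p (r p) x) \<in> test_functions"
      by (intro test_mult g Ck_bump P)
    have "supp (\<lambda>x. ?g x * bump p (r p) x) \<subseteq> cball p (2 * r p)"
      by (rule supp_subset) (use bump_nonzero_iff[OF P(3)[of p]] in \<open>auto simp: dist_commute less_imp_le\<close>)
    then have z: "f (\<lambda>x. ?g x * bump p (r p) x) = 0"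
      using zero[OF _ 2, of "V p"] V[of p] P insert.prems by blast
    have "f \<phi> = f ?g" using insert by simp
    also have "?g = (\<lambda>x. ?g x * (1 - bump p (r p) x) + ?g x * bump p (r p) x)"
      by (simp add: fun_eq_iff algebra_simps)
    also have "f \<dots> = f (\<lambda>x. ?g x * (1 - bump p (r p) x))"
      using add[OF 1 2] z by simp
    finally show ?case using insert.hyps by (simp add: ac_simps)
  qed simp
  from this[OF subset_refl] have "f \<phi> = f (\<lambda>x. \<phi> x * (\<Prod>p\<in>P. 1 - bump p (r p) x))" .
  also have "(\<lambda>x. \<phi> x * (\<Prod>p\<in>P. 1 - bump p (r p) x)) = (\<lambda>x. \<phi> x + -1 * \<phi> x)"
  proof
    fix x
    show "\<phi> x * (\<Prod>p\<in>P. 1 - bump p (r p) x) = \<phi> x + -1 * \<phi> x"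
    proof (cases "x \<in> supp \<phi>")
      case True
      with P(5) obtain p where "p \<in> P" "bump p (r p) x = 1"
        using bump_eq_1[OF P(3)] by (auto simp: dist_commute less_imp_le)
      then have "(\<Prod>p\<in>P. 1 - bump p (r p) x) = 0" using P(1) by auto
      then show ?thesis by simp
    qed (simp add: not_in_suppD)
  qed
  also have "\<dots> = (\<lambda>x. 0)" by simp
  also have "f (\<lambda>x. 0) = 0"
    using add[of "\<lambda>x. 0" "\<lambda>x. 0"] test_scale[OF \<phi>(1), of 0] by simp
  finally show ?thesis .
qed

section \<open>Square-integrable functions\<close>

text \<open>A real inner product also for complex values, where \<open>inner\<close> is the real
  part of the Hermitian product. This suffices, as complex fields are only measured by their norm
  and otherwise split into components.\<close>

definition l2ip :: "(plane \<Rightarrow> 'b::euclidean_space) \<Rightarrow> (plane \<Rightarrow> 'b) \<Rightarrow> real" where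
  "l2ip F G = (\<integral>x. F x \<bullet> G x \<partial>lebesgue)"

definition l2n :: "(plane \<Rightarrow> 'b::euclidean_space) \<Rightarrow> real" where
  "l2n F = sqrt (l2ip F F)"

lemma L2_iff: "F \<in> L2 \<longleftrightarrow> F \<in> borel_measurable lebesgue \<and> integrable lebesgue (\<lambda>x. F x \<bullet> F x)"
  by (simp add: L2_def power2_norm_eq_inner)

lemma L2_measurable: "F \<in> L2 \<Longrightarrow> F \<in> borel_measurable lebesgue"
  by (simp add: L2_iff)

lemma inner_le_sum_squares: "\<bar>x \<bullet> y\<bar> \<le> x \<bullet> x + (y::'b::real_inner) \<bullet> y"
proof -
  have "0 \<le> (x - y) \<bullet> (x - y)" "0 \<le> (x + y) \<bullet> (x + y)" by simp_all
  then have "\<bar>2 * (x \<bullet> y)\<bar> \<le> x \<bullet> x + y \<bullet> y"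
    by (simp add: inner_simps inner_commute)
  moreover have "0 \<le> x \<bullet> x + y \<bullet> y" by simp
  ultimately show ?thesis by linarith
qed

lemma L2_integrable_inner:
  assumes "F \<in> L2" "G \<in> L2" shows "integrable lebesgue (\<lambda>x. F x \<bullet> G x)"
proof (rule Bochner_Integration.integrable_bound)
  show "integrable lebesgue (\<lambda>x. F x \<bullet> F x + G x \<bullet> G x)"
    using assms by (simp add: L2_iff)
  show "AE x in lebesgue. norm (F x \<bullet> G x) \<le> norm (F x \<bullet> F x + G x \<bullet> G x)"
    using inner_le_sum_squares by (intro AE_I2) (simp only: real_norm_def, rule order_trans[OF _ abs_ge_self])
qed (intro borel_measurable_inner L2_measurable assms)

lemma L2_add: assumes "F \<in> L2" "G \<in> L2" shows "(\<lambda>x. F x + G x) \<in> L2"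
  using assms L2_integrable_inner[OF assms] L2_integrable_inner[OF assms(2,1)]
  by (auto simp: L2_iff inner_simps intro!: borel_measurable_add)

lemma L2_scaleR: "F \<in> L2 \<Longrightarrow> (\<lambda>x. c *\<^sub>R F x) \<in> L2"
  by (auto simp: L2_iff intro!: borel_measurable_scaleR)

lemma L2_diff: assumes "F \<in> L2" "G \<in> L2" shows "(\<lambda>x. F x - G x) \<in> L2"
  using L2_add[OF assms(1) L2_scaleR[OF assms(2), of "-1"]] by simp

lemma L2_zero: "(\<lambda>x. 0) \<in> L2"
  by (simp add: L2_iff)

lemma l2ip_commute: "l2ip F G = l2ip G F"
  by (simp add: l2ip_def inner_commute)

lemma l2ip_add:
  assumes "F \<in> L2" "G \<in> L2" "H \<in> L2"
  shows "l2ip (\<lambda>x. F x + G x) H = l2ip F H + l2ip G H"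
    "l2ip H (\<lambda>x. F x + G x) = l2ip H F + l2ip H G"
  using assms by (simp_all add: l2ip_def inner_simps L2_integrable_inner)

lemma l2ip_diff:
  assumes "F \<in> L2" "G \<in> L2" "H \<in> L2"
  shows "l2ip (\<lambda>x. F x - G x) H = l2ip F H - l2ip G H"
    "l2ip H (\<lambda>x. F x - G x) = l2ip H F - l2ip H G"
  using assms by (simp_all add: l2ip_def inner_simps L2_integrable_inner)

lemma l2ip_scaleR:
  "l2ip (\<lambda>x. c *\<^sub>R F x) H = c * l2ip F H" "l2ip H (\<lambda>x. c *\<^sub>R F x) = c * l2ip H F"
  by (simp_all add: l2ip_def)

lemma l2ip_self_nonneg: "0 \<le> l2ip F F"
  by (simp add: l2ip_def)

lemma l2n_nonneg: "0 \<le> l2n F"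
  by (simp add: l2n_def l2ip_self_nonneg)

lemma l2n_sq: "(l2n F)\<^sup>2 = l2ip F F"
  by (simp add: l2n_def l2ip_self_nonneg)

text \<open>Functions are not identified modulo null sets, so \<open>L2\<close> is no inner product
  type and the inequality is derived from the nonnegative quadratic form in \<open>s\<close> and
  \<open>t\<close>.\<close>

lemma l2ip_Cauchy_Schwarz:
  assumes "F \<in> L2" "G \<in> L2" shows "\<bar>l2ip F G\<bar> \<le> l2n F * l2n G"
proof -
  have quad: "0 \<le> s\<^sup>2 * l2ip F F + 2 * s * t * l2ip F G + t\<^sup>2 * l2ip G G" for s t
  proof -
    have "0 \<le> l2ip (\<lambda>x. s *\<^sub>R F x + t *\<^sub>R G x) (\<lambda>x. s *\<^sub>R F x + t *\<^sub>R G x)"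
      by (rule l2ip_self_nonneg)
    also have "\<dots> = s\<^sup>2 * l2ip F F + 2 * s * t * l2ip F G + t\<^sup>2 * l2ip G G"
      using assms by (simp add: l2ip_add l2ip_scaleR L2_add L2_scaleR l2ip_commute[of G F]
        power2_eq_square algebra_simps)
    finally show ?thesis .
  qed
  have "(l2ip F G)\<^sup>2 \<le> l2ip F F * l2ip G G"
  proof (cases "l2ip G G = 0")
    case True
    have "l2ip F G = 0"
    proof (rule ccontr)
      assume nz: "l2ip F G \<noteq> 0"
      \<comment> \<open>For degenerate \<open>G\<close> the form is affine in \<open>t\<close>; this
        value of \<open>t\<close> would make it -1.\<close>
      have "0 \<le> l2ip F F + 2 * (- (l2ip F F + 1) / (2 * l2ip F G)) * l2ip F G"
        using quad[of 1 "- (l2ip F F + 1) / (2 * l2ip F G)"] True by simp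
      also have "\<dots> = -1" using nz by (simp add: field_simps)
      finally show False by simp
    qed
    then show ?thesis using True by simp
  next
    case False
    then have pos: "l2ip G G > 0" using l2ip_self_nonneg[of G] by simp
    \<comment> \<open>The minimizing ratio of \<open>t\<close> to \<open>s\<close>, scaled so that
      no division occurs.\<close>
    have "0 \<le> l2ip G G * (l2ip F F * l2ip G G - (l2ip F G)\<^sup>2)"
      using quad[of "l2ip G G" "- l2ip F G"] by (simp add: power2_eq_square algebra_simps)
    then show ?thesis using pos by (simp add: zero_le_mult_iff)
  qed
  then have "sqrt ((l2ip F G)\<^sup>2) \<le> sqrt (l2ip F F * l2ip G G)" by (rule real_sqrt_le_mono)
  then show ?thesis by (simp add: l2n_def real_sqrt_mult)
qed

lemma l2n_add_le:
  assumes "F \<in> L2" "G \<in> L2" shows "l2n (\<lambda>x. F x + G x) \<le> l2n F + l2n G"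
proof (rule power2_le_imp_le)
  have "(l2n (\<lambda>x. F x + G x))\<^sup>2 = l2ip F F + 2 * l2ip F G + l2ip G G"
    using assms by (simp add: l2n_sq l2ip_add L2_add l2ip_commute[of G F])
  also have "\<dots> \<le> (l2n F + l2n G)\<^sup>2"
    using l2ip_Cauchy_Schwarz[OF assms] by (simp add: power2_sum l2n_sq)
  finally show "(l2n (\<lambda>x. F x + G x))\<^sup>2 \<le> (l2n F + l2n G)\<^sup>2" .
qed (simp add: l2n_nonneg)

lemma l2n_scaleR: "l2n (\<lambda>x. c *\<^sub>R F x) = \<bar>c\<bar> * l2n F"
  by (simp add: l2n_def l2ip_scaleR real_sqrt_mult flip: mult.assoc)

lemma l2n_minus_commute: "l2n (\<lambda>x. F x - G x) = l2n (\<lambda>x. G x - F x)"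
  using l2n_scaleR[of "-1" "\<lambda>x. F x - G x"] by simp

lemma l2n_triangle:
  assumes "F \<in> L2" "G \<in> L2" "H \<in> L2"
  shows "l2n (\<lambda>x. F x - H x) \<le> l2n (\<lambda>x. F x - G x) + l2n (\<lambda>x. G x - H x)"
  using l2n_add_le[OF L2_diff[OF assms(1,2)] L2_diff[OF assms(2,3)]] by simp

lemma l2ip_self_zero_AE:
  assumes "F \<in> L2" "l2ip F F = 0" shows "AE x in lebesgue. F x = 0"
  using assms integral_nonneg_eq_0_iff_AE[of lebesgue "\<lambda>x. F x \<bullet> F x"]
  by (simp add: L2_iff l2ip_def)

lemma l2ip_cong_AE:
  assumes "AE x in lebesgue. F x = F' x" "AE x in lebesgue. G x = G' x"
    "F \<in> L2" "F' \<in> L2" "G \<in> L2" "G' \<in> L2"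
  shows "l2ip F G = l2ip F' G'"
  unfolding l2ip_def using assms by (intro integral_cong_AE borel_measurable_inner L2_measurable) auto

lemma nn_integral_L2:
  assumes "F \<in> L2" shows "(\<integral>\<^sup>+x. ennreal ((norm (F x))\<^sup>2) \<partial>lebesgue) = ennreal (l2ip F F)"
  using nn_integral_eq_integral[of lebesgue "\<lambda>x. F x \<bullet> F x"] assms
  by (simp add: L2_iff l2ip_def power2_norm_eq_inner)

lemma L2_nn_integral_bound:
  assumes "F \<in> borel_measurable lebesgue" "c \<ge> 0"
    "(\<integral>\<^sup>+x. ennreal ((norm (F x))\<^sup>2) \<partial>lebesgue) \<le> ennreal c"
  shows "F \<in> L2" "l2ip F F \<le> c"
proof -
  have "integrable lebesgue (\<lambda>x. (norm (F x))\<^sup>2)"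
    using assms by (intro integrableI_bounded) (auto simp: le_less_trans[OF _ ennreal_less_top])
  then show L2: "F \<in> L2" using assms by (simp add: L2_def)
  show "l2ip F F \<le> c" using assms nn_integral_L2[OF L2] by simp
qed

lemma L2_cong_AE:
  assumes "F \<in> L2" "AE x in lebesgue. F x = G x" "G \<in> borel_measurable lebesgue"
  shows "G \<in> L2"
proof -
  have "integrable lebesgue (\<lambda>x. F x \<bullet> F x) \<longleftrightarrow> integrable lebesgue (\<lambda>x. G x \<bullet> G x)"
    using assms L2_measurable[OF assms(1)] by (intro integrable_cong_AE) auto
  then show ?thesis using assms by (simp add: L2_iff)
qed

lemma integrable_bound_all:
  fixes f :: "'a \<Rightarrow> 'b::{banach, second_countable_topology}"
    and g :: "'a \<Rightarrow> 'c::{banach, second_countable_topology}"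
  assumes "integrable M f" "g \<in> borel_measurable M" "\<And>x. norm (g x) \<le> norm (f x)"
  shows "integrable M g"
  using assms by (intro Bochner_Integration.integrable_bound[OF assms(1)]) auto

lemma L2_compare_scaled:
  fixes F :: "plane \<Rightarrow> 'b::euclidean_space" and G :: "plane \<Rightarrow> 'c::euclidean_space"
  assumes "F \<in> L2" "G \<in> borel_measurable lebesgue" "B \<ge> 0" "\<And>x. norm (G x) \<le> B * norm (F x)"
  shows "G \<in> L2" "l2n G \<le> B * l2n F"
proof -
  have int: "integrable lebesgue (\<lambda>x. B\<^sup>2 * (F x \<bullet> F x))" using assms(1) by (simp add: L2_iff)
  have le: "G x \<bullet> G x \<le> B\<^sup>2 * (F x \<bullet> F x)" for x
    using power_mono[OF assms(4), of x 2] by (simp add: power_mult_distrib power2_norm_eq_inner)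
  note [measurable] = assms(2)
  have int2: "integrable lebesgue (\<lambda>x. G x \<bullet> G x)"
    by (rule integrable_bound_all[OF int]) (measurable, use le in \<open>auto simp: abs_le_iff\<close>)
  then show "G \<in> L2" using assms(2) by (simp add: L2_iff)
  have "l2ip G G \<le> B\<^sup>2 * l2ip F F"
    using integral_mono[OF int2 int le] by (simp add: l2ip_def)
  from real_sqrt_le_mono[OF this] show "l2n G \<le> B * l2n F"
    using assms(3) by (simp add: l2n_def real_sqrt_mult)
qed

lemma L2_mult_bounded:
  fixes m :: "plane \<Rightarrow> real"
  assumes "F \<in> L2" "m \<in> borel_measurable lebesgue" "\<And>x. \<bar>m x\<bar> \<le> B"
  shows "(\<lambda>x. m x *\<^sub>R F x) \<in> L2" "l2n (\<lambda>x. m x *\<^sub>R F x) \<le> B * l2n F"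
proof -
  have m: "(\<lambda>x. m x *\<^sub>R F x) \<in> borel_measurable lebesgue"
    by (intro borel_measurable_scaleR L2_measurable assms)
  have B: "B \<ge> 0" using assms(3)[of 0] by simp
  have le: "norm (m x *\<^sub>R F x) \<le> B * norm (F x)" for x
    using assms(3)[of x] by (simp add: mult_right_mono)
  show "(\<lambda>x. m x *\<^sub>R F x) \<in> L2" "l2n (\<lambda>x. m x *\<^sub>R F x) \<le> B * l2n F"
    by (rule L2_compare_scaled[OF assms(1) m B le])+
qed

lemma L2_vec_nth:
  fixes F :: "plane \<Rightarrow> 'b::euclidean_space ^ 2"
  assumes "F \<in> L2" shows "(\<lambda>x. F x $ i) \<in> L2" "l2n (\<lambda>x. F x $ i) \<le> l2n F"
proof -
  have m: "(\<lambda>x. F x $ i) \<in> borel_measurable lebesgue"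
    by (rule measurable_compose[OF L2_measurable[OF assms] borel_measurable_continuous_onI])
      (intro continuous_intros)
  show "(\<lambda>x. F x $ i) \<in> L2" "l2n (\<lambda>x. F x $ i) \<le> l2n F"
    using L2_compare_scaled[OF assms m, of 1] by (simp_all add: Finite_Cartesian_Product.norm_nth_le)
qed

lemma L2_inner_const:
  fixes G :: "plane \<Rightarrow> 'b::euclidean_space"
  assumes "G \<in> L2" shows "(\<lambda>x. z \<bullet> G x) \<in> L2" "l2n (\<lambda>x. z \<bullet> G x) \<le> norm z * l2n G"
proof -
  have m: "(\<lambda>x. z \<bullet> G x) \<in> borel_measurable lebesgue"
    by (intro borel_measurable_inner borel_measurable_const L2_measurable assms)
  show "(\<lambda>x. z \<bullet> G x) \<in> L2" "l2n (\<lambda>x. z \<bullet> G x) \<le> norm z * l2n G"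
    using L2_compare_scaled[OF assms m, of "norm z"] Cauchy_Schwarz_ineq2[of z] by simp_all
qed

section \<open>Translations and reflections of the plane\<close>

text \<open>One statement for the translations (\<open>s = 1\<close>) and the reflections x -> z - x
  (\<open>s = -1\<close>) that convolutions require.\<close>

lemma lebesgue_distr_affine:
  assumes "\<bar>s\<bar> = (1::real)"
  shows "distr lebesgue lebesgue (\<lambda>x::plane. s *\<^sub>R x + z) = lebesgue"
    and "(\<lambda>x::plane. s *\<^sub>R x + z) \<in> lebesgue \<rightarrow>\<^sub>M lebesgue"
proof -
  have eq: "z + (\<Sum>j\<in>Basis. (s * (x \<bullet> j)) *\<^sub>R j) = s *\<^sub>R x + z" for x :: plane
    by (simp add: euclidean_representation flip: scaleR_scaleR scaleR_sum_right)
  show "(\<lambda>x::plane. s *\<^sub>R x + z) \<in> lebesgue \<rightarrow>\<^sub>M lebesgue"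
    using lebesgue_affine_measurable[of "\<lambda>_. s" z] assms by (simp add: eq)
  show "distr lebesgue lebesgue (\<lambda>x::plane. s *\<^sub>R x + z) = lebesgue"
    using lebesgue_affine_euclidean[of "\<lambda>_. s" z] assms by (simp add: eq density_1)
qed

lemma
  fixes h :: "plane \<Rightarrow> 'b::{banach, second_countable_topology}"
  assumes "h \<in> borel_measurable lebesgue" "\<bar>s\<bar> = (1::real)"
  shows lebesgue_integral_affine: "(\<integral>x. h (s *\<^sub>R x + z) \<partial>lebesgue) = (\<integral>x. h x \<partial>lebesgue)"
    and lebesgue_integrable_affine:
      "integrable lebesgue (\<lambda>x. h (s *\<^sub>R x + z)) \<longleftrightarrow> integrable lebesgue h"
  using lebesgue_distr_affine[OF assms(2), of z] assms
    integral_distr[of "\<lambda>x. s *\<^sub>R x + z" lebesgue lebesgue h]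
    integrable_distr_eq[of "\<lambda>x. s *\<^sub>R x + z" lebesgue lebesgue h] by auto

lemma nn_integral_lebesgue_affine:
  fixes h :: "plane \<Rightarrow> ennreal"
  assumes "h \<in> borel_measurable lebesgue" "\<bar>s\<bar> = (1::real)"
  shows "(\<integral>\<^sup>+x. h (s *\<^sub>R x + z) \<partial>lebesgue) = (\<integral>\<^sup>+x. h x \<partial>lebesgue)"
  using lebesgue_distr_affine[OF assms(2), of z] assms
    nn_integral_distr[of "\<lambda>x. s *\<^sub>R x + z" lebesgue lebesgue h] by simp

lemma ball_in_sets_lebesgue [measurable]: "ball (a :: 'a::euclidean_space) r \<in> sets lebesgue"
  by (simp add: borel_open)

section \<open>Completeness and the Riesz representation\<close>

text \<open>The constant may depend on the ball. For \<open>L2_complete\<close> it is the constant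
  1, but the potentials in \<open>wgrad_complete\<close> converge only locally, with constants that
  grow with the radius.\<close>

lemma riesz_fischer_local:
  fixes V :: "nat \<Rightarrow> plane \<Rightarrow> 'b::euclidean_space"
  assumes meas: "\<And>n. V n \<in> borel_measurable lebesgue"
    and bd: "\<And>(r::nat) n m. n \<le> m \<Longrightarrow>
      (\<integral>\<^sup>+x. ennreal ((norm (V m x - V n x))\<^sup>2) * indicator (ball 0 r) x \<partial>lebesgue) \<le> ennreal (C r * (1/4)^n)"
  obtains U where "U \<in> borel_measurable lebesgue"
    "\<And>(r::nat) n. (\<integral>\<^sup>+x. ennreal ((norm (U x - V n x))\<^sup>2) * indicator (ball 0 r) x \<partial>lebesgue)
       \<le> ennreal (C r * (1/4)^n)"
proof -
  note [measurable] = meas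
  define d where "d n x = norm (V (Suc n) x - V n x)" for n x
  \<comment> \<open>The squared increments have integrals of order (1/4)^n. Weighted by 2^n they
    still have a finite sum almost everywhere on the ball, and this weighted sum controls the sum of
    the increments themselves.\<close>
  have conv_r: "AE x in lebesgue. x \<in> ball 0 (real r) \<longrightarrow> convergent (\<lambda>n. V n x)" for r :: nat
  proof -
    have "(\<integral>\<^sup>+x. (\<Sum>n. ennreal (2^n * (d n x)\<^sup>2) * indicator (ball 0 (real r)) x) \<partial>lebesgue)
      = (\<Sum>n. \<integral>\<^sup>+x. ennreal (2^n * (d n x)\<^sup>2) * indicator (ball 0 (real r)) x \<partial>lebesgue)"
      unfolding d_def by (intro nn_integral_suminf) measurable
    also have "\<dots> = (\<Sum>n. ennreal (2^n) * (\<integral>\<^sup>+x. ennreal ((d n x)\<^sup>2) * indicator (ball 0 (real r)) x \<partial>lebesgue))"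
      unfolding d_def
      by (subst nn_integral_cmult[symmetric]) (simp_all add: ennreal_mult mult.assoc)
    also have "\<dots> \<le> (\<Sum>n. ennreal (\<bar>C r\<bar> * (1/2)^n))"
    proof (intro suminf_le summableI)
      fix n
      have "ennreal (2^n) * (\<integral>\<^sup>+x. ennreal ((d n x)\<^sup>2) * indicator (ball 0 (real r)) x \<partial>lebesgue)
          \<le> ennreal (2^n) * ennreal (\<bar>C r\<bar> * (1/4)^n)"
        unfolding d_def
        by (intro mult_left_mono order_trans[OF bd] ennreal_leI mult_right_mono) auto
      also have "\<dots> = ennreal (2^n * (\<bar>C r\<bar> * (1/4)^n))" by (simp add: ennreal_mult)
      also have "2^n * (\<bar>C r\<bar> * (1/4)^n) = \<bar>C r\<bar> * (2 * (1/4)) ^ n"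
        by (simp only: power_mult_distrib) simp
      finally show "ennreal (2^n) * (\<integral>\<^sup>+x. ennreal ((d n x)\<^sup>2) * indicator (ball 0 (real r)) x \<partial>lebesgue)
          \<le> ennreal (\<bar>C r\<bar> * (1/2)^n)" by simp
    qed
    also have "\<dots> < \<infinity>"
      by (subst suminf_ennreal2) (auto intro!: summable_mult summable_geometric)
    finally have "AE x in lebesgue. (\<Sum>n. ennreal (2^n * (d n x)\<^sup>2) * indicator (ball 0 (real r)) x) \<noteq> \<infinity>"
      unfolding d_def by (intro nn_integral_noteq_infinite) auto
    then show ?thesis
    proof (rule AE_mp, intro AE_I2 impI)
      fix x :: plane
      assume "(\<Sum>n. ennreal (2^n * (d n x)\<^sup>2) * indicator (ball 0 (real r)) x) \<noteq> \<infinity>" "x \<in> ball 0 (real r)"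
      then have "summable (\<lambda>n. 2^n * (d n x)\<^sup>2)"
        by (intro summable_suminf_not_top) auto
      then have "summable (\<lambda>n. 2^n * (d n x)\<^sup>2 + (1/2)^n)"
        by (intro summable_add summable_geometric) auto
      \<comment> \<open>Either the increment is at most (1/2)^n, or 2^n times it exceeds 1 and it is
        at most its weighted square.\<close>
      moreover have le: "d n x \<le> 2^n * (d n x)\<^sup>2 + (1/2)^n" for n
      proof (cases "d n x \<le> (1/2)^n")
        case True
        then show ?thesis by (simp add: add_increasing)
      next
        case False
        then have "2^n * (d n x * (1/2)^n) \<le> 2^n * (d n x * d n x)"
          by (intro mult_left_mono) (auto simp: d_def)
        then have "d n x \<le> 2^n * (d n x)\<^sup>2"
          by (simp add: power2_eq_square power_one_over)
        then show ?thesis by (simp add: add_increasing2)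
      qed
      ultimately have "summable (\<lambda>n. d n x)"
        using summable_comparison_test'[of "\<lambda>n. 2^n * (d n x)\<^sup>2 + (1/2)^n" 0 "\<lambda>n. d n x"]
        by (simp add: d_def)
      then have "summable (\<lambda>n. V (Suc n) x - V n x)"
        unfolding d_def by (rule summable_norm_cancel)
      then have "convergent (\<lambda>n. \<Sum>k<n. V (Suc k) x - V k x)"
        by (simp add: summable_iff_convergent)
      then have "convergent (\<lambda>n. V n x - V 0 x)" 
        using sum_lessThan_telescope[of "\<lambda>k. V k x"] by simp
      then have "convergent (\<lambda>n. (V n x - V 0 x) + V 0 x)"
        by (rule convergent_add) (rule convergent_const)
      then show "convergent (\<lambda>n. V n x)" by simp
    qed
  qed
  have "AE x in lebesgue. \<forall>r::nat. x \<in> ball 0 (real r) \<longrightarrow> convergent (\<lambda>n. V n x)"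
    using conv_r unfolding AE_all_countable by blast
  then have conv: "AE x in lebesgue. (\<lambda>n. V n x) \<longlonglongrightarrow> lim (\<lambda>n. V n x)"
  proof (rule AE_mp, intro AE_I2 impI)
    fix x :: plane
    assume *: "\<forall>r::nat. x \<in> ball 0 (real r) \<longrightarrow> convergent (\<lambda>n. V n x)"
    obtain r :: nat where "norm x < real r" using reals_Archimedean2 by blast
    with * have "convergent (\<lambda>n. V n x)" by auto
    then show "(\<lambda>n. V n x) \<longlonglongrightarrow> lim (\<lambda>n. V n x)" by (simp add: convergent_LIMSEQ_iff)
  qed
  define U where "U x = lim (\<lambda>n. V n x)" for x
  have U[measurable]: "U \<in> borel_measurable lebesgue"
    unfolding U_def by (rule borel_measurable_lim_metric) (rule meas)
  show ?thesis
  proof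
    fix r n :: nat
    let ?I = "\<lambda>x. indicator (ball 0 (real r)) x :: ennreal"
    \<comment> \<open>Fatou's lemma in \<open>m\<close> with \<open>n\<close> fixed, since the
      assumed bounds do not depend on \<open>m\<close>.\<close>
    have "(\<integral>\<^sup>+x. ennreal ((norm (U x - V n x))\<^sup>2) * ?I x \<partial>lebesgue)
      \<le> (\<integral>\<^sup>+x. liminf (\<lambda>m. ennreal ((norm (V m x - V n x))\<^sup>2) * ?I x) \<partial>lebesgue)"
    proof (rule nn_integral_mono_AE, rule AE_mp[OF conv], intro AE_I2 impI)
      fix x
      assume "(\<lambda>n. V n x) \<longlonglongrightarrow> lim (\<lambda>n. V n x)"
      then have "(\<lambda>m. (norm (V m x - V n x))\<^sup>2) \<longlonglongrightarrow> (norm (U x - V n x))\<^sup>2"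
        unfolding U_def by (intro tendsto_intros)
      then have "(\<lambda>m. ennreal ((norm (V m x - V n x))\<^sup>2)) \<longlonglongrightarrow> ennreal ((norm (U x - V n x))\<^sup>2)"
        by (rule tendsto_ennrealI)
      then have "(\<lambda>m. ennreal ((norm (V m x - V n x))\<^sup>2) * ?I x) \<longlonglongrightarrow> ennreal ((norm (U x - V n x))\<^sup>2) * ?I x"
        by (auto simp: indicator_def)
      from lim_imp_Liminf[OF _ this]
      show "ennreal ((norm (U x - V n x))\<^sup>2) * ?I x \<le> liminf (\<lambda>m. ennreal ((norm (V m x - V n x))\<^sup>2) * ?I x)"
        by simp
    qed
    also have "\<dots> \<le> liminf (\<lambda>m. \<integral>\<^sup>+x. ennreal ((norm (V m x - V n x))\<^sup>2) * ?I x \<partial>lebesgue)"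
      by (intro nn_integral_liminf) measurable
    also have "\<dots> \<le> ennreal (C r * (1/4)^n)"
      by (rule Liminf_le) (auto intro!: eventually_sequentiallyI[of n] bd)
    finally show "(\<integral>\<^sup>+x. ennreal ((norm (U x - V n x))\<^sup>2) * ?I x \<partial>lebesgue) \<le> ennreal (C r * (1/4)^n)" .
  qed (rule U)
qed

lemma nn_integral_balls_le:
  fixes h :: "plane \<Rightarrow> ennreal"
  assumes [measurable]: "h \<in> borel_measurable lebesgue"
    and "\<And>r::nat. (\<integral>\<^sup>+x. h x * indicator (ball 0 r) x \<partial>lebesgue) \<le> c"
  shows "(\<integral>\<^sup>+x. h x \<partial>lebesgue) \<le> c"
proof -
  have "h x = (SUP r::nat. h x * indicator (ball 0 (real r)) x)" for x
  proof (rule antisym)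
    obtain r :: nat where "norm x < real r" using reals_Archimedean2 by blast
    then have "h x = h x * indicator (ball 0 (real r)) x" by simp
    also have "\<dots> \<le> (SUP r::nat. h x * indicator (ball 0 (real r)) x)"
      by (rule SUP_upper) simp
    finally show "h x \<le> (SUP r::nat. h x * indicator (ball 0 (real r)) x)" .
  qed (auto intro!: SUP_least simp: indicator_def)
  then have "(\<integral>\<^sup>+x. h x \<partial>lebesgue) = (\<integral>\<^sup>+x. (SUP r::nat. h x * indicator (ball 0 (real r)) x) \<partial>lebesgue)"
    by simp
  also have "\<dots> = (SUP r::nat. \<integral>\<^sup>+x. h x * indicator (ball 0 (real r)) x \<partial>lebesgue)"
  proof (rule nn_integral_monotone_convergence_SUP)
    show "incseq (\<lambda>(r::nat) x. h x * indicator (ball 0 (real r)) x)"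
      by (auto simp: incseq_def le_fun_def indicator_def)
  qed measurable
  also have "\<dots> \<le> c" by (rule SUP_least) (rule assms)
  finally show ?thesis .
qed

text \<open>A geometric rate takes the place of the Cauchy property, so that no subsequence has to
  be extracted here; the minimizing sequence of the Riesz representation is chosen with exactly this
  rate.\<close>

lemma L2_complete:
  fixes h :: "nat \<Rightarrow> plane \<Rightarrow> 'b::euclidean_space"
  assumes h: "\<And>n. h n \<in> L2"
    and cauchy: "\<And>n m. n \<le> m \<Longrightarrow> l2ip (\<lambda>x. h m x - h n x) (\<lambda>x. h m x - h n x) \<le> (1/4)^n"
  obtains g where "g \<in> L2" "(\<lambda>n. l2n (\<lambda>x. h n x - g x)) \<longlonglongrightarrow> 0"
proof -
  note [measurable] = L2_measurable[OF h]
  have "(\<integral>\<^sup>+x. ennreal ((norm (h m x - h n x))\<^sup>2) * indicator (ball 0 (real r)) x \<partial>lebesgue) \<le> ennreal (1 * (1/4)^n)"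
    if "n \<le> m" for n m and r :: nat
  proof -
    have "(\<integral>\<^sup>+x. ennreal ((norm (h m x - h n x))\<^sup>2) * indicator (ball 0 (real r)) x \<partial>lebesgue)
        \<le> (\<integral>\<^sup>+x. ennreal ((norm (h m x - h n x))\<^sup>2) \<partial>lebesgue)"
      by (intro nn_integral_mono) (simp add: indicator_def)
    also have "\<dots> = ennreal (l2ip (\<lambda>x. h m x - h n x) (\<lambda>x. h m x - h n x))"
      by (rule nn_integral_L2) (intro L2_diff h)
    also have "\<dots> \<le> ennreal (1 * (1/4)^n)" using cauchy[OF that] by (simp add: ennreal_leI)
    finally show ?thesis .
  qed
  from riesz_fischer_local[of h "\<lambda>_. 1", OF L2_measurable[OF h] this]
  obtain g where [measurable]: "g \<in> borel_measurable lebesgue"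
    and g: "\<And>(r::nat) n. (\<integral>\<^sup>+x. ennreal ((norm (g x - h n x))\<^sup>2) * indicator (ball 0 r) x \<partial>lebesgue)
       \<le> ennreal (1 * (1/4)^n)"
    by blast
  have gn: "(\<integral>\<^sup>+x. ennreal ((norm (g x - h n x))\<^sup>2) \<partial>lebesgue) \<le> ennreal (1 * (1/4)^n)" for n
    by (rule nn_integral_balls_le[OF _ g]) measurable
  have d: "(\<lambda>x. g x - h n x) \<in> L2" "l2ip (\<lambda>x. g x - h n x) (\<lambda>x. g x - h n x) \<le> (1/4)^n" for n
    using L2_nn_integral_bound[OF _ _ gn, of n] by simp_all
  \<comment> \<open>So far only the differences are known to be in \<open>L2\<close>; adding
    \<open>h 0\<close> brings \<open>g\<close> back.\<close>
  have "(\<lambda>x. (g x - h 0 x) + h 0 x) \<in> L2" by (rule L2_add[OF d(1) h])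
  then have "g \<in> L2" by simp
  moreover have "(\<lambda>n. l2n (\<lambda>x. h n x - g x)) \<longlonglongrightarrow> 0"
  proof (rule Lim_null_comparison)
    show "\<forall>\<^sub>F n in sequentially. norm (l2n (\<lambda>x. h n x - g x)) \<le> (1/2)^n"
    proof (intro always_eventually allI)
      fix n
      have "((1/2::real)^n)\<^sup>2 = (1/4)^n"
        by (simp add: power2_eq_square flip: power_mult_distrib)
      then have "(l2n (\<lambda>x. g x - h n x))\<^sup>2 \<le> ((1/2)^n)\<^sup>2"
        using d(2)[of n] by (simp only: l2n_sq)
      then have "l2n (\<lambda>x. g x - h n x) \<le> (1/2)^n"
        by (rule power2_le_imp_le) simp
      then show "norm (l2n (\<lambda>x. h n x - g x)) \<le> (1/2)^n"
        using l2n_minus_commute[of "h n" g] l2n_nonneg[of "\<lambda>x. g x - h n x"] by simp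
    qed
    show "(\<lambda>n. (1/2)^n :: real) \<longlonglongrightarrow> 0" by (rule LIMSEQ_power_zero) simp
  qed
  ultimately show ?thesis using that by blast
qed

lemma l2ip_tendsto:
  assumes h: "\<And>n. h n \<in> L2" "g \<in> L2" "(\<lambda>n. l2n (\<lambda>x. h n x - g x)) \<longlonglongrightarrow> 0" "k \<in> L2"
  shows "(\<lambda>n. l2ip k (h n)) \<longlonglongrightarrow> l2ip k g"
proof -
  have "(\<lambda>n. l2ip k (h n) - l2ip k g) \<longlonglongrightarrow> 0"
  proof (rule Lim_null_comparison)
    show "\<forall>\<^sub>F n in sequentially. norm (l2ip k (h n) - l2ip k g) \<le> l2n k * l2n (\<lambda>x. h n x - g x)"
      using l2ip_Cauchy_Schwarz[OF h(4) L2_diff[OF h(1,2)]] h by (simp add: l2ip_diff)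
    show "(\<lambda>n. l2n k * l2n (\<lambda>x. h n x - g x)) \<longlonglongrightarrow> 0"
      using tendsto_mult_right_zero[OF h(3)] by simp
  qed
  then show ?thesis by (simp add: LIM_zero_iff)
qed

text \<open>The representing function minimizes \<open>\<parallel>h\<parallel>\<^sup>2 / 2 - L h\<close>; minimizing sequences are Cauchy by the
  parallelogram law.\<close>

lemma riesz_representation_L2:
  fixes S :: "(plane \<Rightarrow> 'b::euclidean_space) set"
  assumes S: "S \<subseteq> L2" "(\<lambda>x. 0) \<in> S"
    and S_add: "\<And>h k. h \<in> S \<Longrightarrow> k \<in> S \<Longrightarrow> (\<lambda>x. h x + k x) \<in> S"
    and S_scale: "\<And>c h. h \<in> S \<Longrightarrow> (\<lambda>x. c *\<^sub>R h x) \<in> S"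
    and closed: "\<And>h g. (\<And>n. h n \<in> S) \<Longrightarrow> g \<in> L2 \<Longrightarrow> (\<lambda>n. l2n (\<lambda>x. h n x - g x)) \<longlonglongrightarrow> 0 \<Longrightarrow> g \<in> S"
    and l_add: "\<And>h k. h \<in> S \<Longrightarrow> k \<in> S \<Longrightarrow> L (\<lambda>x. h x + k x) = L h + L k"
    and l_scale: "\<And>c h. h \<in> S \<Longrightarrow> L (\<lambda>x. c *\<^sub>R h x) = c * L h"
    and bound: "\<And>h. h \<in> S \<Longrightarrow> \<bar>L h\<bar> \<le> C * l2n h"
  obtains g where "g \<in> S" "\<And>h. h \<in> S \<Longrightarrow> L h = l2ip g h"
proof -
  have L2: "h \<in> S \<Longrightarrow> h \<in> L2" for h using S by blast
  define q where "q h = l2ip h h / 2 - L h" for h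
  have q_ge: "q h \<ge> - C\<^sup>2 / 2" if "h \<in> S" for h
  proof -
    have "(l2n h - C)\<^sup>2 \<ge> 0" by simp
    then show ?thesis using bound[OF that] unfolding q_def l2n_sq[symmetric] power2_diff
      by (simp add: field_simps abs_le_iff)
  qed
  have bdd: "bdd_below (q ` S)" using q_ge by (intro bdd_belowI2)
  let ?I = "Inf (q ` S)"
  have q_I: "?I \<le> q h" if "h \<in> S" for h using bdd that by (rule cINF_lower)
  \<comment> \<open>Two slacks of (1/4)^n / 8 add up to a quarter of (1/4)^n, which matches the
    factor 1/4 in \<open>par\<close> and yields the rate demanded by
    \<open>L2_complete\<close>.\<close>
  have "\<exists>h\<in>S. q h < ?I + (1/4)^n / 8" for n :: nat
    using cInf_lessD[of "q ` S" "?I + (1/4)^n / 8"] S by auto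
  then obtain h where h: "\<And>n. h n \<in> S" "\<And>n. q (h n) < ?I + (1/4)^n / 8" by metis
  have par: "q a + q b - 2 * q (\<lambda>x. (1/2) *\<^sub>R (a x + b x)) = l2ip (\<lambda>x. a x - b x) (\<lambda>x. a x - b x) / 4"
    if "a \<in> S" "b \<in> S" for a b
    using that L2[OF that(1)] L2[OF that(2)]
    by (simp add: q_def l_scale l_add S_add l2ip_scaleR l2ip_add l2ip_diff L2_add L2_diff
      l2ip_commute[of b a]) (simp add: field_simps)
  have cauchy: "l2ip (\<lambda>x. h m x - h n x) (\<lambda>x. h m x - h n x) \<le> (1/4)^n" if "n \<le> m" for n m
  proof -
    have "?I \<le> q (\<lambda>x. (1/2) *\<^sub>R (h m x + h n x))" by (intro q_I S_scale S_add h)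
    moreover have "(1/4::real)^m \<le> (1/4)^n" by (rule power_decreasing[OF that]) auto
    ultimately show ?thesis using par[OF h(1)[of m] h(1)[of n]] h(2)[of m] h(2)[of n] by linarith
  qed
  obtain g where g: "g \<in> L2" "(\<lambda>n. l2n (\<lambda>x. h n x - g x)) \<longlonglongrightarrow> 0"
    using L2_complete[of h, OF L2[OF h(1)] cauchy] by blast
  have gS: "g \<in> S" by (rule closed[OF h(1) g])
  have "q g \<le> ?I"
  proof (rule LIMSEQ_le_const)
    have 1: "q (h n) = q g + l2ip (\<lambda>x. h n x - g x) (\<lambda>x. h n x - g x) / 2
        + l2ip g (\<lambda>x. h n x - g x) - L (\<lambda>x. h n x - g x)" for n
    proof -
      have "L (\<lambda>x. h n x - g x) = L (h n) - L g"
        using l_add[OF h(1) S_scale[OF gS, of "-1"]] l_scale[OF gS, of "-1"] by simp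
      then show ?thesis using L2[OF h(1)] g
        by (simp add: q_def l2ip_diff L2_diff l2ip_commute[of "h n" g] field_simps)
    qed
    have 4: "L (\<lambda>x. h n x - g x) \<le> C * l2n (\<lambda>x. h n x - g x)" for n
      using bound[OF S_add[OF h(1) S_scale[OF gS, of "-1"]]] by (simp add: abs_le_iff)
    \<comment> \<open>Without the nonnegative quadratic term of \<open>1\<close>, the rest of the
      error is linear in the distance between \<open>h n\<close> and \<open>g\<close>, so
      \<open>q g\<close> does not exceed the infimum in the limit.\<close>
    have low: "q g - (l2n g + C) * l2n (\<lambda>x. h n x - g x) \<le> q (h n)" for n
      using 1[of n] 4[of n] l2ip_self_nonneg[of "\<lambda>x. h n x - g x"]
        l2ip_Cauchy_Schwarz[OF g(1) L2_diff[OF L2[OF h(1)[of n]] g(1)]]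
      by (simp add: abs_le_iff algebra_simps)
    have "q g \<le> ?I + (1/4)^n / 8 + (l2n g + C) * l2n (\<lambda>x. h n x - g x)" for n
      using low[of n] h(2)[of n] by linarith
    then show "\<exists>N. \<forall>n\<ge>N. q g \<le> ?I + (1/4)^n / 8 + (l2n g + C) * l2n (\<lambda>x. h n x - g x)" by blast
    have "(\<lambda>n. ?I + (1/4)^n / 8 + (l2n g + C) * l2n (\<lambda>x. h n x - g x)) \<longlonglongrightarrow> ?I + 0 / 8 + (l2n g + C) * 0"
      by (intro tendsto_intros LIMSEQ_power_zero g) auto
    then show "(\<lambda>n. ?I + (1/4)^n / 8 + (l2n g + C) * l2n (\<lambda>x. h n x - g x)) \<longlonglongrightarrow> ?I" by simp
  qed
  have "L k = l2ip g k" if k: "k \<in> S" for k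
  proof -
    define D where "D = l2ip g k - L k"
    have var: "0 \<le> t * D + t\<^sup>2 * (l2ip k k / 2)" for t
    proof -
      have "q g \<le> q (\<lambda>x. g x + t *\<^sub>R k x)"
        using \<open>q g \<le> ?I\<close> q_I[OF S_add[OF gS S_scale[OF k]], of t] by linarith
      also have "\<dots> = q g + t * D + t\<^sup>2 * (l2ip k k / 2)"
        using L2[OF k] g gS k
        by (simp add: q_def D_def l_add l_scale S_scale l2ip_add l2ip_scaleR L2_add L2_scaleR
          l2ip_commute[of k g] power2_eq_square) (simp add: field_simps)
      finally show ?thesis by simp
    qed
    have complete_square: "(- D / q) * D + (- D / q)\<^sup>2 * (q / 2) = - (D\<^sup>2) / (2 * q)" if "q > 0" for q
      using that by (simp add: power2_eq_square field_simps)
    \<comment> \<open>The optimal step of the quadratic in \<open>t\<close> is - D divided by the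
      squared norm of \<open>k\<close>; adding 1 keeps the divisor positive when \<open>k\<close>
      vanishes almost everywhere.\<close>
    let ?Q = "l2ip k k + 1"
    have K: "?Q > 0" using l2ip_self_nonneg[of k] by linarith
    have "0 \<le> (- D / ?Q) * D + (- D / ?Q)\<^sup>2 * (l2ip k k / 2)" by (rule var)
    also have "\<dots> \<le> (- D / ?Q) * D + (- D / ?Q)\<^sup>2 * (?Q / 2)"
      by (intro add_left_mono mult_left_mono) auto
    also have "\<dots> = - (D\<^sup>2) / (2 * ?Q)" by (rule complete_square[OF K])
    finally have "D\<^sup>2 / (2 * ?Q) \<le> 0" by simp
    then have "D = 0" using K by (simp add: divide_le_0_iff)
    then show ?thesis by (simp add: D_def)
  qed
  with gS that show ?thesis by blast
qed

text \<open>For real values \<open>simp\<close> turns \<open>scaleR\<close> into multiplication, and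
  then \<open>l2ip_scaleR\<close> no longer matches.\<close>

lemma l2ip_mult:
  fixes F H :: "plane \<Rightarrow> real"
  shows "l2ip (\<lambda>x. c * F x) H = c * l2ip F H" "l2ip H (\<lambda>x. c * F x) = c * l2ip H F"
  using l2ip_scaleR(1)[of c F H] by (simp_all add: l2ip_commute[of H])

lemma integrable_indicator_ball: "integrable lebesgue (indicator (ball (a::plane) r) :: plane \<Rightarrow> real)"
  using emeasure_lborel_ball_finite[of a r]
  by (intro integrable_real_indicator) (simp_all add: ball_in_sets_lebesgue)

section \<open>Local square integrability\<close>

lemma L2_locI:
  assumes "F \<in> borel_measurable lebesgue"
    "\<And>r. integrable lebesgue (\<lambda>x. indicator (ball 0 r) x * (norm (F x))\<^sup>2)"
  shows "F \<in> L2_loc"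
  unfolding L2_loc_def
proof (intro CollectI conjI allI impI assms)
  fix K :: "plane set" assume K: "compact K"
  from compact_imp_bounded[OF K] obtain r where r: "K \<subseteq> ball 0 r"
    using bounded_subset_ballD by blast
  have [measurable]: "K \<in> sets lebesgue" using K by (simp add: borel_compact)
  note [measurable] = assms(1)
  show "set_integrable lebesgue K (\<lambda>x. (norm (F x))\<^sup>2)"
    unfolding set_integrable_def
    by (rule integrable_bound_all[OF assms(2)[of r]]) (measurable, use r in \<open>auto simp: indicator_def\<close>)
qed

lemma L2_loc_measurable: "F \<in> L2_loc \<Longrightarrow> F \<in> borel_measurable lebesgue"
  by (simp add: L2_loc_def)

lemma L2_loc_mult_L2:
  assumes F: "F \<in> L2_loc" and m: "m \<in> borel_measurable lebesgue" "\<And>x. \<bar>m x\<bar> \<le> B"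
    and supp: "\<And>x. r \<le> norm x \<Longrightarrow> m x = (0::real)"
  shows "(\<lambda>x. m x *\<^sub>R F x) \<in> L2"
proof -
  note [measurable] = m(1) L2_loc_measurable[OF F]
  have "integrable lebesgue (\<lambda>x. B\<^sup>2 * (indicator (cball 0 r) x * (norm (F x))\<^sup>2))"
    using F by (intro integrable_mult_right) (auto simp: L2_loc_def set_integrable_def)
  then have "integrable lebesgue (\<lambda>x. (norm (m x *\<^sub>R F x))\<^sup>2)"
  proof (rule Bochner_Integration.integrable_bound)
    show "AE x in lebesgue. norm ((norm (m x *\<^sub>R F x))\<^sup>2)
        \<le> norm (B\<^sup>2 * (indicator (cball 0 r) x * (norm (F x))\<^sup>2))"
    proof (rule AE_I2)
      fix x
      have "(m x)\<^sup>2 \<le> B\<^sup>2" using m(2)[of x] by (metis abs_le_square_iff abs_ge_zero abs_of_nonneg order_trans)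
      then show "norm ((norm (m x *\<^sub>R F x))\<^sup>2) \<le> norm (B\<^sup>2 * (indicator (cball 0 r) x * (norm (F x))\<^sup>2))"
        using supp[of x] by (cases "norm x \<le> r") (auto simp: power_mult_distrib mult_right_mono)
    qed
  qed measurable
  then show ?thesis by (simp add: L2_def)
qed

lemma L2_bounded_support_integrable:
  assumes h: "h \<in> L2" and supp: "\<And>x. r \<le> norm x \<Longrightarrow> h x = 0"
  shows "integrable lebesgue h"
proof -
  note [measurable] = L2_measurable[OF h]
  have "integrable lebesgue (\<lambda>x. indicator (ball 0 r) x + (norm (h x))\<^sup>2 :: real)"
    using h by (intro Bochner_Integration.integrable_add integrable_indicator_ball) (simp add: L2_def)
  then show ?thesis
  proof (rule Bochner_Integration.integrable_bound)
    show "AE x in lebesgue. norm (h x) \<le> norm (indicator (ball 0 r) x + (norm (h x))\<^sup>2 :: real)"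
    proof (rule AE_I2)
      fix x
      have "norm (h x) \<le> 1 + (norm (h x))\<^sup>2"
        using inner_le_sum_squares[of "norm (h x)" 1] by (simp add: power2_eq_square)
      then show "norm (h x) \<le> norm (indicator (ball 0 r) x + (norm (h x))\<^sup>2 :: real)"
        using supp[of x] by (cases "norm x < r") auto
    qed
  qed measurable
qed

lemma L2_loc_mult_integrable:
  assumes "F \<in> L2_loc" "m \<in> borel_measurable lebesgue" "\<And>x. \<bar>m x\<bar> \<le> B"
    "\<And>x. r \<le> norm x \<Longrightarrow> m x = (0::real)"
  shows "integrable lebesgue (\<lambda>x. m x *\<^sub>R F x)"
  by (rule L2_bounded_support_integrable[where r = r, OF L2_loc_mult_L2[OF assms]]) (simp_all add: assms(4))

lemma L2_imp_L2_loc: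
  assumes "F \<in> L2" shows "F \<in> L2_loc"
proof (rule L2_locI)
  note [measurable] = L2_measurable[OF assms]
  show "integrable lebesgue (\<lambda>x. indicator (ball 0 r) x * (norm (F x))\<^sup>2)" for r
    by (rule integrable_bound_all[of _ "\<lambda>x. (norm (F x))\<^sup>2"])
      (use assms in \<open>simp add: L2_def\<close>, measurable, simp add: indicator_def)
qed (rule L2_measurable[OF assms])

lemma L2_loc_cut:
  assumes "F \<in> L2_loc" shows "(\<lambda>x. indicator (ball 0 r) x *\<^sub>R F x) \<in> L2"
  by (rule L2_loc_mult_L2[OF assms borel_measurable_indicator, of _ 1 r])
    (use ball_in_sets_lebesgue in \<open>auto simp: indicator_def\<close>)

lemma L2_locI_cut:
  assumes "F \<in> borel_measurable lebesgue" "\<And>r::nat. (\<lambda>x. indicator (ball 0 (real r)) x *\<^sub>R F x) \<in> L2"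
  shows "F \<in> L2_loc"
proof (rule L2_locI[OF assms(1)])
  fix r :: real
  obtain n :: nat where n: "r < real n" using reals_Archimedean2 by blast
  note [measurable] = assms(1)
  show "integrable lebesgue (\<lambda>x. indicator (ball 0 r) x * (norm (F x))\<^sup>2)"
    by (rule integrable_bound_all[of _ "\<lambda>x. (norm (indicator (ball 0 (real n)) x *\<^sub>R F x))\<^sup>2"])
      (use assms(2)[of n] in \<open>simp add: L2_def\<close>, measurable, use n in \<open>auto simp: indicator_def\<close>)
qed

lemma L2_loc_add:
  assumes "F \<in> L2_loc" "G \<in> L2_loc" shows "(\<lambda>x. F x + G x) \<in> L2_loc"
  using L2_add[OF assms[THEN L2_loc_cut]] assms[THEN L2_loc_measurable]
  by (intro L2_locI_cut borel_measurable_add) (simp_all add: scaleR_add_right)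

lemma L2_loc_scaleR:
  assumes "F \<in> L2_loc" shows "(\<lambda>x. c *\<^sub>R F x) \<in> L2_loc"
  using L2_scaleR[OF L2_loc_cut[OF assms]] assms[THEN L2_loc_measurable]
  by (intro L2_locI_cut borel_measurable_scaleR) (simp_all add: mult.commute)

lemma L2_loc_const: "(\<lambda>x. c) \<in> L2_loc"
  by (rule L2_locI) (auto intro!: integrable_mult_left integrable_indicator_ball)

lemma L2_loc_diff:
  assumes "F \<in> L2_loc" "G \<in> L2_loc" shows "(\<lambda>x. F x - G x) \<in> L2_loc"
  using L2_loc_add[OF assms(1) L2_loc_scaleR[OF assms(2), of "-1"]] by simp

lemma L2_loc_cong_AE:
  assumes "F \<in> L2_loc" "AE x in lebesgue. F x = G x" "G \<in> borel_measurable lebesgue"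
  shows "G \<in> L2_loc"
proof (rule L2_locI_cut[OF assms(3)])
  note [measurable] = assms(3)
  show "(\<lambda>x. indicator (ball 0 (real r)) x *\<^sub>R G x) \<in> L2" for r :: nat
    by (rule L2_cong_AE[OF L2_loc_cut[OF assms(1), of r]]) (use assms(2) in auto)
qed

lemma L2_loc_affine:
  assumes F: "F \<in> L2_loc" and s: "\<bar>s\<bar> = (1::real)"
  shows "(\<lambda>x. F (s *\<^sub>R x + z)) \<in> L2_loc"
proof (rule L2_locI)
  note [measurable] = L2_loc_measurable[OF F] lebesgue_distr_affine(2)[OF s]
  show "(\<lambda>x. F (s *\<^sub>R x + z)) \<in> borel_measurable lebesgue" by measurable
  fix r :: real
  have [measurable]: "cball z r \<in> sets lebesgue" by simp
  have "integrable lebesgue (\<lambda>x. indicator (cball z r) x * (norm (F x))\<^sup>2)"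
    using F by (auto simp: L2_loc_def set_integrable_def)
  then have "integrable lebesgue (\<lambda>x. indicator (cball z r) (s *\<^sub>R x + z) * (norm (F (s *\<^sub>R x + z)))\<^sup>2)"
    using lebesgue_integrable_affine[OF _ s, of "\<lambda>x. indicator (cball z r) x * (norm (F x))\<^sup>2" z] by simp
  then show "integrable lebesgue (\<lambda>x. indicator (ball 0 r) x * (norm (F (s *\<^sub>R x + z)))\<^sup>2)"
    by (rule integrable_bound_all) (measurable, use s in \<open>auto simp: indicator_def dist_norm\<close>)
qed

lemma test_measurable: "\<phi> \<in> test_functions \<Longrightarrow> \<phi> \<in> borel_measurable lebesgue"
  using borel_measurable_continuous_onI[OF test_continuous[of \<phi> UNIV]]
  by (simp add: measurable_completion)

lemma test_L2_loc_mult: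
  assumes "\<phi> \<in> test_functions" "F \<in> L2_loc"
  shows "(\<lambda>x. \<phi> x *\<^sub>R F x) \<in> L2" "integrable lebesgue (\<lambda>x. \<phi> x *\<^sub>R F x)"
proof -
  obtain B where B: "\<And>x. \<bar>\<phi> x\<bar> \<le> B" using test_bounded[OF assms(1)] by blast
  obtain r where r: "\<And>x. r \<le> norm x \<Longrightarrow> \<phi> x = 0" using test_bounded_supp[OF assms(1)] by blast
  show "(\<lambda>x. \<phi> x *\<^sub>R F x) \<in> L2" "integrable lebesgue (\<lambda>x. \<phi> x *\<^sub>R F x)"
    using L2_loc_mult_L2[OF assms(2) test_measurable[OF assms(1)] B r]
      L2_loc_mult_integrable[OF assms(2) test_measurable[OF assms(1)] B r] by auto
qed

lemma test_L2: "\<phi> \<in> test_functions \<Longrightarrow> \<phi> \<in> L2"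
  using test_L2_loc_mult(1)[OF _ L2_loc_const[of "1::real"]] by simp

lemma test_integrable: "\<phi> \<in> test_functions \<Longrightarrow> integrable lebesgue \<phi>"
  using test_L2_loc_mult(2)[OF _ L2_loc_const[of "1::real"]] by simp

section \<open>The fundamental lemma, density of test functions, and duality\<close>

text \<open>The indicator of \<open>K\<close> is the pointwise limit of cutoffs supported in
  shrinking neighbourhoods of \<open>K\<close>. They all live in one ball, on which \<open>D\<close>
  is integrable, so dominated convergence applies.\<close>

lemma compact_set_integral_zero:
  fixes D :: "plane \<Rightarrow> real"
  assumes D: "D \<in> L2_loc" "\<And>\<phi>. \<phi> \<in> test_functions \<Longrightarrow> (\<integral>x. \<phi> x * D x \<partial>lebesgue) = 0"
    and K: "compact K"
  shows "(\<integral>x. indicator K x * D x \<partial>lebesgue) = 0"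
proof -
  define V where "V n = (\<Union>x\<in>K. ball x (1 / real (Suc n)))" for n
  have "\<exists>\<zeta>. \<zeta> \<in> test_functions \<and> (\<forall>x\<in>K. \<zeta> x = 1) \<and> (\<forall>x. 0 \<le> \<zeta> x \<and> \<zeta> x \<le> 1) \<and> supp \<zeta> \<subseteq> V n" for n
  proof -
    have "open (V n)" "K \<subseteq> V n" by (auto simp: V_def)
    from smooth_urysohn[OF K this] show ?thesis by (metis subsetD)
  qed
  then obtain \<zeta> where \<zeta>: "\<And>n. \<zeta> n \<in> test_functions" "\<And>n x. x \<in> K \<Longrightarrow> \<zeta> n x = 1"
    "\<And>n x. 0 \<le> \<zeta> n x" "\<And>n x. \<zeta> n x \<le> 1" "\<And>n. supp (\<zeta> n) \<subseteq> V n" by metis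
  obtain R where R: "\<And>x. x \<in> K \<Longrightarrow> norm x \<le> R"
    using compact_imp_bounded[OF K] by (auto simp: bounded_iff)
  have out: "\<zeta> n x = 0" if "norm x \<ge> R + 1" for n x
  proof (rule ccontr)
    assume "\<zeta> n x \<noteq> 0"
    then have "x \<in> V n" using \<zeta>(5) not_in_suppD by blast
    then obtain y where y: "y \<in> K" "dist y x < 1 / real (Suc n)" by (auto simp: V_def)
    then have "norm x \<le> norm y + dist y x" by (metis dist_commute dist_norm norm_triangle_sub)
    moreover have "1 / real (Suc n) \<le> 1" by simp
    ultimately show False using R[OF y(1)] y(2) that by linarith
  qed
  have [measurable]: "K \<in> sets lebesgue" using K by (simp add: borel_compact)
  note [measurable] = test_measurable[OF \<zeta>(1)] L2_loc_measurable[OF D(1)]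
  have w: "integrable lebesgue (\<lambda>x. \<bar>indicator (ball 0 (R + 1)) x * D x\<bar>)"
    using L2_bounded_support_integrable[OF L2_loc_cut[OF D(1), of "R + 1"], of "R + 1"]
    by (intro integrable_abs) auto
  have "(\<lambda>n. \<integral>x. \<zeta> n x * D x \<partial>lebesgue) \<longlonglongrightarrow> (\<integral>x. indicator K x * D x \<partial>lebesgue)"
  proof (rule integral_dominated_convergence[OF _ _ w])
    show "AE x in lebesgue. (\<lambda>n. \<zeta> n x * D x) \<longlonglongrightarrow> indicator K x * D x"
    proof (intro AE_I2 tendsto_mult tendsto_const)
      fix x
      show "(\<lambda>n. \<zeta> n x) \<longlonglongrightarrow> indicator K x"
      proof (cases "x \<in> K")
        case False
        have "open (- K)" using K by (simp add: compact_imp_closed open_Compl)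
        with False obtain e where e: "e > 0" "ball x e \<subseteq> - K"
          by (meson ComplI open_contains_ball)
        obtain N where N: "1 / real (Suc N) < e" using nat_approx_posE[OF e(1)] by blast
        have "\<zeta> n x = 0" if "n \<ge> N" for n
        proof (rule ccontr)
          assume "\<zeta> n x \<noteq> 0"
          then have "x \<in> V n" using \<zeta>(5) not_in_suppD by blast
          then obtain y where y: "y \<in> K" "dist y x < 1 / real (Suc n)" by (auto simp: V_def)
          have "1 / real (Suc n) \<le> 1 / real (Suc N)" using that by (simp add: frac_le)
          then have "y \<in> ball x e" using y N by (simp add: dist_commute)
          then show False using e y by blast
        qed
        then have "\<forall>\<^sub>F n in sequentially. \<zeta> n x = indicator K x"
          using False by (auto simp: eventually_sequentially)
        then show ?thesis by (rule tendsto_eventually)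
      qed (simp add: \<zeta>)
    qed
    show "AE x in lebesgue. norm (\<zeta> n x * D x) \<le> \<bar>indicator (ball 0 (R + 1)) x * D x\<bar>" for n
    proof (rule AE_I2)
      fix x
      show "norm (\<zeta> n x * D x) \<le> \<bar>indicator (ball 0 (R + 1)) x * D x\<bar>"
        using out[of x n] \<zeta>(3,4)[of n x]
        by (cases "norm x < R + 1") (auto simp: abs_mult mult_left_le_one_le)
    qed
  qed measurable
  then show ?thesis using D(2)[OF \<zeta>(1)] by (simp add: LIMSEQ_const_iff)
qed

text \<open>By inner regularity the set where \<open>D\<close> is positive is, up to a null set, a
  countable union of compact sets. On each of them a positive function has integral zero, so each is
  a null set.\<close>

lemma nonpos_AE_of_compact_integrals:
  fixes D :: "plane \<Rightarrow> real"
  assumes D: "D \<in> L2_loc" "\<And>K. compact K \<Longrightarrow> (\<integral>x. indicator K x * D x \<partial>lebesgue) = 0"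
  shows "AE x in lebesgue. D x \<le> 0"
proof -
  note [measurable] = L2_loc_measurable[OF D(1)]
  have "{x \<in> space lebesgue. D x > 0} \<in> sets lebesgue" by measurable
  then have "{x. D x > 0} \<in> sets lebesgue" by simp
  from lebesgue_regular_inner[OF this] obtain N C where
    C: "negligible N" "\<And>n::nat. compact (C n)" "{x. D x > 0} = (\<Union>n. C n) \<union> N" by metis
  have "AE x in lebesgue. x \<notin> C n" for n
  proof -
    have [measurable]: "C n \<in> sets lebesgue" using C(2) by (simp add: borel_compact)
    have pos: "D x > 0" if "x \<in> C n" for x using C(3) that by blast
    obtain R where R: "\<And>x. x \<in> C n \<Longrightarrow> norm x < R"
      using compact_imp_bounded[OF C(2)[of n]] unfolding bounded_pos_less by blast
    have int: "integrable lebesgue (\<lambda>x. indicator (C n) x * D x)"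
      using L2_loc_mult_integrable[OF D(1), of "indicator (C n)" 1 R] R
      by (force simp: indicator_def)
    have "AE x in lebesgue. indicator (C n) x * D x = 0"
      using integral_nonneg_eq_0_iff_AE[OF int] D(2)[OF C(2)] pos
      by (auto simp: indicator_def less_imp_le)
    then show ?thesis
      by (rule AE_mp) (use pos in \<open>force intro!: AE_I2 simp: indicator_def\<close>)
  qed
  then have "AE x in lebesgue. \<forall>n. x \<notin> C n" unfolding AE_all_countable by blast
  moreover have "AE x in lebesgue. x \<notin> N"
    using C(1) by (simp add: negligible_iff_null_sets AE_not_in)
  ultimately show ?thesis
  proof eventually_elim
    case (elim x)
    then have "x \<notin> {x. D x > 0}" unfolding C(3) by blast
    then show ?case by simp
  qed
qed

lemma fundamental_lemma:
  fixes D :: "plane \<Rightarrow> real"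
  assumes D: "D \<in> L2_loc" "\<And>\<phi>. \<phi> \<in> test_functions \<Longrightarrow> (\<integral>x. \<phi> x * D x \<partial>lebesgue) = 0"
  shows "AE x in lebesgue. D x = 0"
proof -
  note z = compact_set_integral_zero[OF D]
  have "AE x in lebesgue. D x \<le> 0" by (rule nonpos_AE_of_compact_integrals[OF D(1) z])
  moreover have "AE x in lebesgue. - D x \<le> 0"
    by (rule nonpos_AE_of_compact_integrals)
      (use L2_loc_scaleR[OF D(1), of "-1"] z in simp_all)
  ultimately show ?thesis by eventually_elim simp
qed

text \<open>By the Riesz representation on the closure of the test functions, density follows from the
  fundamental lemma.\<close>

lemma test_dense_L2:
  fixes D :: "plane \<Rightarrow> real"
  assumes D: "D \<in> L2" and e: "e > 0"
  obtains \<phi> where "\<phi> \<in> test_functions" "l2n (\<lambda>x. D x - \<phi> x) < e"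
proof -
  define S where "S = {h \<in> L2. \<forall>e>0. \<exists>\<phi>\<in>test_functions. l2n (\<lambda>x. h x - \<phi> x) < e}"
  have S_test: "\<exists>\<phi>\<in>test_functions. l2n (\<lambda>x. h x - \<phi> x) < e" if "h \<in> S" "e > 0" for h e
    using that unfolding S_def by blast
  have test_S: "\<phi> \<in> S" if "\<phi> \<in> test_functions" for \<phi>
    using that by (auto simp: S_def test_L2 l2n_def l2ip_def intro!: bexI[of _ \<phi>])
  \<comment> \<open>The representer of \<open>l2ip D\<close> on \<open>S\<close> is the orthogonal
    projection of \<open>D\<close> onto the closure of the test functions; \<open>D - g\<close> is
    then orthogonal to all of them.\<close>
  obtain g where g: "g \<in> S" "\<And>h. h \<in> S \<Longrightarrow> l2ip D h = l2ip g h"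
  proof (rule riesz_representation_L2[of S "l2ip D" "l2n D"])
    show "S \<subseteq> L2" by (auto simp: S_def)
    show "(\<lambda>x. 0) \<in> S"
      using test_S[OF test_scale[OF test_bump[of 1 0], of 0]] by simp
    show "(\<lambda>x. h x + k x) \<in> S" if hk: "h \<in> S" "k \<in> S" for h k
      unfolding S_def
    proof (intro CollectI conjI allI impI)
      show "(\<lambda>x. h x + k x) \<in> L2" using that by (auto simp: S_def L2_add)
      fix e :: real assume "e > 0"
      then obtain \<phi> \<psi> where *: "\<phi> \<in> test_functions" "\<psi> \<in> test_functions"
        "l2n (\<lambda>x. h x - \<phi> x) < e / 2" "l2n (\<lambda>x. k x - \<psi> x) < e / 2"
        using S_test[OF hk(1), of "e / 2"] S_test[OF hk(2), of "e / 2"] by auto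
      have "(\<lambda>x. h x - \<phi> x) \<in> L2" "(\<lambda>x. k x - \<psi> x) \<in> L2"
        using hk * by (simp_all add: S_def L2_diff test_L2)
      from l2n_add_le[OF this] *
      show "\<exists>\<phi>\<in>test_functions. l2n (\<lambda>x. h x + k x - \<phi> x) < e"
        by (intro bexI[of _ "\<lambda>x. \<phi> x + \<psi> x"] test_add) (auto simp: algebra_simps)
    qed
    show "(\<lambda>x. c *\<^sub>R h x) \<in> S" if hS: "h \<in> S" for c h
      unfolding S_def
    proof (intro CollectI conjI allI impI)
      show "(\<lambda>x. c *\<^sub>R h x) \<in> L2" using that L2_scaleR[of h c] by (auto simp: S_def)
      fix e :: real assume "e > 0"
      then have "e / (\<bar>c\<bar> + 1) > 0" by simp
      then obtain \<phi> where *: "\<phi> \<in> test_functions" "l2n (\<lambda>x. h x - \<phi> x) < e / (\<bar>c\<bar> + 1)"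
        using S_test[OF hS] by blast
      have "l2n (\<lambda>x. c *\<^sub>R (h x - \<phi> x)) = \<bar>c\<bar> * l2n (\<lambda>x. h x - \<phi> x)" by (rule l2n_scaleR)
      also have "\<dots> \<le> (\<bar>c\<bar> + 1) * l2n (\<lambda>x. h x - \<phi> x)"
        by (intro mult_right_mono l2n_nonneg) simp
      also have "\<dots> < e" using *(2) by (simp add: pos_less_divide_eq mult.commute)
      finally show "\<exists>\<phi>\<in>test_functions. l2n (\<lambda>x. c *\<^sub>R h x - \<phi> x) < e"
        by (intro bexI[of _ "\<lambda>x. c * \<phi> x"] test_scale *) (simp add: algebra_simps)
    qed
    show "g \<in> S" if h: "\<And>n. h n \<in> S" and "g \<in> L2" and lim: "(\<lambda>n. l2n (\<lambda>x. h n x - g x)) \<longlonglongrightarrow> 0" for h :: "nat \<Rightarrow> plane \<Rightarrow> real" and g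
      unfolding S_def
    proof (intro CollectI conjI allI impI)
      fix e :: real assume "e > 0"
      then have "\<forall>\<^sub>F n in sequentially. l2n (\<lambda>x. h n x - g x) < e / 2"
        using order_tendstoD(2)[OF lim, of "e / 2"] by simp
      then obtain n where n: "l2n (\<lambda>x. h n x - g x) < e / 2"
        by (auto simp: eventually_sequentially)
      obtain \<phi> where \<phi>: "\<phi> \<in> test_functions" "l2n (\<lambda>x. h n x - \<phi> x) < e / 2"
        using S_test[OF h[of n], of "e / 2"] \<open>e > 0\<close> by auto
      have "l2n (\<lambda>x. g x - \<phi> x) \<le> l2n (\<lambda>x. g x - h n x) + l2n (\<lambda>x. h n x - \<phi> x)"
        using h[of n] \<phi> \<open>g \<in> L2\<close> l2n_triangle[of g "h n" \<phi>] by (simp add: S_def test_L2)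
      then show "\<exists>\<phi>\<in>test_functions. l2n (\<lambda>x. g x - \<phi> x) < e"
        using n \<phi> l2n_minus_commute[of g "h n"] by (intro bexI[of _ \<phi>]) auto
    qed (rule \<open>g \<in> L2\<close>)
  qed (use D in \<open>auto simp: S_def l2ip_add l2ip_mult l2ip_Cauchy_Schwarz\<close>)
  have gL2: "g \<in> L2" using g by (simp add: S_def)
  have "AE x in lebesgue. D x - g x = 0"
  proof (rule fundamental_lemma[OF L2_imp_L2_loc[OF L2_diff[OF D gL2]]])
    fix \<phi> :: "plane \<Rightarrow> real" assume \<phi>: "\<phi> \<in> test_functions"
    have "l2ip \<phi> (\<lambda>x. D x - g x) = 0"
      using g(2)[OF test_S[OF \<phi>]] D gL2 test_L2[OF \<phi>]
      by (simp add: l2ip_diff l2ip_commute[of \<phi>])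
    then show "(\<integral>x. \<phi> x * (D x - g x) \<partial>lebesgue) = 0" by (simp add: l2ip_def)
  qed
  moreover obtain \<phi> where \<phi>: "\<phi> \<in> test_functions" "l2n (\<lambda>x. g x - \<phi> x) < e"
    using g(1) e by (auto simp: S_def)
  ultimately have "l2n (\<lambda>x. D x - \<phi> x) = l2n (\<lambda>x. g x - \<phi> x)"
    unfolding l2n_def using D gL2 test_L2[OF \<phi>(1)]
    by (intro arg_cong[of _ _ sqrt] l2ip_cong_AE L2_diff) auto
  then show ?thesis using \<phi> that by simp
qed

text \<open>\<open>D\<close> is tested with approximations of its own truncation \<open>E\<close>.
  As \<open>D\<close> is not yet known to be in \<open>L2\<close>, the approximating test functions
  are cut off by \<zeta>, so that \<open>D\<close> may be replaced by the wider truncation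
  \<open>E'\<close>, whose possibly large norm is multiplied only by the approximation
  error.\<close>

lemma L2_duality:
  fixes D :: "plane \<Rightarrow> real"
  assumes D: "D \<in> L2_loc" and M: "M \<ge> 0"
    and bound: "\<And>\<phi>. \<phi> \<in> test_functions \<Longrightarrow> \<bar>\<integral>x. \<phi> x * D x \<partial>lebesgue\<bar> \<le> M * l2n \<phi>"
  shows "D \<in> L2" "l2n D \<le> M"
proof -
  have cut: "l2ip (\<lambda>x. indicator (ball 0 (real r)) x *\<^sub>R D x) (\<lambda>x. indicator (ball 0 (real r)) x *\<^sub>R D x) \<le> M\<^sup>2"
    for r :: nat
  proof -
    define E where "E x = indicator (ball 0 (real r)) x *\<^sub>R D x" for x
    define E' where "E' x = indicator (ball 0 (2 * real r + 2)) x *\<^sub>R D x" for x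
    have E: "E \<in> L2" "E' \<in> L2" unfolding E_def E'_def by (intro L2_loc_cut D)+
    define \<zeta> where "\<zeta> = bump 0 (real r + 1)"
    have \<zeta>: "\<zeta> \<in> test_functions" "\<And>x. norm x < real r \<Longrightarrow> \<zeta> x = 1"
      "\<And>x. 0 \<le> \<zeta> x" "\<And>x. \<zeta> x \<le> 1" "\<And>x. \<not> norm x < 2 * real r + 2 \<Longrightarrow> \<zeta> x = 0"
      using test_bump[of "real r + 1" 0] bump_nonneg[of "real r + 1" 0] bump_le_1[of "real r + 1" 0]
        bump_eq_1[of "real r + 1" _ 0] bump_nonzero_iff[of "real r + 1" 0]
      by (auto simp: \<zeta>_def algebra_simps)
    have approx: "l2ip E E \<le> M * l2n E + (M + l2n E') * e" if "e > 0" for e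
    proof -
      obtain \<phi> where \<phi>: "\<phi> \<in> test_functions" "l2n (\<lambda>x. E x - \<phi> x) < e"
        using test_dense_L2[OF E(1) \<open>e > 0\<close>] by blast
      have t: "(\<lambda>x. \<zeta> x * \<phi> x) \<in> test_functions" by (intro test_mult \<zeta> test_Ck \<phi>)
      \<comment> \<open>\<zeta> is 1 wherever \<open>E\<close> is nonzero and lies between 0 and 1,
        so that cutting off leaves \<open>E\<close> unchanged and does not increase the
        error.\<close>
      have eq: "(\<lambda>x. \<zeta> x *\<^sub>R (E x - \<phi> x)) = (\<lambda>x. E x - \<zeta> x * \<phi> x)"
        using \<zeta>(2) by (auto simp: fun_eq_iff E_def indicator_def algebra_simps)
      have small: "l2n (\<lambda>x. E x - \<zeta> x * \<phi> x) \<le> e"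
        using L2_mult_bounded(2)[OF L2_diff[OF E(1) test_L2[OF \<phi>(1)]] test_measurable[OF \<zeta>(1)], of 1]
          \<zeta>(3,4) \<phi>(2) eq by (auto simp: abs_le_iff intro: order_trans[of _ 0])
      have "l2n (\<lambda>x. \<zeta> x * \<phi> x) \<le> l2n E + e"
        using l2n_add_le[OF E(1) L2_diff[OF test_L2[OF t] E(1)]] small
          l2n_minus_commute[of "\<lambda>x. \<zeta> x * \<phi> x" E] by simp
      moreover have "l2ip E' (\<lambda>x. \<zeta> x * \<phi> x) = (\<integral>x. (\<zeta> x * \<phi> x) * D x \<partial>lebesgue)"
        unfolding l2ip_def E'_def using \<zeta>(5)
        by (intro Bochner_Integration.integral_cong) (auto simp: indicator_def)
      ultimately have 1: "l2ip E' (\<lambda>x. \<zeta> x * \<phi> x) \<le> M * (l2n E + e)"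
        using bound[OF t] mult_left_mono[of "l2n (\<lambda>x. \<zeta> x * \<phi> x)" "l2n E + e" M] M by linarith
      have 2: "l2ip E' (\<lambda>x. E x - \<zeta> x * \<phi> x) \<le> l2n E' * e"
        using l2ip_Cauchy_Schwarz[OF E(2) L2_diff[OF E(1) test_L2[OF t]]]
          mult_left_mono[OF small l2n_nonneg[of E']] by linarith
      have "l2ip E E = l2ip E' E"
        unfolding l2ip_def by (intro Bochner_Integration.integral_cong) (auto simp: E_def E'_def indicator_def)
      also have "\<dots> = l2ip E' (\<lambda>x. \<zeta> x * \<phi> x) + l2ip E' (\<lambda>x. E x - \<zeta> x * \<phi> x)"
        using E test_L2[OF t] by (simp add: l2ip_diff)
      finally show ?thesis using 1 2 by (simp add: algebra_simps)
    qed
    have "l2ip E E \<le> M * l2n E"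
    proof (rule field_le_epsilon)
      fix e :: real assume "e > 0"
      have pos: "M + l2n E' + 1 > 0" using M l2n_nonneg[of E'] by linarith
      have "(M + l2n E') * (e / (M + l2n E' + 1)) \<le> e"
        using pos \<open>e > 0\<close> by (simp add: field_simps)
      then show "l2ip E E \<le> M * l2n E + e"
        using approx[of "e / (M + l2n E' + 1)"] pos \<open>e > 0\<close> by simp
    qed
    then have "l2n E * l2n E \<le> M * l2n E" by (simp add: power2_eq_square flip: l2n_sq)
    then have "l2n E \<le> M" using M l2n_nonneg[of E] by (cases "l2n E = 0") auto
    then show ?thesis using power_mono[of "l2n E" M 2] l2n_nonneg[of E] by (simp add: l2n_sq E_def[abs_def])
  qed
  note [measurable] = L2_loc_measurable[OF D]
  have nn: "(\<integral>\<^sup>+x. ennreal ((norm (D x))\<^sup>2) \<partial>lebesgue) \<le> ennreal (M\<^sup>2)"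
  proof (rule nn_integral_balls_le)
    fix r :: nat
    have "(\<integral>\<^sup>+x. ennreal ((norm (D x))\<^sup>2) * indicator (ball 0 (real r)) x \<partial>lebesgue)
      = (\<integral>\<^sup>+x. ennreal ((norm (indicator (ball 0 (real r)) x *\<^sub>R D x))\<^sup>2) \<partial>lebesgue)"
      by (intro nn_integral_cong) (simp add: indicator_def)
    also have "\<dots> \<le> ennreal (M\<^sup>2)"
      using cut[of r] by (subst nn_integral_L2[OF L2_loc_cut[OF D]]) (rule ennreal_leI)
    finally show "(\<integral>\<^sup>+x. ennreal ((norm (D x))\<^sup>2) * indicator (ball 0 (real r)) x \<partial>lebesgue) \<le> ennreal (M\<^sup>2)" .
  qed measurable
  show "D \<in> L2" by (rule L2_nn_integral_bound[OF _ _ nn]) auto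
  have "l2ip D D \<le> M\<^sup>2" by (rule L2_nn_integral_bound[OF _ _ nn]) auto
  then show "l2n D \<le> M" using M by (simp add: l2n_def real_le_lsqrt l2ip_self_nonneg real_sqrt_le_iff flip: real_sqrt_unique)
qed

section \<open>First-order expansion of test functions\<close>

lemma test_mvt:
  assumes "\<phi> \<in> test_functions"
  obtains s where "0 < s" "s < 1"
    "\<phi> (y + h) - \<phi> y = (\<Sum>i\<in>UNIV. h $ i * partial_deriv i \<phi> (y + s *\<^sub>R h))"
proof -
  define g' where "g' t = (\<Sum>i\<in>UNIV. h $ i * partial_deriv i \<phi> (y + t *\<^sub>R h))" for t
  have "((\<lambda>t. \<phi> (y + t *\<^sub>R h)) has_real_derivative g' t) (at t)" for t
  proof -
    have "((\<lambda>t. \<phi> (y + t *\<^sub>R h)) has_derivative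
        (\<lambda>d. frechet_derivative \<phi> (at (y + t *\<^sub>R h)) (d *\<^sub>R h))) (at t)"
      by (rule has_derivative_compose[OF _ test_has_derivative[OF assms]])
        (auto intro!: derivative_eq_intros)
    moreover have "frechet_derivative \<phi> (at (y + t *\<^sub>R h)) (d *\<^sub>R h) = g' t * d" for d
      unfolding frechet_eq_sum_partial[OF test_has_derivative[OF assms]] g'_def sum_distrib_right
      by (simp add: ac_simps)
    ultimately show ?thesis by (simp add: has_field_derivative_def)
  qed
  then obtain s where "0 < s" "s < 1" "\<phi> (y + 1 *\<^sub>R h) - \<phi> (y + 0 *\<^sub>R h) = (1 - 0) * g' s"
    using MVT2[of 0 1 "\<lambda>t. \<phi> (y + t *\<^sub>R h)" g'] by auto
  then show ?thesis using that by (simp add: g'_def)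
qed

lemma test_lipschitz:
  assumes "\<phi> \<in> test_functions"
  obtains L where "L \<ge> 0" "\<And>y h. \<bar>\<phi> (y + h) - \<phi> y\<bar> \<le> L * norm h"
proof -
  have "\<exists>B>0. \<forall>x. \<bar>partial_deriv i \<phi> x\<bar> \<le> B" for i
    using test_bounded[OF test_partial_deriv[OF assms, of i]] by metis
  then obtain B where B: "\<And>i. B i > 0" "\<And>i x. \<bar>partial_deriv i \<phi> x\<bar> \<le> B i" by metis
  show ?thesis
  proof
    show "sum B UNIV \<ge> 0" using B(1) by (simp add: sum_nonneg less_imp_le)
    fix y h
    obtain s where "\<phi> (y + h) - \<phi> y = (\<Sum>i\<in>UNIV. h $ i * partial_deriv i \<phi> (y + s *\<^sub>R h))"
      using test_mvt[OF assms] by blast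
    also have "\<bar>\<dots>\<bar> \<le> (\<Sum>i\<in>UNIV. B i * norm h)"
      by (rule order_trans[OF sum_abs], rule sum_mono)
        (use B component_le_norm_cart[of h] in \<open>auto simp: abs_mult mult.commute[of "B _"] intro!: mult_mono\<close>)
    finally show "\<bar>\<phi> (y + h) - \<phi> y\<bar> \<le> sum B UNIV * norm h" by (simp add: sum_distrib_right)
  qed
qed

text \<open>The partial derivatives are Lipschitz, hence the quadratic remainder. \<open>M\<close>
  does not depend on \<open>y\<close>, which permits integrating the estimate when a convolution is
  differentiated.\<close>

lemma test_taylor:
  assumes "\<phi> \<in> test_functions"
  obtains M where "M \<ge> 0"
    "\<And>y h. \<bar>\<phi> (y + h) - \<phi> y - (\<Sum>i\<in>UNIV. h $ i * partial_deriv i \<phi> y)\<bar> \<le> M * (norm h)\<^sup>2"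
proof -
  have "\<exists>L\<ge>0. \<forall>y h. \<bar>partial_deriv i \<phi> (y + h) - partial_deriv i \<phi> y\<bar> \<le> L * norm h" for i
    using test_lipschitz[OF test_partial_deriv[OF assms, of i]] by metis
  then obtain L where L: "\<And>i. L i \<ge> 0"
    "\<And>i y h. \<bar>partial_deriv i \<phi> (y + h) - partial_deriv i \<phi> y\<bar> \<le> L i * norm h" by metis
  show ?thesis
  proof
    show "sum L UNIV \<ge> 0" using L(1) by (simp add: sum_nonneg)
    fix y h
    obtain s where s: "0 < s" "s < 1"
      "\<phi> (y + h) - \<phi> y = (\<Sum>i\<in>UNIV. h $ i * partial_deriv i \<phi> (y + s *\<^sub>R h))"
      using test_mvt[OF assms] by blast
    have "\<bar>\<phi> (y + h) - \<phi> y - (\<Sum>i\<in>UNIV. h $ i * partial_deriv i \<phi> y)\<bar>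
      = \<bar>\<Sum>i\<in>UNIV. h $ i * (partial_deriv i \<phi> (y + s *\<^sub>R h) - partial_deriv i \<phi> y)\<bar>"
      by (simp only: s(3) right_diff_distrib sum_subtractf)
    also have "\<dots> \<le> (\<Sum>i\<in>UNIV. L i * (norm h)\<^sup>2)"
    proof (rule order_trans[OF sum_abs], rule sum_mono)
      fix i
      have "\<bar>partial_deriv i \<phi> (y + s *\<^sub>R h) - partial_deriv i \<phi> y\<bar> \<le> L i * norm (s *\<^sub>R h)" by (rule L(2))
      also have "\<dots> \<le> L i * norm h" using s L(1)[of i] by (intro mult_left_mono) (auto simp: mult_left_le_one_le)
      finally have "\<bar>h $ i\<bar> * \<bar>partial_deriv i \<phi> (y + s *\<^sub>R h) - partial_deriv i \<phi> y\<bar> \<le> norm h * (L i * norm h)"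
        by (intro mult_mono component_le_norm_cart) auto
      then show "\<bar>h $ i * (partial_deriv i \<phi> (y + s *\<^sub>R h) - partial_deriv i \<phi> y)\<bar> \<le> L i * (norm h)\<^sup>2"
        by (simp add: abs_mult power2_eq_square ac_simps)
    qed
    finally show "\<bar>\<phi> (y + h) - \<phi> y - (\<Sum>i\<in>UNIV. h $ i * partial_deriv i \<phi> y)\<bar> \<le> sum L UNIV * (norm h)\<^sup>2"
      by (simp add: sum_distrib_right)
  qed
qed

section \<open>Weak gradients\<close>

definition conv :: "(plane \<Rightarrow> real) \<Rightarrow> (plane \<Rightarrow> real) \<Rightarrow> plane \<Rightarrow> real" where
  "conv \<rho> U z = (\<integral>x. \<rho> (z - x) * U x \<partial>lebesgue)"

lemma test_reflect: "\<rho> \<in> test_functions \<Longrightarrow> (\<lambda>x. \<rho> (z - x)) \<in> test_functions"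
  using test_affine[of \<rho> "-1" z] by simp

lemma partial_deriv_reflect:
  "\<rho> \<in> test_functions \<Longrightarrow> partial_deriv i (\<lambda>x. \<rho> (z - x)) x = - partial_deriv i \<rho> (z - x)"
  using partial_deriv_affine[of \<rho> i "-1" z x] by simp

lemma test_mult_integrable:
  fixes U :: "plane \<Rightarrow> real"
  assumes "\<phi> \<in> test_functions" "U \<in> L2_loc" shows "integrable lebesgue (\<lambda>x. \<phi> x * U x)"
  using test_L2_loc_mult(2)[OF assms] by simp

text \<open>The uniform Taylor estimate for \<rho> is integrated against \<open>U\<close>. For
  increments below 1 in norm the integrands vanish outside a fixed ball, on which \<open>U\<close>
  is integrable.\<close>

lemma conv_has_derivative:
  assumes \<rho>: "\<rho> \<in> test_functions" and U: "U \<in> L2_loc"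
  shows "(conv \<rho> U has_derivative (\<lambda>h. \<Sum>i\<in>UNIV. h $ i * conv (partial_deriv i \<rho>) U z)) (at z)"
proof -
  let ?D = "\<lambda>h. \<Sum>i\<in>UNIV. h $ i * conv (partial_deriv i \<rho>) U z"
  obtain M where M: "M \<ge> 0"
    "\<And>y h. \<bar>\<rho> (y + h) - \<rho> y - (\<Sum>i\<in>UNIV. h $ i * partial_deriv i \<rho> y)\<bar> \<le> M * (norm h)\<^sup>2"
    using test_taylor[OF \<rho>] by blast
  obtain r where r: "\<And>x. x \<in> supp \<rho> \<Longrightarrow> norm x < r"
    using compact_imp_bounded[OF test_compact[OF \<rho>]] unfolding bounded_pos_less by blast
  have zero: "\<rho> x = 0" "partial_deriv i \<rho> x = 0" if "r \<le> norm x" for x i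
    using r[of x] that not_in_suppD[of x \<rho>] frechet_zero_outside_supp[of x \<rho>]
    by (auto simp: partial_deriv_def)
  define R where "R = r + norm z + 1"
  define C where "C = (\<integral>x. \<bar>indicator (ball 0 R) x * U x\<bar> \<partial>lebesgue)"
  have intU: "integrable lebesgue (\<lambda>x. \<bar>indicator (ball 0 R) x * U x\<bar>)"
    using L2_bounded_support_integrable[OF L2_loc_cut[OF U, of R], of R]
    by (intro integrable_abs) auto
  have est: "\<bar>conv \<rho> U (z + h) - conv \<rho> U z - ?D h\<bar> \<le> M * C * (norm h)\<^sup>2" if h: "norm h < 1" for h
  proof -
    have int: "integrable lebesgue (\<lambda>x. \<phi> (w - x) * U x)" if "\<phi> \<in> test_functions" for \<phi> w
      by (intro test_mult_integrable test_reflect that U)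
    note ints = int[OF \<rho>] int[OF test_partial_deriv[OF \<rho>]]
    have "conv \<rho> U (z + h) - conv \<rho> U z - ?D h =
      (\<integral>x. \<rho> (z + h - x) * U x - \<rho> (z - x) * U x - (\<Sum>i\<in>UNIV. h $ i * (partial_deriv i \<rho> (z - x) * U x)) \<partial>lebesgue)"
      unfolding conv_def using ints by simp
    also have "\<bar>\<dots>\<bar> \<le> (\<integral>x. M * (norm h)\<^sup>2 * \<bar>indicator (ball 0 R) x * U x\<bar> \<partial>lebesgue)"
      unfolding real_norm_def[symmetric]
    proof (rule Bochner_Integration.integral_norm_bound_integral)
      show "integrable lebesgue (\<lambda>x. \<rho> (z + h - x) * U x - \<rho> (z - x) * U x -
          (\<Sum>i\<in>UNIV. h $ i * (partial_deriv i \<rho> (z - x) * U x)))"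
        using ints by auto
      show "integrable lebesgue (\<lambda>x. M * (norm h)\<^sup>2 * norm (indicator (ball 0 R) x * U x))"
        using intU by simp
      fix x
      have eq: "\<rho> (z + h - x) * U x - \<rho> (z - x) * U x - (\<Sum>i\<in>UNIV. h $ i * (partial_deriv i \<rho> (z - x) * U x))
        = (\<rho> ((z - x) + h) - \<rho> (z - x) - (\<Sum>i\<in>UNIV. h $ i * partial_deriv i \<rho> (z - x))) * U x"
        by (simp add: algebra_simps sum_distrib_left)
      show "norm (\<rho> (z + h - x) * U x - \<rho> (z - x) * U x - (\<Sum>i\<in>UNIV. h $ i * (partial_deriv i \<rho> (z - x) * U x)))
        \<le> M * (norm h)\<^sup>2 * norm (indicator (ball 0 R) x * U x)"
      proof (cases "norm x < R")
        case True
        then show ?thesis unfolding eq using mult_right_mono[OF M(2)[of "z - x" h], of "\<bar>U x\<bar>"]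
          by (simp add: abs_mult)
      next
        case False
        have "norm x \<le> norm (z - x) + norm z"
          by (metis norm_minus_commute norm_triangle_sub add.commute)
        moreover have "norm (z - x) \<le> norm (z - x + h) + norm h"
          using norm_triangle_ineq4[of "z - x + h" h] by simp
        ultimately have "r \<le> norm (z - x)" "r \<le> norm (z - x + h)" using False h by (auto simp: R_def)
        then show ?thesis unfolding eq using zero M(1) by simp
      qed
    qed
    also have "\<dots> = M * C * (norm h)\<^sup>2" by (simp add: C_def)
    finally show ?thesis .
  qed
  have "bounded_linear ?D"
    by (intro bounded_linear_sum bounded_linear_mult_const bounded_linear_vec_nth)
  moreover have "((\<lambda>h. norm (conv \<rho> U (z + h) - conv \<rho> U z - ?D h) / norm h) \<longlongrightarrow> 0) (at 0)"
  proof (rule Lim_null_comparison)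
    have "\<forall>\<^sub>F h :: plane in at 0. norm h < (1::real)"
      unfolding eventually_at by (intro exI[of _ 1]) auto
    then show "\<forall>\<^sub>F h in at 0. norm (norm (conv \<rho> U (z + h) - conv \<rho> U z - ?D h) / norm h) \<le> M * C * norm h"
    proof (rule eventually_mono)
      fix h :: plane assume "norm h < 1"
      from est[OF this] show "norm (norm (conv \<rho> U (z + h) - conv \<rho> U z - ?D h) / norm h) \<le> M * C * norm h"
        by (cases "h = 0") (auto simp: divide_simps power2_eq_square ac_simps)
    qed
    show "((\<lambda>h::plane. M * C * norm h) \<longlongrightarrow> 0) (at 0)" by (auto intro!: tendsto_eq_intros)
  qed
  ultimately show ?thesis by (simp add: has_derivative_at)
qed

lemma Ck_conv:
  assumes "U \<in> L2_loc" shows "\<rho> \<in> test_functions \<Longrightarrow> Ck k (conv \<rho> U)"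
proof (induction k arbitrary: \<rho>)
  case 0
  have "isCont (conv \<rho> U) z" for z
    by (rule has_derivative_continuous[OF conv_has_derivative[OF 0 assms]])
  then show ?case by (simp add: continuous_at_imp_continuous_on)
next
  case (Suc k)
  show ?case
    by (rule Ck_SucI[OF conv_has_derivative[OF Suc.prems assms]])
      (intro Ck_sum Ck_mult Ck_const Suc.IH test_partial_deriv Suc.prems)
qed

lemma partial_deriv_conv:
  assumes "\<rho> \<in> test_functions" "U \<in> L2_loc"
  shows "partial_deriv i (conv \<rho> U) z = conv (partial_deriv i \<rho>) U z"
proof -
  have "(\<Sum>j\<in>UNIV. axis i 1 $ j * conv (partial_deriv j \<rho>) U z) = conv (partial_deriv i \<rho>) U z"
    by (simp add: axis_def if_distrib[of "\<lambda>c. c * _"] cong: if_cong)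
  then show ?thesis
    using frechet_derivative_at[OF conv_has_derivative[OF assms, of z]]
    by (simp add: partial_deriv_def fun_eq_iff)
qed

text \<open>Convolving \<phi> with the constant 1 gives the constant function with value the
  integral of \<phi>. Its derivative is zero, and it is also the convolution of the partial
  derivative with 1, so no iterated integration is involved.\<close>

lemma integral_partial_deriv:
  assumes "\<phi> \<in> test_functions" shows "(\<integral>x. partial_deriv i \<phi> x \<partial>lebesgue) = 0"
proof -
  have const: "conv \<psi> (\<lambda>_. 1) z = (\<integral>x. \<psi> x \<partial>lebesgue)" if "\<psi> \<in> test_functions" for \<psi> z
    using lebesgue_integral_affine[OF test_measurable[OF that], of "-1" z] by (simp add: conv_def)
  have "(\<integral>x. partial_deriv i \<phi> x \<partial>lebesgue) = conv (partial_deriv i \<phi>) (\<lambda>_. 1) 0"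
    by (simp add: const test_partial_deriv assms)
  also have "\<dots> = partial_deriv i (conv \<phi> (\<lambda>_. 1)) 0"
    by (rule partial_deriv_conv[symmetric, OF assms L2_loc_const])
  also have "conv \<phi> (\<lambda>_. 1) = (\<lambda>_. \<integral>x. \<phi> x \<partial>lebesgue)" by (simp add: fun_eq_iff const assms)
  also have "partial_deriv i (\<lambda>_. \<integral>x. \<phi> x \<partial>lebesgue) 0 = 0"
    by (simp add: partial_deriv_def)
  finally show ?thesis .
qed

section \<open>Calculus of weak gradients\<close>

text \<open>Carries an explicit representative \<open>G\<close> in place of the chosen
  \<open>weak_grad U\<close>, together with the integrability that every use requires.\<close>

definition wgrad :: "(plane \<Rightarrow> 'b::euclidean_space) \<Rightarrow> (plane \<Rightarrow> 'b^2) \<Rightarrow> bool" where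
  "wgrad U G \<longleftrightarrow> U \<in> L2_loc \<and> G \<in> L2 \<and> has_weak_gradient U G"

lemma wgrad_L2_loc: "wgrad U G \<Longrightarrow> U \<in> L2_loc" and wgrad_L2: "wgrad U G \<Longrightarrow> G \<in> L2"
  by (simp_all add: wgrad_def)

lemma wgrad_eq:
  assumes "wgrad U (G :: plane \<Rightarrow> real^2)" "\<phi> \<in> test_functions"
  shows "(\<integral>x. partial_deriv i \<phi> x * U x \<partial>lebesgue) = - (\<integral>x. \<phi> x * G x $ i \<partial>lebesgue)"
  using assms by (simp add: wgrad_def has_weak_gradient_def)

lemma wgradI:
  fixes U :: "plane \<Rightarrow> real"
  assumes "U \<in> L2_loc" "G \<in> L2" "\<And>\<phi> i. \<phi> \<in> test_functions \<Longrightarrow>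
    (\<integral>x. partial_deriv i \<phi> x * U x \<partial>lebesgue) = - (\<integral>x. \<phi> x * G x $ i \<partial>lebesgue)"
  shows "wgrad U G"
  using assms by (simp add: wgrad_def has_weak_gradient_def)

lemma wgrad_add:
  fixes U V :: "plane \<Rightarrow> real"
  assumes "wgrad U G" "wgrad V H" shows "wgrad (\<lambda>x. U x + V x) (\<lambda>x. G x + H x)"
proof (rule wgradI)
  show "(\<lambda>x. U x + V x) \<in> L2_loc" "(\<lambda>x. G x + H x) \<in> L2"
    by (intro L2_loc_add L2_add assms[THEN wgrad_L2_loc] assms[THEN wgrad_L2])+
  fix \<phi> :: "plane \<Rightarrow> real" and i assume \<phi>: "\<phi> \<in> test_functions"
  have "integrable lebesgue (\<lambda>x. partial_deriv i \<phi> x * U x)" "integrable lebesgue (\<lambda>x. partial_deriv i \<phi> x * V x)"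
    "integrable lebesgue (\<lambda>x. \<phi> x * G x $ i)" "integrable lebesgue (\<lambda>x. \<phi> x * H x $ i)"
    by (intro test_mult_integrable test_partial_deriv \<phi> L2_imp_L2_loc L2_vec_nth(1)
      assms[THEN wgrad_L2_loc] assms[THEN wgrad_L2])+
  then show "(\<integral>x. partial_deriv i \<phi> x * (U x + V x) \<partial>lebesgue) = - (\<integral>x. \<phi> x * (G x + H x) $ i \<partial>lebesgue)"
    using wgrad_eq[OF assms(1) \<phi>, of i] wgrad_eq[OF assms(2) \<phi>, of i] by (simp add: distrib_left)
qed

lemma wgrad_scale:
  fixes U :: "plane \<Rightarrow> real"
  assumes "wgrad U G" shows "wgrad (\<lambda>x. c * U x) (\<lambda>x. c *\<^sub>R G x)"
proof (rule wgradI)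
  show "(\<lambda>x. c * U x) \<in> L2_loc" using L2_loc_scaleR[OF wgrad_L2_loc[OF assms], of c] by simp
  show "(\<lambda>x. c *\<^sub>R G x) \<in> L2" by (rule L2_scaleR[OF wgrad_L2[OF assms]])
  fix \<phi> :: "plane \<Rightarrow> real" and i assume \<phi>: "\<phi> \<in> test_functions"
  show "(\<integral>x. partial_deriv i \<phi> x * (c * U x) \<partial>lebesgue) = - (\<integral>x. \<phi> x * (c *\<^sub>R G x) $ i \<partial>lebesgue)"
    using wgrad_eq[OF assms \<phi>, of i] by (simp add: mult.left_commute[of _ c])
qed

lemma wgrad_diff:
  fixes U V :: "plane \<Rightarrow> real"
  assumes "wgrad U G" "wgrad V H" shows "wgrad (\<lambda>x. U x - V x) (\<lambda>x. G x - H x)"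
  using wgrad_add[OF assms(1) wgrad_scale[OF assms(2), of "-1"]] by simp

lemma wgrad_const: "wgrad (\<lambda>x. c::real) (\<lambda>x. 0)"
  by (rule wgradI) (simp_all add: L2_loc_const L2_zero integral_partial_deriv)

lemma wgrad_sub_const:
  fixes U :: "plane \<Rightarrow> real"
  assumes "wgrad U G" shows "wgrad (\<lambda>x. U x - c) G"
  using wgrad_diff[OF assms wgrad_const[of c]] by simp

lemma wgrad_cong_AE:
  fixes U V :: "plane \<Rightarrow> real"
  assumes U: "wgrad U G" and eq: "AE x in lebesgue. U x = V x" and V: "V \<in> borel_measurable lebesgue"
  shows "wgrad V G"
proof (rule wgradI)
  show "V \<in> L2_loc" by (rule L2_loc_cong_AE[OF wgrad_L2_loc[OF U] eq V])
  show "G \<in> L2" by (rule wgrad_L2[OF U])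
  fix \<phi> :: "plane \<Rightarrow> real" and i assume \<phi>: "\<phi> \<in> test_functions"
  note [measurable] = V L2_loc_measurable[OF wgrad_L2_loc[OF U]] test_measurable[OF test_partial_deriv[OF \<phi>]]
  have "(\<integral>x. partial_deriv i \<phi> x * V x \<partial>lebesgue) = (\<integral>x. partial_deriv i \<phi> x * U x \<partial>lebesgue)"
    by (rule integral_cong_AE) (use eq in auto)
  then show "(\<integral>x. partial_deriv i \<phi> x * V x \<partial>lebesgue) = - (\<integral>x. \<phi> x * G x $ i \<partial>lebesgue)"
    using wgrad_eq[OF U \<phi>, of i] by simp
qed

lemma wgrad_unique_AE:
  fixes U :: "plane \<Rightarrow> real"
  assumes "wgrad U G" "wgrad U H" shows "AE x in lebesgue. G x = H x"
proof -
  have "AE x in lebesgue. G x $ i - H x $ i = 0" for i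
  proof (rule fundamental_lemma)
    have GH: "(\<lambda>x. G x $ i) \<in> L2" "(\<lambda>x. H x $ i) \<in> L2"
      by (intro L2_vec_nth(1) assms[THEN wgrad_L2])+
    then show "(\<lambda>x. G x $ i - H x $ i) \<in> L2_loc" by (intro L2_imp_L2_loc L2_diff)
    fix \<phi> :: "plane \<Rightarrow> real" assume \<phi>: "\<phi> \<in> test_functions"
    have "integrable lebesgue (\<lambda>x. \<phi> x * G x $ i)" "integrable lebesgue (\<lambda>x. \<phi> x * H x $ i)"
      by (intro test_mult_integrable \<phi> L2_imp_L2_loc GH)+
    then show "(\<integral>x. \<phi> x * (G x $ i - H x $ i) \<partial>lebesgue) = 0"
      using wgrad_eq[OF assms(1) \<phi>, of i] wgrad_eq[OF assms(2) \<phi>, of i] by (simp add: right_diff_distrib)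
  qed
  then have "AE x in lebesgue. \<forall>i. G x $ i - H x $ i = 0" unfolding AE_all_countable by blast
  then show ?thesis by eventually_elim (simp add: vec_eq_iff)
qed

definition grad :: "(plane \<Rightarrow> real) \<Rightarrow> plane \<Rightarrow> real^2" where
  "grad \<phi> x = (\<chi> i. partial_deriv i \<phi> x)"

lemma vec_L2:
  fixes g :: "2 \<Rightarrow> plane \<Rightarrow> 'b::euclidean_space"
  assumes "\<And>i. g i \<in> L2" shows "(\<lambda>x. (\<chi> i. g i x)) \<in> L2"
proof -
  have "(\<lambda>x. (\<chi> i. g i x)) \<in> borel_measurable lebesgue"
    unfolding borel_measurable_euclidean_space[where 'c = "'b^2"]
    using assms by (auto simp: Basis_vec_def inner_axis L2_measurable intro!: borel_measurable_inner)
  moreover have "integrable lebesgue (\<lambda>x. \<Sum>i\<in>UNIV. g i x \<bullet> g i x)"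
    using L2_integrable_inner[OF assms assms] by simp
  ultimately show ?thesis by (simp add: L2_iff inner_vec_def)
qed

text \<open>Integration by parts: the derivative of the product of two test functions has integral
  zero.\<close>

lemma wgrad_test: assumes "\<phi> \<in> test_functions" shows "wgrad \<phi> (grad \<phi>)"
proof (rule wgradI)
  show "\<phi> \<in> L2_loc" by (intro L2_imp_L2_loc test_L2 assms)
  show "grad \<phi> \<in> L2" unfolding grad_def[abs_def] by (intro vec_L2 test_L2 test_partial_deriv assms)
  fix \<psi> :: "plane \<Rightarrow> real" and i assume \<psi>: "\<psi> \<in> test_functions"
  have "integrable lebesgue (\<lambda>x. \<psi> x * partial_deriv i \<phi> x)" "integrable lebesgue (\<lambda>x. partial_deriv i \<psi> x * \<phi> x)"
    by (intro test_mult_integrable test_partial_deriv L2_imp_L2_loc test_L2 \<psi> assms)+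
  then show "(\<integral>x. partial_deriv i \<psi> x * \<phi> x \<partial>lebesgue) = - (\<integral>x. \<psi> x * grad \<phi> x $ i \<partial>lebesgue)"
    using integral_partial_deriv[OF test_mult[OF \<psi> test_Ck[OF assms]], of i]
    by (simp add: partial_deriv_mult[OF \<psi> assms] grad_def)
qed

lemma test_grad_bounded:
  assumes "\<phi> \<in> test_functions"
  obtains K where "K \<ge> 0" "\<And>x. norm (grad \<phi> x) \<le> K"
proof -
  have "\<exists>B>0. \<forall>x. \<bar>partial_deriv i \<phi> x\<bar> \<le> B" for i
    using test_bounded[OF test_partial_deriv[OF assms, of i]] by metis
  then obtain B where B: "\<And>i. B i > 0" "\<And>i x. \<bar>partial_deriv i \<phi> x\<bar> \<le> B i" by metis
  show ?thesis
  proof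
    show "sum B UNIV \<ge> 0" using B(1) by (simp add: sum_nonneg less_imp_le)
    fix x
    have "norm (grad \<phi> x) \<le> (\<Sum>i\<in>UNIV. \<bar>partial_deriv i \<phi> x\<bar>)"
      using norm_le_l1_cart[of "grad \<phi> x"] by (simp add: grad_def)
    also have "\<dots> \<le> sum B UNIV" by (intro sum_mono B(2))
    finally show "norm (grad \<phi> x) \<le> sum B UNIV" .
  qed
qed

text \<open>The weak gradient tested with the reflected translate of \<rho>. The sign from the
  reflection cancels the sign from the integration by parts, so the derivative moves from \<rho>
  onto \<open>U\<close>.\<close>

lemma conv_partial_deriv:
  assumes "wgrad U G" "\<rho> \<in> test_functions"
  shows "conv (partial_deriv i \<rho>) U z = conv \<rho> (\<lambda>x. G x $ i) z"
  using wgrad_eq[OF assms(1) test_reflect[OF assms(2), of z], of i]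
  by (simp add: conv_def partial_deriv_reflect[OF assms(2)])

lemma l2n_affine:
  assumes "F \<in> L2" "\<bar>s\<bar> = (1::real)"
  shows "(\<lambda>x. F (s *\<^sub>R x + z)) \<in> L2" "l2n (\<lambda>x. F (s *\<^sub>R x + z)) = l2n F"
proof -
  note [measurable] = L2_measurable[OF assms(1)] lebesgue_distr_affine(2)[OF assms(2)]
  have m: "(\<lambda>x. F x \<bullet> F x) \<in> borel_measurable lebesgue" by measurable
  show "(\<lambda>x. F (s *\<^sub>R x + z)) \<in> L2"
    using lebesgue_integrable_affine[OF m assms(2), of z] assms(1) by (simp add: L2_iff)
  show "l2n (\<lambda>x. F (s *\<^sub>R x + z)) = l2n F"
    using lebesgue_integral_affine[OF m assms(2), of z] by (simp add: l2n_def l2ip_def)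
qed

text \<open>Dually, \<open>t \<mapsto> \<integral> U(x) \<phi>(x - t z) dx\<close> has derivative \<open>\<integral> (z \<bullet> G) \<phi>(\<cdot> - t z)\<close>, to which the mean value
  theorem applies; this avoids any approximation of \<open>U\<close> by smooth functions.\<close>

lemma translation_estimate:
  fixes U :: "plane \<Rightarrow> real"
  assumes U: "wgrad U G"
  shows "(\<lambda>x. U (x + z) - U x) \<in> L2" "l2n (\<lambda>x. U (x + z) - U x) \<le> norm z * l2n G"
proof -
  have UL: "U \<in> L2_loc" "(\<lambda>x. U (x + z)) \<in> L2_loc"
    using wgrad_L2_loc[OF U] L2_loc_affine[of U 1 z] by simp_all
  have bound: "\<bar>\<integral>x. \<phi> x * (U (x + z) - U x) \<partial>lebesgue\<bar> \<le> (norm z * l2n G) * l2n \<phi>"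
    if \<phi>: "\<phi> \<in> test_functions" for \<phi>
  proof -
    \<comment> \<open>After the reflection, the value of \<open>conv \<rho> U\<close> at t z is the
      integral of \<open>U\<close> against \<phi> translated by t z, a differentiable function of
      t.\<close>
    define \<rho> where "\<rho> y = \<phi> (- y)" for y
    have \<rho>: "\<rho> \<in> test_functions" using test_reflect[OF \<phi>, of 0] by (simp add: \<rho>_def[abs_def])
    define T' where "T' t = (\<Sum>i\<in>UNIV. z $ i * conv (partial_deriv i \<rho>) U (t *\<^sub>R z))" for t
    have "((\<lambda>t. conv \<rho> U (t *\<^sub>R z)) has_real_derivative T' t) (at t)" for t
    proof -
      have "((\<lambda>t. conv \<rho> U (t *\<^sub>R z)) has_derivative
        (\<lambda>d. \<Sum>i\<in>UNIV. (d *\<^sub>R z) $ i * conv (partial_deriv i \<rho>) U (t *\<^sub>R z))) (at t)"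
        by (rule has_derivative_compose[OF _ conv_has_derivative[OF \<rho> UL(1)]])
          (auto intro!: derivative_eq_intros)
      moreover have "(\<Sum>i\<in>UNIV. (d *\<^sub>R z) $ i * conv (partial_deriv i \<rho>) U (t *\<^sub>R z)) = T' t * d" for d
        unfolding T'_def sum_distrib_right by (simp add: ac_simps)
      ultimately show ?thesis by (simp add: has_field_derivative_def)
    qed
    then obtain s where s: "conv \<rho> U (1 *\<^sub>R z) - conv \<rho> U (0 *\<^sub>R z) = (1 - 0) * T' s"
      using MVT2[of 0 1 "\<lambda>t. conv \<rho> U (t *\<^sub>R z)" T'] by auto
    define \<sigma> where "\<sigma> x = \<rho> (s *\<^sub>R z - x)" for x
    have \<sigma>: "\<sigma> \<in> test_functions" unfolding \<sigma>_def by (rule test_reflect[OF \<rho>])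
    have "T' s = (\<Sum>i\<in>UNIV. z $ i * (\<integral>x. \<sigma> x * G x $ i \<partial>lebesgue))"
      unfolding T'_def conv_partial_deriv[OF U \<rho>] by (simp add: conv_def \<sigma>_def)
    also have "\<dots> = (\<integral>x. (\<Sum>i\<in>UNIV. z $ i * (\<sigma> x * G x $ i)) \<partial>lebesgue)"
      using test_mult_integrable[OF \<sigma> L2_imp_L2_loc[OF L2_vec_nth(1)[OF wgrad_L2[OF U]]]] by simp
    also have "\<dots> = l2ip \<sigma> (\<lambda>x. z \<bullet> G x)"
      by (simp add: l2ip_def inner_vec_def sum_distrib_left ac_simps)
    finally have "\<bar>T' s\<bar> \<le> l2n \<sigma> * l2n (\<lambda>x. z \<bullet> G x)"
      using l2ip_Cauchy_Schwarz[OF test_L2[OF \<sigma>] L2_inner_const(1)[OF wgrad_L2[OF U], of z]] by simp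
    also have "l2n \<sigma> = l2n \<phi>"
      using l2n_affine(2)[OF test_L2[OF \<phi>], of 1 "- s *\<^sub>R z"] by (simp add: \<sigma>_def[abs_def] \<rho>_def)
    also have "l2n \<phi> * l2n (\<lambda>x. z \<bullet> G x) \<le> l2n \<phi> * (norm z * l2n G)"
      by (intro mult_left_mono L2_inner_const(2)[OF wgrad_L2[OF U]] l2n_nonneg)
    finally have T': "\<bar>T' s\<bar> \<le> (norm z * l2n G) * l2n \<phi>" by (simp add: ac_simps)
    have [measurable]: "(\<lambda>x. \<phi> (x - z) * U x) \<in> borel_measurable lebesgue"
      using test_mult_integrable[OF test_affine[OF \<phi>, of 1 "- z"] UL(1)] by simp
    have "conv \<rho> U z = (\<integral>x. \<phi> (x - z) * U x \<partial>lebesgue)" by (simp add: conv_def \<rho>_def)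
    also have "\<dots> = (\<integral>x. \<phi> x * U (x + z) \<partial>lebesgue)"
      using lebesgue_integral_affine[of "\<lambda>x. \<phi> (x - z) * U x" 1 z] by simp
    finally have "conv \<rho> U z - conv \<rho> U 0 = (\<integral>x. \<phi> x * (U (x + z) - U x) \<partial>lebesgue)"
      using test_mult_integrable[OF \<phi> UL(1)] test_mult_integrable[OF \<phi> UL(2)]
      by (simp add: conv_def \<rho>_def right_diff_distrib)
    then show ?thesis using s T' by simp
  qed
  \<comment> \<open>Beforehand the difference is only locally square-integrable; its action on test
    functions yields global integrability and the norm at once.\<close>
  note d = L2_duality[OF L2_loc_diff[OF UL(2,1)] _ bound]
  show "(\<lambda>x. U (x + z) - U x) \<in> L2" by (rule d(1)) (simp add: l2n_nonneg)
  show "l2n (\<lambda>x. U (x + z) - U x) \<le> norm z * l2n G" by (rule d(2)) (simp add: l2n_nonneg)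
qed

section \<open>The Poincare inequality and completeness of gradients\<close>

definition ball_mean :: "real \<Rightarrow> (plane \<Rightarrow> real) \<Rightarrow> real" where
  "ball_mean s U = (\<integral>x. indicator (ball 0 s) x * U x \<partial>lebesgue) / measure lborel (ball (0::plane) s)"

text \<open>The integral of (a - U)^2 splits into the area times (a - mean)^2 and the variance, as
  the cross term integrates to zero. The \<open>ennreal\<close> form suits the iterated integrals of
  \<open>poincare\<close>, where \<open>a\<close> runs through the values of the function
  itself.\<close>

lemma ball_mean_variance:
  fixes U :: "plane \<Rightarrow> real"
  assumes U: "U \<in> L2_loc" and s: "s > 0"
  shows "ennreal (measure lborel (ball (0::plane) s) * (a - ball_mean s U)\<^sup>2)
    \<le> (\<integral>\<^sup>+y. ennreal (indicator (ball 0 s) y * (a - U y)\<^sup>2) \<partial>lebesgue)"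
proof -
  let ?I = "indicator (ball 0 s) :: plane \<Rightarrow> real"
  define c where "c = ball_mean s U"
  note cut = L2_loc_cut[OF U, of s]
  have i1: "integrable lebesgue (\<lambda>y. ?I y * U y)"
    using L2_bounded_support_integrable[OF cut, of s] by simp
  have i2: "integrable lebesgue (\<lambda>y. ?I y * (b - U y)\<^sup>2)" for b
  proof -
    have "(\<lambda>y. ?I y * (b - U y)\<^sup>2) = (\<lambda>y. (?I y *\<^sub>R (b - U y)) \<bullet> (?I y *\<^sub>R (b - U y)))"
      by (auto simp: fun_eq_iff indicator_def power2_eq_square)
    then show ?thesis
      using L2_loc_cut[OF L2_loc_diff[OF L2_loc_const[of b] U], of s] by (simp only: L2_iff)
  qed
  note i0 = integrable_indicator_ball[of "0::plane" s]
  have v: "(\<integral>y. ?I y \<partial>lebesgue) = measure lborel (ball (0::plane) s)" by simp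
  have vpos: "measure lborel (ball (0::plane) s) > 0" using s by simp
  have z: "(\<integral>y. ?I y * (c - U y) \<partial>lebesgue) = 0"
    using i0 i1 vpos by (simp add: right_diff_distrib c_def ball_mean_def)
  have i3: "integrable lebesgue (\<lambda>y. ?I y * (c - U y))"
    using i0 i1 by (simp add: right_diff_distrib)
  have "(\<integral>y. ?I y * (a - U y)\<^sup>2 \<partial>lebesgue)
    = (\<integral>y. (a - c)\<^sup>2 * ?I y + 2 * (a - c) * (?I y * (c - U y)) + ?I y * (c - U y)\<^sup>2 \<partial>lebesgue)"
    by (intro Bochner_Integration.integral_cong) (auto simp: power2_eq_square algebra_simps)
  also have "\<dots> = (a - c)\<^sup>2 * measure lborel (ball (0::plane) s) + (\<integral>y. ?I y * (c - U y)\<^sup>2 \<partial>lebesgue)"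
    using i0 i2 i3 z v by simp
  finally have "measure lborel (ball (0::plane) s) * (a - c)\<^sup>2 \<le> (\<integral>y. ?I y * (a - U y)\<^sup>2 \<partial>lebesgue)"
    by (simp add: mult.commute)
  moreover have "(\<integral>\<^sup>+y. ennreal (?I y * (a - U y)\<^sup>2) \<partial>lebesgue) = ennreal (\<integral>y. ?I y * (a - U y)\<^sup>2 \<partial>lebesgue)"
    by (rule nn_integral_eq_integral[OF i2]) simp
  ultimately show ?thesis by (simp add: c_def ennreal_leI)
qed

text \<open>By \<open>ball_mean_variance\<close> the left-hand side is at most a constant times the double integral of
  \<open>\<bar>U(x) - U(y)\<bar>\<^sup>2\<close> over \<open>ball 0 r \<times> ball 0 s\<close>; substitute \<open>x = y + z\<close> with \<open>\<bar>z\<bar> < 2 r\<close> and apply the translation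
  estimate for each \<open>z\<close>.\<close>

lemma poincare:
  fixes U :: "plane \<Rightarrow> real"
  assumes U: "wgrad U G" and s: "0 < s" "s \<le> r"
  shows "l2ip (\<lambda>x. indicator (ball 0 r) x *\<^sub>R (U x - ball_mean s U))
      (\<lambda>x. indicator (ball 0 r) x *\<^sub>R (U x - ball_mean s U)) \<le> 16 * r^4 / s\<^sup>2 * l2ip G G"
proof -
  \<comment> \<open>Interchanging the integrals requires joint measurability for the product of
    \<open>lborel\<close> with itself, hence a Borel representative of \<open>U\<close>.\<close>
  obtain W where W[measurable]: "W \<in> borel_measurable lborel" and eq: "AE x in lborel. U x = W x"
    using completion_ex_borel_measurable_real[of U lborel] L2_loc_measurable[OF wgrad_L2_loc[OF U]] by auto
  have eq': "AE x in lebesgue. U x = W x" using eq by (rule AE_completion)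
  have WL: "W \<in> borel_measurable lebesgue" using W by (rule measurable_completion)
  have wW: "wgrad W G" by (rule wgrad_cong_AE[OF U eq' WL])
  let ?v = "\<lambda>r. measure lborel (ball (0::plane) r)"
  let ?I = "\<lambda>r. indicator (ball 0 r) :: plane \<Rightarrow> real"
  let ?c = "ball_mean s U"
  have c: "ball_mean s W = ?c"
    unfolding ball_mean_def using eq' WL L2_loc_measurable[OF wgrad_L2_loc[OF U]]
    by (intro arg_cong2[of _ _ _ _ "(/)"] refl integral_cong_AE borel_measurable_times borel_measurable_indicator) auto
  define k where "k x y = ennreal (?I r x * (?I s y * (W x - W y)\<^sup>2))" for x y
  note ball_in_sets_lebesgue[measurable del]
  have [measurable]: "ball (0::plane) t \<in> sets borel" for t by simp
  have [measurable]: "(\<lambda>p. k (fst p) (snd p)) \<in> borel_measurable (lborel \<Otimes>\<^sub>M lborel)"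
    unfolding k_def by measurable
  have [measurable]: "(\<lambda>p. k (fst p + snd p) (snd p)) \<in> borel_measurable (lborel \<Otimes>\<^sub>M lborel)"
    unfolding k_def by measurable
  have "(\<integral>\<^sup>+x. ennreal (?I r x * (?v s * (W x - ?c)\<^sup>2)) \<partial>lborel) \<le> (\<integral>\<^sup>+x. \<integral>\<^sup>+y. k x y \<partial>lborel \<partial>lborel)"
  proof (rule nn_integral_mono)
    fix x
    show "ennreal (?I r x * (?v s * (W x - ?c)\<^sup>2)) \<le> (\<integral>\<^sup>+y. k x y \<partial>lborel)"
      using ball_mean_variance[OF wgrad_L2_loc[OF wW] s(1), of "W x"]
      by (cases "x \<in> ball 0 r") (simp_all add: c k_def nn_integral_completion)
  qed
  also have "\<dots> = (\<integral>\<^sup>+y. \<integral>\<^sup>+x. k x y \<partial>lborel \<partial>lborel)"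
    by (rule lborel_pair.Fubini'[symmetric]) (simp add: case_prod_beta)
  also have "\<dots> = (\<integral>\<^sup>+y. \<integral>\<^sup>+z. k (z + y) y \<partial>lborel \<partial>lborel)"
  proof (rule nn_integral_cong)
    fix y
    have "(\<lambda>x. k x y) \<in> borel_measurable lborel" unfolding k_def by measurable
    from nn_integral_lebesgue_affine[OF measurable_completion[OF this], of 1 y]
    show "(\<integral>\<^sup>+x. k x y \<partial>lborel) = (\<integral>\<^sup>+z. k (z + y) y \<partial>lborel)"
      by (simp add: nn_integral_completion)
  qed
  also have "\<dots> = (\<integral>\<^sup>+z. \<integral>\<^sup>+y. k (z + y) y \<partial>lborel \<partial>lborel)"
    by (rule lborel_pair.Fubini') (simp add: case_prod_beta)
  also have "\<dots> \<le> (\<integral>\<^sup>+z. ennreal ((2 * r)\<^sup>2 * l2ip G G) * indicator (ball (0::plane) (2 * r)) z \<partial>lborel)"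
  proof (rule nn_integral_mono)
    fix z :: plane
    show "(\<integral>\<^sup>+y. k (z + y) y \<partial>lborel) \<le> ennreal ((2 * r)\<^sup>2 * l2ip G G) * indicator (ball 0 (2 * r)) z"
    proof (cases "norm z < 2 * r")
      case True
      have t: "(\<lambda>y. W (y + z) - W y) \<in> L2" "l2n (\<lambda>y. W (y + z) - W y) \<le> norm z * l2n G"
        by (rule translation_estimate[OF wW])+
      have "(\<integral>\<^sup>+y. k (z + y) y \<partial>lborel) \<le> (\<integral>\<^sup>+y. ennreal ((norm (W (y + z) - W y))\<^sup>2) \<partial>lborel)"
        unfolding k_def by (intro nn_integral_mono ennreal_leI) (simp add: indicator_def add.commute)
      also have "\<dots> = ennreal ((l2n (\<lambda>y. W (y + z) - W y))\<^sup>2)"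
        using nn_integral_L2[OF t(1)] by (simp add: nn_integral_completion l2n_sq)
      also have "\<dots> \<le> ennreal ((2 * r * l2n G)\<^sup>2)"
        using True t(2) mult_right_mono[of "norm z" "2 * r" "l2n G"] l2n_nonneg[of G]
        by (intro ennreal_leI power_mono l2n_nonneg) linarith
      also have "(2 * r * l2n G)\<^sup>2 = (2 * r)\<^sup>2 * l2ip G G" by (simp add: power_mult_distrib l2n_sq)
      finally show ?thesis using True by simp
    next
      case False
      have "k (z + y) y = 0" for y
      proof (cases "norm (z + y) < r \<and> norm y < s")
        case True
        then have "norm z < 2 * r" using norm_triangle_ineq4[of "z + y" y] s by simp
        then show ?thesis using False by simp
      qed (auto simp: k_def)
      then show ?thesis by simp
    qed
  qed
  also have "\<dots> = ennreal ((2 * r)\<^sup>2 * l2ip G G) * ennreal (?v (2 * r))"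
  proof -
    have "emeasure lborel (ball (0::plane) (2 * r)) = ennreal (?v (2 * r))"
      using emeasure_lborel_ball_finite[of "0::plane" "2 * r"] by (intro emeasure_eq_ennreal_measure) auto
    then show ?thesis by (subst nn_integral_cmult_indicator) simp_all
  qed
  also have "\<dots> = ennreal (16 * r^4 / s\<^sup>2 * l2ip G G * ?v s)"
  proof -
    \<comment> \<open>The factor 16 r^4 / s^2 is the squared translation bound (2 r)^2 times the
      area ratio 4 r^2 / s^2 of the balls of radii 2 r and s.\<close>
    have "?v (2 * r) = 4 * r\<^sup>2 / s\<^sup>2 * ?v s"
      using s by (simp add: content_ball power2_eq_square)
    then have "(2 * r)\<^sup>2 * l2ip G G * ?v (2 * r) = 16 * r^4 / s\<^sup>2 * l2ip G G * ?v s"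
      by (simp only:) (simp add: power2_eq_square power4_eq_xxxx)
    then show ?thesis by (metis ennreal_mult l2ip_self_nonneg measure_nonneg mult_nonneg_nonneg zero_le_power2)
  qed
  finally have main: "(\<integral>\<^sup>+x. ennreal (?I r x * (?v s * (W x - ?c)\<^sup>2)) \<partial>lborel)
    \<le> ennreal (16 * r^4 / s\<^sup>2 * l2ip G G * ?v s)" .
  have vpos: "?v s > 0" using s by simp
  have L2: "(\<lambda>x. ?I r x *\<^sub>R (W x - ?c)) \<in> L2"
    by (intro L2_loc_cut L2_loc_diff L2_loc_const wgrad_L2_loc[OF wW])
  have "ennreal (?v s * l2ip (\<lambda>x. ?I r x *\<^sub>R (W x - ?c)) (\<lambda>x. ?I r x *\<^sub>R (W x - ?c)))
    = ennreal (?v s) * (\<integral>\<^sup>+x. ennreal ((norm (?I r x *\<^sub>R (W x - ?c)))\<^sup>2) \<partial>lebesgue)"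
    unfolding nn_integral_L2[OF L2] using vpos by (simp add: ennreal_mult l2ip_self_nonneg)
  also have "\<dots> = (\<integral>\<^sup>+x. ennreal (?I r x * (?v s * (W x - ?c)\<^sup>2)) \<partial>lborel)"
  proof -
    have m: "(\<lambda>x. ennreal ((norm (?I r x *\<^sub>R (W x - ?c)))\<^sup>2)) \<in> borel_measurable lborel"
      by measurable
    show ?thesis
      unfolding nn_integral_completion nn_integral_cmult[OF m, symmetric]
      by (intro nn_integral_cong) (auto simp: ennreal_mult[symmetric] indicator_def)
  qed
  also note main
  finally have "?v s * l2ip (\<lambda>x. ?I r x *\<^sub>R (W x - ?c)) (\<lambda>x. ?I r x *\<^sub>R (W x - ?c))
    \<le> ?v s * (16 * r^4 / s\<^sup>2 * l2ip G G)"
    using vpos by (simp add: ennreal_le_iff l2ip_self_nonneg mult.commute)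
  then have "l2ip (\<lambda>x. ?I r x *\<^sub>R (W x - ?c)) (\<lambda>x. ?I r x *\<^sub>R (W x - ?c)) \<le> 16 * r^4 / s\<^sup>2 * l2ip G G"
    using vpos by (simp only: mult_le_cancel_left_pos)
  moreover have "l2ip (\<lambda>x. ?I r x *\<^sub>R (U x - ?c)) (\<lambda>x. ?I r x *\<^sub>R (U x - ?c))
    = l2ip (\<lambda>x. ?I r x *\<^sub>R (W x - ?c)) (\<lambda>x. ?I r x *\<^sub>R (W x - ?c))"
    using eq' L2 L2_loc_cut[OF L2_loc_diff[OF wgrad_L2_loc[OF U] L2_loc_const[of ?c]], of r]
    by (intro l2ip_cong_AE) auto
  ultimately show ?thesis by simp
qed

text \<open>With equal radii the constant is linear in \<open>r\<close>, just what the gradient of a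
  cutoff at scale \<open>r\<close>, of order 1 / r, can compensate.\<close>

lemma poincare_ball:
  fixes U :: "plane \<Rightarrow> real"
  assumes U: "wgrad U G" and r: "r > 0"
  shows "l2n (\<lambda>x. indicator (ball 0 r) x *\<^sub>R (U x - ball_mean r U)) \<le> 4 * r * l2n G"
proof (rule power2_le_imp_le)
  have "16 * r^4 / r\<^sup>2 = (4 * r)\<^sup>2" using r by (simp add: power2_eq_square power4_eq_xxxx)
  then show "(l2n (\<lambda>x. indicator (ball 0 r) x *\<^sub>R (U x - ball_mean r U)))\<^sup>2 \<le> (4 * r * l2n G)\<^sup>2"
    using poincare[OF U r order_refl] by (simp only: l2n_sq power_mult_distrib)
qed (use r l2n_nonneg[of G] in simp)

text \<open>The mean is taken over the unit ball while the outer radius of the Poincare inequality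
  grows, so that one and the same constant serves on all balls.\<close>

lemma wgrad_zero_const:
  fixes U :: "plane \<Rightarrow> real"
  assumes U: "wgrad U G" and G: "AE x in lebesgue. G x = 0"
  shows "\<exists>c. AE x in lebesgue. U x = c"
proof -
  let ?c = "ball_mean 1 U"
  have "l2ip G G = l2ip (\<lambda>x. 0 :: real^2) (\<lambda>x. 0)"
    using G wgrad_L2[OF U] by (intro l2ip_cong_AE) (auto simp: L2_zero)
  then have G0: "l2ip G G = 0" by (simp add: l2ip_def)
  have "AE x in lebesgue. indicator (ball 0 (real (Suc r))) x *\<^sub>R (U x - ?c) = 0" for r :: nat
  proof (rule l2ip_self_zero_AE)
    show "(\<lambda>x. indicator (ball 0 (real (Suc r))) x *\<^sub>R (U x - ?c)) \<in> L2"
      by (intro L2_loc_cut L2_loc_diff L2_loc_const wgrad_L2_loc[OF U])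
    show "l2ip (\<lambda>x. indicator (ball 0 (real (Suc r))) x *\<^sub>R (U x - ?c))
        (\<lambda>x. indicator (ball 0 (real (Suc r))) x *\<^sub>R (U x - ?c)) = 0"
      using poincare[OF U, of 1 "real (Suc r)"] G0 by (intro antisym l2ip_self_nonneg) simp_all
  qed
  then have "AE x in lebesgue. \<forall>r::nat. indicator (ball 0 (real (Suc r))) x *\<^sub>R (U x - ?c) = 0"
    unfolding AE_all_countable by blast
  then have "AE x in lebesgue. U x = ?c"
  proof eventually_elim
    case (elim x)
    obtain r :: nat where "norm x < real r" using reals_Archimedean2 by blast
    then have "norm x < real (Suc r)" by simp
    then show ?case using elim[rule_format, of r] by (simp del: of_nat_Suc)
  qed
  then show ?thesis by blast
qed

lemma ball_mean_diff:
  assumes "U \<in> L2_loc" "V \<in> L2_loc"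
  shows "ball_mean s (\<lambda>x. U x - V x) = ball_mean s U - ball_mean s V"
proof -
  have "integrable lebesgue (\<lambda>x. indicator (ball 0 s) x * W x)" if "W \<in> L2_loc" for W :: "plane \<Rightarrow> real"
    using L2_bounded_support_integrable[OF L2_loc_cut[OF that, of s], of s] by simp
  from this[OF assms(1)] this[OF assms(2)] show ?thesis
    by (simp add: ball_mean_def right_diff_distrib diff_divide_distrib)
qed

text \<open>Convergent gradients say nothing about additive constants, so the potentials are first
  normalized to mean zero on the unit ball. The Poincare inequality then makes them Cauchy on every
  ball, and the weak gradient identity passes to the limit. This is the completeness of
  \<open>H1_dot\<close> modulo constants.\<close>

lemma wgrad_complete:
  fixes U :: "nat \<Rightarrow> plane \<Rightarrow> real"
  assumes U: "\<And>n. wgrad (U n) (G n)" and G: "G' \<in> L2" "(\<lambda>n. l2n (\<lambda>x. G n x - G' x)) \<longlonglongrightarrow> 0"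
  shows "\<exists>V. wgrad V G'"
proof -
  have "\<exists>k. l2n (\<lambda>x. G k x - G' x) < (1/2)^n / 2" for n :: nat
  proof -
    have "\<forall>\<^sub>F k in sequentially. l2n (\<lambda>x. G k x - G' x) < (1/2)^n / 2"
      using order_tendstoD(2)[OF G(2), of "(1/2)^n / 2"] by simp
    then show ?thesis by (auto simp: eventually_sequentially)
  qed
  \<comment> \<open>A subsequence whose distance to the limit is half of (1/2)^n; two such distances
    give (1/2)^n, hence the squared rate (1/4)^n of \<open>riesz_fischer_local\<close>.\<close>
  then obtain k where k: "\<And>n. l2n (\<lambda>x. G (k n) x - G' x) < (1/2)^n / 2" by metis
  define V where "V n x = U (k n) x - ball_mean 1 (U (k n))" for n x
  have V: "wgrad (V n) (G (k n))" for n unfolding V_def[abs_def] by (rule wgrad_sub_const[OF U])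
  have cauchy: "l2ip (\<lambda>x. G (k m) x - G (k n) x) (\<lambda>x. G (k m) x - G (k n) x) \<le> (1/4)^n" if "n \<le> m" for n m
  proof -
    have "l2n (\<lambda>x. G (k m) x - G (k n) x) \<le> l2n (\<lambda>x. G (k m) x - G' x) + l2n (\<lambda>x. G' x - G (k n) x)"
      by (intro l2n_triangle wgrad_L2[OF U] G)
    moreover have "(1/2::real)^m \<le> (1/2)^n" by (rule power_decreasing[OF that]) auto
    ultimately have "l2n (\<lambda>x. G (k m) x - G (k n) x) \<le> (1/2)^n"
      using k[of m] k[of n] l2n_minus_commute[of G' "G (k n)"] by linarith
    from power_mono[OF this l2n_nonneg, of 2] show ?thesis
      unfolding l2n_sq by (simp add: power2_eq_square flip: power_mult_distrib)
  qed
  \<comment> \<open>The constant of \<open>poincare\<close> for s = 1. The maximum ensures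
    \<open>s \<le> r\<close> for the radius 0 as well.\<close>
  define C where "C r = 16 * (max 1 r)^4" for r :: real
  have bd: "(\<integral>\<^sup>+x. ennreal ((norm (V m x - V n x))\<^sup>2) * indicator (ball 0 (real r)) x \<partial>lebesgue)
      \<le> ennreal (C (real r) * (1/4)^n)" if "n \<le> m" for r n m :: nat
  proof -
    let ?R = "max 1 (real r)" and ?D = "\<lambda>x. U (k m) x - U (k n) x"
    have D: "wgrad ?D (\<lambda>x. G (k m) x - G (k n) x)" by (rule wgrad_diff[OF U U])
    let ?E = "\<lambda>x. indicator (ball 0 ?R) x *\<^sub>R (?D x - ball_mean 1 ?D)"
    have E: "?E \<in> L2" by (intro L2_loc_cut L2_loc_diff L2_loc_const wgrad_L2_loc[OF U])
    have "(\<integral>\<^sup>+x. ennreal ((norm (V m x - V n x))\<^sup>2) * indicator (ball 0 (real r)) x \<partial>lebesgue)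
      \<le> (\<integral>\<^sup>+x. ennreal ((norm (?E x))\<^sup>2) \<partial>lebesgue)"
      by (intro nn_integral_mono)
        (auto simp: indicator_def V_def ball_mean_diff[OF wgrad_L2_loc[OF U] wgrad_L2_loc[OF U]] algebra_simps)
    also have "\<dots> = ennreal (l2ip ?E ?E)" by (rule nn_integral_L2[OF E])
    also have "\<dots> \<le> ennreal (C (real r) * (1/4)^n)"
    proof (rule ennreal_leI)
      have "l2ip ?E ?E \<le> 16 * ?R^4 / 1\<^sup>2 * l2ip (\<lambda>x. G (k m) x - G (k n) x) (\<lambda>x. G (k m) x - G (k n) x)"
        by (rule poincare[OF D]) auto
      also have "\<dots> = C (real r) * l2ip (\<lambda>x. G (k m) x - G (k n) x) (\<lambda>x. G (k m) x - G (k n) x)"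
        by (simp add: C_def)
      also have "\<dots> \<le> C (real r) * (1/4)^n" by (rule mult_left_mono[OF cauchy[OF that]]) (simp add: C_def)
      finally show "l2ip ?E ?E \<le> C (real r) * (1/4)^n" .
    qed
    finally show ?thesis .
  qed
  obtain W where Wm[measurable]: "W \<in> borel_measurable lebesgue" and W: "\<And>(r::nat) n.
      (\<integral>\<^sup>+x. ennreal ((norm (W x - V n x))\<^sup>2) * indicator (ball 0 r) x \<partial>lebesgue) \<le> ennreal (C (real r) * (1/4)^n)"
    using riesz_fischer_local[of V C, OF L2_loc_measurable[OF wgrad_L2_loc[OF V]] bd] by blast
  have Vm[measurable]: "V n \<in> borel_measurable lebesgue" for n by (rule L2_loc_measurable[OF wgrad_L2_loc[OF V]])
  have WV: "(\<lambda>x. indicator (ball 0 (real r)) x *\<^sub>R (W x - V n x)) \<in> L2"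
    "l2n (\<lambda>x. indicator (ball 0 (real r)) x *\<^sub>R (W x - V n x)) \<le> sqrt (C (real r)) * (1/2)^n" for r n :: nat
  proof -
    have "(\<integral>\<^sup>+x. ennreal ((norm (indicator (ball 0 (real r)) x *\<^sub>R (W x - V n x)))\<^sup>2) \<partial>lebesgue)
      = (\<integral>\<^sup>+x. ennreal ((norm (W x - V n x))\<^sup>2) * indicator (ball 0 (real r)) x \<partial>lebesgue)"
      by (intro nn_integral_cong) (simp add: indicator_def)
    with W[of n r] have le: "(\<integral>\<^sup>+x. ennreal ((norm (indicator (ball 0 (real r)) x *\<^sub>R (W x - V n x)))\<^sup>2) \<partial>lebesgue)
      \<le> ennreal (C (real r) * (1/4)^n)" by simp
    have m: "(\<lambda>x. indicator (ball 0 (real r)) x *\<^sub>R (W x - V n x)) \<in> borel_measurable lebesgue" by measurable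
    have c: "0 \<le> C (real r) * (1/4)^n" by (simp add: C_def)
    show "(\<lambda>x. indicator (ball 0 (real r)) x *\<^sub>R (W x - V n x)) \<in> L2"
      by (rule L2_nn_integral_bound(1)[OF m c le])
    have "sqrt ((1/4)^n) = (1/2::real)^n" by (simp add: real_sqrt_power real_sqrt_divide)
    then show "l2n (\<lambda>x. indicator (ball 0 (real r)) x *\<^sub>R (W x - V n x)) \<le> sqrt (C (real r)) * (1/2)^n"
      using real_sqrt_le_mono[OF L2_nn_integral_bound(2)[OF m c le]] by (simp add: l2n_def real_sqrt_mult)
  qed
  have "wgrad W G'"
  proof (rule wgradI)
    show WL: "W \<in> L2_loc"
    proof (rule L2_locI_cut[OF Wm])
      show "(\<lambda>x. indicator (ball 0 (real r)) x *\<^sub>R W x) \<in> L2" for r :: nat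
        using L2_add[OF WV(1)[of r 0] L2_loc_cut[OF wgrad_L2_loc[OF V[of 0]], of "real r"]]
        by (simp add: algebra_simps)
    qed
    fix \<phi> :: "plane \<Rightarrow> real" and i assume \<phi>: "\<phi> \<in> test_functions"
    let ?d = "partial_deriv i \<phi>"
    note d = test_partial_deriv[OF \<phi>, of i]
    obtain R where R: "\<And>x. R \<le> norm x \<Longrightarrow> ?d x = 0" using test_bounded_supp[OF d] by blast
    obtain r :: nat where r: "R < real r" using reals_Archimedean2 by blast
    have "(\<lambda>n. l2ip ?d (\<lambda>x. indicator (ball 0 (real r)) x *\<^sub>R (W x - V n x))) \<longlonglongrightarrow> 0"
    proof (rule Lim_null_comparison)
      show "\<forall>\<^sub>F n in sequentially. norm (l2ip ?d (\<lambda>x. indicator (ball 0 (real r)) x *\<^sub>R (W x - V n x)))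
          \<le> l2n ?d * (sqrt (C (real r)) * (1/2)^n)"
        using l2ip_Cauchy_Schwarz[OF test_L2[OF d] WV(1)] mult_left_mono[OF WV(2) l2n_nonneg[of ?d]]
        by (intro always_eventually allI) (simp only: real_norm_def, rule order_trans)
      have "(\<lambda>n. l2n ?d * (sqrt (C (real r)) * (1/2)^n)) \<longlonglongrightarrow> l2n ?d * (sqrt (C (real r)) * 0)"
        by (intro tendsto_intros LIMSEQ_power_zero) simp
      then show "(\<lambda>n. l2n ?d * (sqrt (C (real r)) * (1/2)^n)) \<longlonglongrightarrow> 0" by simp
    qed
    moreover have "l2ip ?d (\<lambda>x. indicator (ball 0 (real r)) x *\<^sub>R (W x - V n x))
      = (\<integral>x. ?d x * W x \<partial>lebesgue) - (\<integral>x. ?d x * V n x \<partial>lebesgue)" for n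
    proof -
      have "l2ip ?d (\<lambda>x. indicator (ball 0 (real r)) x *\<^sub>R (W x - V n x)) = (\<integral>x. ?d x * W x - ?d x * V n x \<partial>lebesgue)"
        unfolding l2ip_def using R r
        by (intro Bochner_Integration.integral_cong) (auto simp: indicator_def algebra_simps)
      also have "\<dots> = (\<integral>x. ?d x * W x \<partial>lebesgue) - (\<integral>x. ?d x * V n x \<partial>lebesgue)"
        by (intro Bochner_Integration.integral_diff test_mult_integrable d WL wgrad_L2_loc[OF V])
      finally show ?thesis .
    qed
    ultimately have "(\<lambda>n. (\<integral>x. ?d x * W x \<partial>lebesgue) - (\<integral>x. ?d x * V n x \<partial>lebesgue)) \<longlonglongrightarrow> 0" by simp
    then have lim1: "(\<lambda>n. \<integral>x. ?d x * V n x \<partial>lebesgue) \<longlonglongrightarrow> (\<integral>x. ?d x * W x \<partial>lebesgue)"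
      using tendsto_diff[OF tendsto_const, of _ 0 sequentially "\<integral>x. ?d x * W x \<partial>lebesgue"] by fastforce
    have "(\<lambda>n. l2ip \<phi> (\<lambda>x. G (k n) x $ i)) \<longlonglongrightarrow> l2ip \<phi> (\<lambda>x. G' x $ i)"
    proof (rule l2ip_tendsto)
      show "(\<lambda>n. l2n (\<lambda>x. G (k n) x $ i - G' x $ i)) \<longlonglongrightarrow> 0"
      proof (rule Lim_null_comparison)
        show "\<forall>\<^sub>F n in sequentially. norm (l2n (\<lambda>x. G (k n) x $ i - G' x $ i)) \<le> (1/2)^n / 2"
        proof (intro always_eventually allI)
          fix n
          show "norm (l2n (\<lambda>x. G (k n) x $ i - G' x $ i)) \<le> (1/2)^n / 2"
            using L2_vec_nth(2)[OF L2_diff[OF wgrad_L2[OF U[of "k n"]] G(1)], of i] k[of n]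
            by (simp add: l2n_nonneg)
        qed
        have "(\<lambda>n. (1/2)^n / 2 :: real) \<longlonglongrightarrow> 0 / 2" by (intro tendsto_intros LIMSEQ_power_zero) auto
        then show "(\<lambda>n. (1/2)^n / 2 :: real) \<longlonglongrightarrow> 0" by simp
      qed
    qed (intro L2_vec_nth(1) wgrad_L2[OF U] G test_L2 \<phi>)+
    then have "(\<lambda>n. - (\<integral>x. \<phi> x * G (k n) x $ i \<partial>lebesgue)) \<longlonglongrightarrow> - (\<integral>x. \<phi> x * G' x $ i \<partial>lebesgue)"
      by (intro tendsto_minus) (simp add: l2ip_def)
    then have "(\<lambda>n. \<integral>x. ?d x * V n x \<partial>lebesgue) \<longlonglongrightarrow> - (\<integral>x. \<phi> x * G' x $ i \<partial>lebesgue)"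
      by (simp add: wgrad_eq[OF V \<phi>])
    with lim1 show "(\<integral>x. ?d x * W x \<partial>lebesgue) = - (\<integral>x. \<phi> x * G' x $ i \<partial>lebesgue)"
      by (rule LIMSEQ_unique)
  qed (rule G)
  then show ?thesis by blast
qed

lemma wgrad_mult:
  fixes U :: "plane \<Rightarrow> real"
  assumes U: "wgrad U G" and \<phi>: "\<phi> \<in> test_functions"
  shows "wgrad (\<lambda>x. \<phi> x * U x) (\<lambda>x. \<phi> x *\<^sub>R G x + U x *\<^sub>R grad \<phi> x)"
    and "(\<lambda>x. \<phi> x * U x) \<in> L2"
    and "(\<lambda>x. U x *\<^sub>R grad \<phi> x) \<in> L2"
proof -
  show "(\<lambda>x. \<phi> x * U x) \<in> L2"
    using test_L2_loc_mult(1)[OF \<phi> wgrad_L2_loc[OF U]] by simp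
  then have L: "(\<lambda>x. \<phi> x * U x) \<in> L2_loc" by (rule L2_imp_L2_loc)
  have "(\<lambda>x. (\<chi> i. partial_deriv i \<phi> x * U x) :: real^2) \<in> L2"
    using test_L2_loc_mult(1)[OF test_partial_deriv[OF \<phi>] wgrad_L2_loc[OF U]] by (intro vec_L2) simp
  moreover have "(\<lambda>x. (\<chi> i. partial_deriv i \<phi> x * U x) :: real^2) = (\<lambda>x. U x *\<^sub>R grad \<phi> x)"
    by (simp add: fun_eq_iff vec_eq_iff grad_def)
  ultimately show gL: "(\<lambda>x. U x *\<^sub>R grad \<phi> x) \<in> L2" by simp
  show "wgrad (\<lambda>x. \<phi> x * U x) (\<lambda>x. \<phi> x *\<^sub>R G x + U x *\<^sub>R grad \<phi> x)"
  proof (rule wgradI[OF L])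
    show "(\<lambda>x. \<phi> x *\<^sub>R G x + U x *\<^sub>R grad \<phi> x) \<in> L2"
      by (intro L2_add gL test_L2_loc_mult(1) \<phi> L2_imp_L2_loc wgrad_L2[OF U])
    fix \<psi> :: "plane \<Rightarrow> real" and i assume \<psi>: "\<psi> \<in> test_functions"
    have t1: "(\<lambda>x. \<psi> x * \<phi> x) \<in> test_functions" by (intro test_mult \<psi> test_Ck \<phi>)
    have t2: "(\<lambda>x. \<psi> x * partial_deriv i \<phi> x) \<in> test_functions"
      by (intro test_mult \<psi> test_Ck test_partial_deriv \<phi>)
    have i1: "integrable lebesgue (\<lambda>x. partial_deriv i (\<lambda>x. \<psi> x * \<phi> x) x * U x)"
      by (intro test_mult_integrable test_partial_deriv t1 wgrad_L2_loc[OF U])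
    have i2: "integrable lebesgue (\<lambda>x. (\<psi> x * partial_deriv i \<phi> x) * U x)"
      by (intro test_mult_integrable t2 wgrad_L2_loc[OF U])
    have i3: "integrable lebesgue (\<lambda>x. (\<psi> x * \<phi> x) * G x $ i)"
      by (intro test_mult_integrable t1 L2_imp_L2_loc L2_vec_nth(1) wgrad_L2[OF U])
    have "(\<integral>x. partial_deriv i \<psi> x * (\<phi> x * U x) \<partial>lebesgue)
      = (\<integral>x. partial_deriv i (\<lambda>x. \<psi> x * \<phi> x) x * U x - (\<psi> x * partial_deriv i \<phi> x) * U x \<partial>lebesgue)"
      by (intro Bochner_Integration.integral_cong refl)
        (simp only: partial_deriv_mult[OF \<psi> \<phi>], simp add: algebra_simps)
    also have "\<dots> = - (\<integral>x. (\<psi> x * \<phi> x) * G x $ i \<partial>lebesgue) - (\<integral>x. (\<psi> x * partial_deriv i \<phi> x) * U x \<partial>lebesgue)"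
      using i1 i2 wgrad_eq[OF U t1, of i] by simp
    also have "\<dots> = - (\<integral>x. (\<psi> x * \<phi> x) * G x $ i + (\<psi> x * partial_deriv i \<phi> x) * U x \<partial>lebesgue)"
      using i2 i3 by simp
    also have "(\<lambda>x. (\<psi> x * \<phi> x) * G x $ i + (\<psi> x * partial_deriv i \<phi> x) * U x)
      = (\<lambda>x. \<psi> x * (\<phi> x *\<^sub>R G x + U x *\<^sub>R grad \<phi> x) $ i)"
      by (simp add: fun_eq_iff grad_def algebra_simps)
    finally show "(\<integral>x. partial_deriv i \<psi> x * (\<phi> x * U x) \<partial>lebesgue)
      = - (\<integral>x. \<psi> x * (\<phi> x *\<^sub>R G x + U x *\<^sub>R grad \<phi> x) $ i \<partial>lebesgue)" .
  qed
qed

section \<open>Fields orthogonal to the gradients of test functions\<close>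

text \<open>The cross-correlation. Its value at 0 is the inner product of \<open>F\<close> and
  \<open>G\<close>; its continuity lets a statement for almost every shift reach the shift
  0.\<close>

definition corr :: "(plane \<Rightarrow> real) \<Rightarrow> (plane \<Rightarrow> real) \<Rightarrow> plane \<Rightarrow> real" where
  "corr F G y = (\<integral>x. F x * G (x - y) \<partial>lebesgue)"

lemma corr_bound:
  fixes F G :: "plane \<Rightarrow> real"
  assumes "F \<in> L2" "G \<in> L2" shows "\<bar>corr F G y\<bar> \<le> l2n F * l2n G"
  using l2ip_Cauchy_Schwarz[OF assms(1) l2n_affine(1)[OF assms(2), of 1 "- y"]]
    l2n_affine(2)[OF assms(2), of 1 "- y"] by (simp add: corr_def l2ip_def)

lemma corr_integrable:
  fixes F G :: "plane \<Rightarrow> real"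
  assumes "F \<in> L2" "G \<in> L2" shows "integrable lebesgue (\<lambda>x. F x * G (x - y))"
  using L2_integrable_inner[OF assms(1) l2n_affine(1)[OF assms(2), of 1 "- y"]] by simp

text \<open>When \<open>F\<close> is a test function the correlation is a reflected convolution,
  hence continuous. In general it is a uniform limit of such functions, by density and the bound of
  \<open>corr_bound\<close>, which is uniform in the shift.\<close>

lemma corr_continuous:
  assumes F: "F \<in> L2" and G: "G \<in> L2" shows "continuous_on UNIV (corr F G)"
proof -
  have "\<exists>\<phi>\<in>test_functions. l2n (\<lambda>x. F x - \<phi> x) < 1 / real (Suc n)" for n
    using test_dense_L2[OF F, of "1 / real (Suc n)"] by (metis of_nat_0_less_iff zero_less_Suc zero_less_divide_1_iff)
  then obtain \<phi> where \<phi>: "\<And>n. \<phi> n \<in> test_functions" "\<And>n. l2n (\<lambda>x. F x - \<phi> n x) < 1 / real (Suc n)"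
    by metis
  have cont: "continuous_on UNIV (corr (\<phi> n) G)" for n
  proof -
    let ?\<rho> = "\<lambda>x. \<phi> n (- x)"
    have \<rho>: "?\<rho> \<in> test_functions" using test_reflect[OF \<phi>(1)[of n], of 0] by simp
    have GL: "G \<in> L2_loc" by (rule L2_imp_L2_loc[OF G])
    have "corr (\<phi> n) G y = conv ?\<rho> G (- y)" for y
      using lebesgue_integral_affine[OF borel_measurable_integrable[OF corr_integrable[OF test_L2[OF \<phi>(1)] G, of n y]], of 1 y]
      by (simp add: corr_def conv_def add.commute)
    moreover have "continuous_on UNIV (\<lambda>y. conv ?\<rho> G (- y))"
      by (rule continuous_on_compose2[of UNIV "conv ?\<rho> G" UNIV uminus])
        (use Ck_conv[OF GL \<rho>, of 0] in \<open>auto intro: continuous_on_minus\<close>)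
    ultimately show ?thesis by simp
  qed
  have "uniform_limit UNIV (\<lambda>n. corr (\<phi> n) G) (corr F G) sequentially"
  proof (rule uniform_limitI)
    fix e :: real assume "e > 0"
    then have "e / (l2n G + 1) > 0" using l2n_nonneg[of G] by simp
    then obtain N where N: "1 / real (Suc N) < e / (l2n G + 1)" using nat_approx_posE by blast
    have "dist (corr (\<phi> n) G y) (corr F G y) < e" if "n \<ge> N" for n y
    proof -
      have "corr (\<lambda>x. F x - \<phi> n x) G y = corr F G y - corr (\<phi> n) G y"
        using corr_integrable[OF F G, of y] corr_integrable[OF test_L2[OF \<phi>(1)[of n]] G, of y]
        by (simp add: corr_def left_diff_distrib)
      then have "dist (corr (\<phi> n) G y) (corr F G y) \<le> l2n (\<lambda>x. F x - \<phi> n x) * l2n G"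
        using corr_bound[OF L2_diff[OF F test_L2[OF \<phi>(1)[of n]]] G, of y] by (simp add: dist_real_def abs_minus_commute)
      also have "\<dots> \<le> (1 / real (Suc N)) * l2n G"
      proof (rule mult_right_mono[OF _ l2n_nonneg])
        have "1 / real (Suc n) \<le> 1 / real (Suc N)" using that by (simp add: frac_le)
        then show "l2n (\<lambda>x. F x - \<phi> n x) \<le> 1 / real (Suc N)" using \<phi>(2)[of n] by linarith
      qed
      also have "\<dots> \<le> (1 / real (Suc N)) * (l2n G + 1)" by (rule mult_left_mono) auto
      also have "\<dots> < e" using N l2n_nonneg[of G] by (simp add: pos_less_divide_eq)
      finally show ?thesis .
    qed
    then show "\<forall>\<^sub>F n in sequentially. \<forall>y\<in>UNIV. dist (corr (\<phi> n) G y) (corr F G y) < e"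
      by (auto intro!: eventually_sequentiallyI[of N])
  qed
  then show ?thesis using cont by (intro uniform_limit_theorem[OF always_eventually]) auto
qed

lemma AE_lebesgue_affine:
  assumes "AE x in lebesgue. P (x::plane)" "\<bar>s\<bar> = (1::real)"
  shows "AE x in lebesgue. P (s *\<^sub>R x + z)"
  using AE_distrD[OF lebesgue_distr_affine(2)[OF assms(2), of z], where P = P] assms(1)
  unfolding lebesgue_distr_affine(1)[OF assms(2)] by blast

lemma borel_representative:
  fixes F :: "plane \<Rightarrow> real"
  assumes "F \<in> L2"
  obtains W where "W \<in> borel_measurable lborel" "AE x in lebesgue. F x = W x" "W \<in> L2"
proof -
  obtain W where W: "W \<in> borel_measurable lborel" "AE x in lborel. F x = W x"
    using completion_ex_borel_measurable_real[of F lborel] L2_measurable[OF assms] by auto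
  then have "AE x in lebesgue. F x = W x" by (intro AE_completion)
  moreover from this have "W \<in> L2"
    by (rule L2_cong_AE[OF assms]) (rule measurable_completion[OF W(1)])
  ultimately show ?thesis using that W by blast
qed

text \<open>Both sides are the double integral of \<rho>(y) F(z) G(z - y) over y and z, in different
  orders. The inner integral over z of the absolute value is at most |\<rho>(y)| times the product
  of the norms, which is integrable in y; Borel representatives provide joint measurability.\<close>

lemma integral_conv_eq_corr:
  fixes F G :: "plane \<Rightarrow> real"
  assumes F: "F \<in> L2" and G: "G \<in> L2" and \<rho>: "\<rho> \<in> test_functions"
  shows "(\<integral>z. F z * conv \<rho> G z \<partial>lebesgue) = (\<integral>y. \<rho> y * corr F G y \<partial>lebesgue)"
proof -
  obtain F' where F'[measurable]: "F' \<in> borel_measurable lborel" and eqF: "AE x in lebesgue. F x = F' x" and F'L: "F' \<in> L2"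
    using borel_representative[OF F] by blast
  obtain G' where G'[measurable]: "G' \<in> borel_measurable lborel" and eqG: "AE x in lebesgue. G x = G' x" and G'L: "G' \<in> L2"
    using borel_representative[OF G] by blast
  have \<rho>b[measurable]: "\<rho> \<in> borel_measurable borel"
    by (rule borel_measurable_continuous_onI[OF test_continuous[OF \<rho>]])
  have corr_eq: "corr F G y = corr F' G' y" for y
    unfolding corr_def
  proof (rule integral_cong_AE)
    have "AE x in lebesgue. G (1 *\<^sub>R x + - y) = G' (1 *\<^sub>R x + - y)"
      by (rule AE_lebesgue_affine[OF eqG]) simp
    with eqF show "AE x in lebesgue. F x * G (x - y) = F' x * G' (x - y)"
      by eventually_elim simp
  qed (rule borel_measurable_integrable, rule corr_integrable, fact, fact)+
  have conv_eq: "conv \<rho> G z = (\<integral>y. \<rho> y * G' (z - y) \<partial>lebesgue)" for z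
  proof -
    have i: "integrable lebesgue (\<lambda>x. \<rho> (z - x) * H x)" if "H \<in> L2" for H
      by (intro test_mult_integrable test_reflect \<rho> L2_imp_L2_loc that)
    have "conv \<rho> G z = (\<integral>x. \<rho> (z - x) * G' x \<partial>lebesgue)"
      unfolding conv_def
      by (rule integral_cong_AE[OF borel_measurable_integrable[OF i[OF G]] borel_measurable_integrable[OF i[OF G'L]]])
        (use eqG in eventually_elim, simp)
    also have "\<dots> = (\<integral>y. \<rho> y * G' (z - y) \<partial>lebesgue)"
      using lebesgue_integral_affine[OF borel_measurable_integrable[OF i[OF G'L]], of "-1" z] by simp
    finally show ?thesis .
  qed
  define k where "k y z = \<rho> y * (F' z * G' (z - y))" for y z
  have km[measurable]: "case_prod k \<in> borel_measurable (lborel \<Otimes>\<^sub>M lborel)"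
    unfolding k_def by measurable
  have int_z: "integrable lborel (\<lambda>z. F' z * G' (z - y))" for y
    using corr_integrable[OF F'L G'L, of y] by (subst (asm) integrable_completion) measurable
  have "integrable (lborel \<Otimes>\<^sub>M lborel) (case_prod k)"
  proof (rule lborel_pair.Fubini_integrable[OF km])
    show "AE y in lborel. integrable lborel (\<lambda>z. case_prod k (y, z))"
      using int_z by (auto simp: k_def)
    have m: "(\<lambda>y. \<integral>z. norm (case_prod k (y, z)) \<partial>lborel) \<in> borel_measurable lborel" by measurable
    have r: "integrable lborel (\<lambda>y. \<rho> y * (l2n F' * l2n G'))"
      using test_integrable[OF \<rho>] by (subst (asm) integrable_completion) auto
    show "integrable lborel (\<lambda>y. \<integral>z. norm (case_prod k (y, z)) \<partial>lborel)"
    proof (rule integrable_bound_all[OF r m])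
      fix y
      have "(\<integral>z. norm (case_prod k (y, z)) \<partial>lborel) = \<bar>\<rho> y\<bar> * (\<integral>z. \<bar>F' z\<bar> * \<bar>G' (z - y)\<bar> \<partial>lborel)"
        by (simp add: k_def abs_mult)
      also have "(\<integral>z. \<bar>F' z\<bar> * \<bar>G' (z - y)\<bar> \<partial>lborel) = corr (\<lambda>x. \<bar>F' x\<bar>) (\<lambda>x. \<bar>G' x\<bar>) y"
        unfolding corr_def by (subst integral_completion) auto
      finally have eq: "(\<integral>z. norm (case_prod k (y, z)) \<partial>lborel) = \<bar>\<rho> y\<bar> * corr (\<lambda>x. \<bar>F' x\<bar>) (\<lambda>x. \<bar>G' x\<bar>) y" .
      have abs: "(\<lambda>x. \<bar>H x\<bar>) \<in> L2" "l2n (\<lambda>x. \<bar>H x\<bar>) = l2n H" if "H \<in> L2" for H :: "plane \<Rightarrow> real"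
        using that L2_measurable[OF that] by (auto simp: L2_iff l2n_def l2ip_def)
      have "\<bar>corr (\<lambda>x. \<bar>F' x\<bar>) (\<lambda>x. \<bar>G' x\<bar>) y\<bar> \<le> l2n F' * l2n G'"
        using corr_bound[OF abs(1)[OF F'L] abs(1)[OF G'L], of y] by (simp add: abs(2) F'L G'L)
      then show "norm (\<integral>z. norm (case_prod k (y, z)) \<partial>lborel) \<le> norm (\<rho> y * (l2n F' * l2n G'))"
        unfolding eq using l2n_nonneg[of F'] l2n_nonneg[of G'] by (simp add: abs_mult mult_left_mono)
    qed
  qed
  note fub = lborel_pair.Fubini_integral[OF this]
  have "(\<integral>y. \<rho> y * corr F G y \<partial>lebesgue) = (\<integral>y. \<rho> y * corr F' G' y \<partial>lebesgue)" by (simp add: corr_eq)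
  also have "\<dots> = (\<integral>y. \<integral>z. k y z \<partial>lborel \<partial>lborel)"
  proof -
    have "\<rho> y * corr F' G' y = (\<integral>z. k y z \<partial>lborel)" for y
      unfolding corr_def k_def by (subst integral_completion) auto
    then show ?thesis by (simp, subst integral_completion) measurable
  qed
  also have "\<dots> = (\<integral>z. \<integral>y. k y z \<partial>lborel \<partial>lborel)" using fub by simp
  also have "\<dots> = (\<integral>z. F' z * conv \<rho> G z \<partial>lebesgue)"
  proof -
    have "F' z * conv \<rho> G z = (\<integral>y. k y z \<partial>lborel)" for z
    proof -
      have "(\<integral>y. k y z \<partial>lborel) = (\<integral>y. F' z * (\<rho> y * G' (z - y)) \<partial>lborel)" by (simp add: k_def ac_simps)
      also have "\<dots> = F' z * conv \<rho> G z"
        unfolding conv_eq by (subst integral_completion) auto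
      finally show ?thesis by simp
    qed
    then show ?thesis by (simp, subst integral_completion) measurable
  qed
  also have "\<dots> = (\<integral>z. F z * conv \<rho> G z \<partial>lebesgue)"
  proof (rule integral_cong_AE)
    have [measurable]: "conv \<rho> G \<in> borel_measurable lebesgue"
      using borel_measurable_continuous_onI[of "conv \<rho> G"] Ck_conv[OF L2_imp_L2_loc[OF G] \<rho>, of 0]
      by (simp add: measurable_completion)
    note [measurable] = L2_measurable[OF F] L2_measurable[OF F'L]
    show "(\<lambda>z. F' z * conv \<rho> G z) \<in> borel_measurable lebesgue" "(\<lambda>z. F z * conv \<rho> G z) \<in> borel_measurable lebesgue"
      by measurable
    show "AE z in lebesgue. F' z * conv \<rho> G z = F z * conv \<rho> G z"
      using eqF by eventually_elim simp
  qed
  finally show ?thesis by simp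
qed

text \<open>The gradient of the test function \<open>conv \<rho> w\<close> is the convolution of \<open>\<rho>\<close> with \<open>G\<close>. Hence the continuous
  function \<open>y \<mapsto> \<integral> F(x) \<bullet> G(x - y) dx\<close> is orthogonal to every test function \<open>\<rho>\<close>, and so it vanishes at \<open>y = 0\<close>.\<close>

lemma orthogonal_compact_support:
  fixes F G :: "plane \<Rightarrow> real^2"
  assumes F: "F \<in> L2" and orth: "\<And>\<phi>. \<phi> \<in> test_functions \<Longrightarrow> l2ip F (grad \<phi>) = 0"
    and w: "wgrad w G" and supp: "\<And>x. r \<le> norm x \<Longrightarrow> w x = 0"
  shows "l2ip F G = 0"
proof -
  have FG: "(\<lambda>x. F x $ i) \<in> L2" "(\<lambda>x. G x $ i) \<in> L2" for i
    by (intro L2_vec_nth(1) F wgrad_L2[OF w])+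
  define c where "c y = (\<Sum>i\<in>UNIV. corr (\<lambda>x. F x $ i) (\<lambda>x. G x $ i) y)" for y
  have zero: "(\<integral>y. \<rho> y * c y \<partial>lebesgue) = 0" if \<rho>: "\<rho> \<in> test_functions" for \<rho>
  proof -
    obtain r' where r': "\<And>x. r' \<le> norm x \<Longrightarrow> \<rho> x = 0" using test_bounded_supp[OF \<rho>] by blast
    \<comment> \<open>Supports add up under convolution, so the bounded support of \<open>w\<close>
      turns the smooth function \<open>conv \<rho> w\<close> into a test function.\<close>
    have T: "conv \<rho> w \<in> test_functions"
    proof (rule test_functionI[OF Ck_conv[OF wgrad_L2_loc[OF w] \<rho>] compact_cball[of 0 "r + r'"]])
      fix z assume nz: "conv \<rho> w z \<noteq> 0"
      show "z \<in> cball 0 (r + r')"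
      proof (rule ccontr)
        assume "z \<notin> cball 0 (r + r')"
        then have z: "norm z > r + r'" by simp
        have "\<rho> (z - x) * w x = 0" for x
        proof (cases "r \<le> norm x")
          case False
          have "norm z \<le> norm (z - x) + norm x" using norm_triangle_ineq[of "z - x" x] by simp
          then show ?thesis using r'[of "z - x"] z False by simp
        qed (simp add: supp)
        then have "conv \<rho> w z = (\<integral>x. 0 \<partial>(lebesgue :: plane measure))"
          unfolding conv_def by (intro Bochner_Integration.integral_cong refl)
        then show False using nz by simp
      qed
    qed
    have pd: "partial_deriv i (conv \<rho> w) z = conv \<rho> (\<lambda>x. G x $ i) z" for i z
      by (simp add: partial_deriv_conv[OF \<rho> wgrad_L2_loc[OF w]] conv_partial_deriv[OF w \<rho>])
    have int: "integrable lebesgue (\<lambda>z. F z $ i * conv \<rho> (\<lambda>x. G x $ i) z)" for i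
      using L2_integrable_inner[OF FG(1)[of i] test_L2[OF test_partial_deriv[OF T, of i]]] by (simp add: pd)
    have cm[measurable]: "corr (\<lambda>x. F x $ i) (\<lambda>x. G x $ i) \<in> borel_measurable lebesgue" for i
      using borel_measurable_continuous_onI[OF corr_continuous[OF FG]] by (simp add: measurable_completion)
    have \<rho>m[measurable]: "\<rho> \<in> borel_measurable lebesgue" by (rule test_measurable[OF \<rho>])
    have int2: "integrable lebesgue (\<lambda>y. \<rho> y * corr (\<lambda>x. F x $ i) (\<lambda>x. G x $ i) y)" for i
    proof (rule integrable_bound_all[of _ "\<lambda>y. \<rho> y * (l2n (\<lambda>x. F x $ i) * l2n (\<lambda>x. G x $ i))"])
      show "integrable lebesgue (\<lambda>y. \<rho> y * (l2n (\<lambda>x. F x $ i) * l2n (\<lambda>x. G x $ i)))"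
        using test_integrable[OF \<rho>] by simp
      show "norm (\<rho> y * corr (\<lambda>x. F x $ i) (\<lambda>x. G x $ i) y)
        \<le> norm (\<rho> y * (l2n (\<lambda>x. F x $ i) * l2n (\<lambda>x. G x $ i)))" for y
        using corr_bound[OF FG[of i], of y]
        by (simp add: abs_mult abs_of_nonneg[OF l2n_nonneg] mult_left_mono)
    qed measurable
    have "0 = l2ip F (grad (conv \<rho> w))" using orth[OF T] by simp
    also have "\<dots> = (\<integral>z. (\<Sum>i\<in>UNIV. F z $ i * conv \<rho> (\<lambda>x. G x $ i) z) \<partial>lebesgue)"
      by (simp add: l2ip_def inner_vec_def grad_def pd)
    also have "\<dots> = (\<Sum>i\<in>UNIV. \<integral>z. F z $ i * conv \<rho> (\<lambda>x. G x $ i) z \<partial>lebesgue)"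
      using int by simp
    also have "\<dots> = (\<Sum>i\<in>UNIV. \<integral>y. \<rho> y * corr (\<lambda>x. F x $ i) (\<lambda>x. G x $ i) y \<partial>lebesgue)"
      by (simp add: integral_conv_eq_corr[OF FG \<rho>])
    also have "\<dots> = (\<integral>y. \<rho> y * c y \<partial>lebesgue)"
      using int2 by (simp add: c_def sum_distrib_left)
    finally show ?thesis by simp
  qed
  have c_cont: "continuous_on UNIV c"
    unfolding c_def[abs_def] by (intro continuous_on_sum corr_continuous FG)
  have cm[measurable]: "c \<in> borel_measurable lebesgue"
    using borel_measurable_continuous_onI[OF c_cont] by (simp add: measurable_completion)
  define B where "B = (\<Sum>i\<in>UNIV. l2n (\<lambda>x. F x $ i) * l2n (\<lambda>x. G x $ i))"
  have c_bound: "\<bar>c y\<bar> \<le> B" for y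
    unfolding c_def B_def by (rule order_trans[OF sum_abs], rule sum_mono) (rule corr_bound[OF FG])
  have "c \<in> L2_loc"
  proof (rule L2_locI[OF cm])
    fix r :: real
    have B: "integrable lebesgue (\<lambda>x::plane. indicator (ball 0 r) x * B\<^sup>2)"
      by (intro integrable_mult_left integrable_indicator_ball)
    have "(c x)\<^sup>2 \<le> B\<^sup>2" for x using power_mono[OF c_bound[of x], of 2] by simp
    then show "integrable lebesgue (\<lambda>x. indicator (ball 0 r) x * (norm (c x))\<^sup>2)"
      by (intro integrable_bound_all[OF B]) (measurable, simp add: abs_mult mult_left_mono)
  qed
  from fundamental_lemma[OF this zero] have AE: "AE y in lebesgue. c y = 0" .
  have "c 0 = 0"
  proof (rule ccontr)
    assume nz: "c 0 \<noteq> 0"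
    have "open (c -` (- {0}))"
      using c_cont by (intro open_vimage) (auto simp: open_Compl)
    moreover have "negligible (c -` (- {0}))"
    proof -
      have m: "{x \<in> space lebesgue. \<not> c x = 0} \<in> sets lebesgue" by measurable
      then show ?thesis using AE AE_iff_null[OF m] by (simp add: negligible_iff_null_sets vimage_def)
    qed
    ultimately show False using open_not_negligible nz by blast
  qed
  then show ?thesis
    using L2_integrable_inner[OF FG] by (simp add: c_def corr_def l2ip_def inner_vec_def)
qed

text \<open>The cutoff times the normalized potential falls under
  \<open>orthogonal_compact_support\<close>. What is left pairs the tail \<open>T\<close> of
  \<open>F\<close> with two fields that are bounded by multiples of \<open>l2n G\<close> independent
  of the scale: for the second, the slope K / n of the cutoff cancels the Poincare constant 12
  n.\<close>

lemma orthogonal_gradients: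
  fixes F G :: "plane \<Rightarrow> real^2"
  assumes F: "F \<in> L2" and orth: "\<And>\<phi>. \<phi> \<in> test_functions \<Longrightarrow> l2ip F (grad \<phi>) = 0"
    and w: "wgrad w G"
  shows "l2ip F G = 0"
proof -
  let ?\<zeta> = "bump 0 1"
  have \<zeta>: "?\<zeta> \<in> test_functions" by (rule test_bump) simp
  obtain K where K: "K \<ge> 0" "\<And>x. norm (grad ?\<zeta> x) \<le> K" using test_grad_bounded[OF \<zeta>] by blast
  note Fm[measurable] = L2_measurable[OF F]
  define T where "T n x = indicator (- ball 0 (real n)) x *\<^sub>R F x" for n x
  have TL: "T n \<in> L2" for n
    unfolding T_def[abs_def] by (rule L2_mult_bounded(1)[OF F borel_measurable_indicator, of _ 1])
      (simp_all add: Compl_in_sets_lebesgue ball_in_sets_lebesgue indicator_def)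
  have T_lim: "(\<lambda>n. l2n (T n)) \<longlonglongrightarrow> 0"
  proof -
    have "(\<lambda>n. \<integral>x. T n x \<bullet> T n x \<partial>lebesgue) \<longlonglongrightarrow> (\<integral>x. 0 \<partial>(lebesgue :: plane measure))"
    proof (rule integral_dominated_convergence[where w = "\<lambda>x. F x \<bullet> F x"])
      show "integrable lebesgue (\<lambda>x. F x \<bullet> F x)" using F by (simp add: L2_iff)
      show "AE x in lebesgue. (\<lambda>n. T n x \<bullet> T n x) \<longlonglongrightarrow> 0"
      proof (rule AE_I2)
        fix x :: plane
        obtain N :: nat where N: "norm x < real N" using reals_Archimedean2 by blast
        then have "T n x \<bullet> T n x = 0" if "n \<ge> N" for n
          using that by (simp add: T_def indicator_def)
        then show "(\<lambda>n. T n x \<bullet> T n x) \<longlonglongrightarrow> 0"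
          by (intro tendsto_eventually eventually_sequentiallyI[of N])
      qed
      show "AE x in lebesgue. norm (T n x \<bullet> T n x) \<le> F x \<bullet> F x" for n
        by (simp add: T_def indicator_def)
      show "(\<lambda>x. T n x \<bullet> T n x) \<in> borel_measurable lebesgue" for n
        by (intro borel_measurable_inner L2_measurable TL)
    qed simp
    then have "(\<lambda>n. sqrt (l2ip (T n) (T n))) \<longlonglongrightarrow> sqrt 0" by (intro tendsto_real_sqrt) (simp add: l2ip_def)
    then show ?thesis by (simp add: l2n_def)
  qed
  have bound: "\<bar>l2ip F G\<bar> \<le> l2n (T (Suc m)) * ((1 + 12 * K) * l2n G)" for m
  proof -
    define n where "n = real (Suc m)"
    have n: "n > 0" by (simp add: n_def)
    define \<zeta>n where "\<zeta>n x = ?\<zeta> ((1 / n) *\<^sub>R x)" for x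
    have \<zeta>n: "\<zeta>n \<in> test_functions"
      using test_affine[OF \<zeta>, of "1 / n" 0] n by (simp add: \<zeta>n_def[abs_def])
    have \<zeta>n_val: "0 \<le> \<zeta>n x" "\<zeta>n x \<le> 1" "norm x < n \<Longrightarrow> \<zeta>n x = 1" "2 * n \<le> norm x \<Longrightarrow> \<zeta>n x = 0" for x
      using bump_nonneg[of 1 0] bump_le_1[of 1 0] bump_eq_1[of 1 "(1 / n) *\<^sub>R x" 0]
        bump_nonzero_iff[of 1 0 "(1 / n) *\<^sub>R x"] n
      by (auto simp: \<zeta>n_def field_simps)
    have pd: "partial_deriv i \<zeta>n x = (1 / n) * partial_deriv i ?\<zeta> ((1 / n) *\<^sub>R x)" for i x
      using partial_deriv_affine[OF \<zeta>, of i "1 / n" 0 x] by (simp add: \<zeta>n_def[abs_def])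
    have "grad \<zeta>n x = (1 / n) *\<^sub>R grad ?\<zeta> ((1 / n) *\<^sub>R x)" for x
      by (simp add: grad_def vec_eq_iff pd)
    then have grad_bound: "norm (grad \<zeta>n x) \<le> K / n" for x
      using K(2)[of "(1 / n) *\<^sub>R x"] n by (simp add: divide_right_mono)
    have open_in: "frechet_derivative \<zeta>n (at x) h = 0" if "norm x < n" for x h
    proof -
      have "(\<zeta>n has_derivative (\<lambda>h. 0)) (at x)"
        using has_derivative_transform_within_open[OF has_derivative_const[of 1], of "ball 0 n" x \<zeta>n]
          that \<zeta>n_val(3) by simp
      then show ?thesis using frechet_derivative_at by metis
    qed
    have grad_in: "grad \<zeta>n x = 0" if "norm x < n" for x
      using open_in[OF that] by (simp add: grad_def vec_eq_iff partial_deriv_def)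
    have grad_out: "grad \<zeta>n x = 0" if "2 * n < norm x" for x
    proof -
      have "supp \<zeta>n \<subseteq> cball 0 (2 * n)"
        by (intro supp_subset closed_cball) (metis \<zeta>n_val(4) linorder_le_cases mem_cball_0)
      then have "x \<notin> supp \<zeta>n" using that by auto
      then show ?thesis using frechet_zero_outside_supp by (simp add: grad_def vec_eq_iff partial_deriv_def)
    qed
    \<comment> \<open>Subtracting the mean leaves the gradient alone but makes the Poincare
      inequality available. The radius 3 n exceeds 2 n, beyond which \<open>grad \<zeta>n\<close>
      vanishes, so the open ball also contains the sphere of radius 2 n, where
      \<open>grad_out\<close> is silent.\<close>
    let ?c = "ball_mean (3 * n) w"
    have w': "wgrad (\<lambda>x. w x - ?c) G" by (rule wgrad_sub_const[OF w])
    let ?H = "\<lambda>x. (w x - ?c) *\<^sub>R grad \<zeta>n x"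
    note pr = wgrad_mult[OF w' \<zeta>n]
    have HL: "?H \<in> L2" by (rule pr(3))
    have \<zeta>GL: "(\<lambda>x. \<zeta>n x *\<^sub>R G x) \<in> L2"
      by (rule test_L2_loc_mult(1)[OF \<zeta>n L2_imp_L2_loc[OF wgrad_L2[OF w]]])
    have "l2ip F (\<lambda>x. \<zeta>n x *\<^sub>R G x + ?H x) = 0"
      by (rule orthogonal_compact_support[OF F orth pr(1), of "2 * n"]) (simp_all add: \<zeta>n_val)
    then have 0: "l2ip F (\<lambda>x. \<zeta>n x *\<^sub>R G x) = - l2ip F ?H"
      using l2ip_add(2)[OF \<zeta>GL HL F] by simp
    have dL: "(\<lambda>x. G x - \<zeta>n x *\<^sub>R G x) \<in> L2" by (intro L2_diff wgrad_L2[OF w] \<zeta>GL)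
    have "l2ip F G = l2ip F (\<lambda>x. G x - \<zeta>n x *\<^sub>R G x) - l2ip F ?H"
      using l2ip_diff(2)[OF wgrad_L2[OF w] \<zeta>GL F] 0 by simp
    \<comment> \<open>The cutoff equals 1 on the ball of radius \<open>n\<close>, so both remaining
      fields vanish there and \<open>F\<close> may be replaced by its tail.\<close>
    moreover have "l2ip F (\<lambda>x. G x - \<zeta>n x *\<^sub>R G x) = l2ip (T (Suc m)) (\<lambda>x. G x - \<zeta>n x *\<^sub>R G x)"
      unfolding l2ip_def
      by (intro Bochner_Integration.integral_cong refl)
        (auto simp: T_def indicator_def \<zeta>n_val n_def)
    moreover have "l2ip F ?H = l2ip (T (Suc m)) ?H"
      unfolding l2ip_def
      by (intro Bochner_Integration.integral_cong refl)
        (auto simp: T_def indicator_def grad_in n_def)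
    ultimately have 1: "\<bar>l2ip F G\<bar> \<le> l2n (T (Suc m)) * l2n (\<lambda>x. G x - \<zeta>n x *\<^sub>R G x) + l2n (T (Suc m)) * l2n ?H"
      using l2ip_Cauchy_Schwarz[OF TL dL, of "Suc m"] l2ip_Cauchy_Schwarz[OF TL HL, of "Suc m"] by linarith
    have 2: "l2n (\<lambda>x. G x - \<zeta>n x *\<^sub>R G x) \<le> 1 * l2n G"
    proof (rule L2_compare_scaled(2)[OF wgrad_L2[OF w] L2_measurable[OF dL]])
      fix x
      have "G x - \<zeta>n x *\<^sub>R G x = (1 - \<zeta>n x) *\<^sub>R G x" by (simp add: algebra_simps)
      then show "norm (G x - \<zeta>n x *\<^sub>R G x) \<le> 1 * norm (G x)"
        using \<zeta>n_val(1,2)[of x] by (simp add: mult_left_le_one_le)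
    qed simp
    let ?E = "\<lambda>x. indicator (ball 0 (3 * n)) x *\<^sub>R (w x - ?c)"
    have EL: "?E \<in> L2" by (rule L2_loc_cut[OF wgrad_L2_loc[OF w']])
    have "l2n ?H \<le> (K / n) * l2n ?E"
    proof (rule L2_compare_scaled(2)[OF EL L2_measurable[OF HL]])
      show "0 \<le> K / n" using K(1) n by simp
      fix x
      show "norm (?H x) \<le> K / n * norm (?E x)"
      proof (cases "norm x < 3 * n")
        case True
        then show ?thesis using mult_left_mono[OF grad_bound[of x], of "\<bar>w x - ?c\<bar>"] by (simp add: mult.commute)
      next
        case False
        then show ?thesis using grad_out[of x] n K(1) by simp
      qed
    qed
    also have "\<dots> \<le> (K / n) * (12 * n * l2n G)"
    proof (rule mult_left_mono)
      show "l2n ?E \<le> 12 * n * l2n G" using poincare_ball[OF w, of "3 * n"] n by simp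
    qed (use K(1) n in simp)
    also have "\<dots> = 12 * K * l2n G" using n by simp
    finally have 3: "l2n ?H \<le> 12 * K * l2n G" .
    have "l2n (T (Suc m)) * l2n (\<lambda>x. G x - \<zeta>n x *\<^sub>R G x) + l2n (T (Suc m)) * l2n ?H
      \<le> l2n (T (Suc m)) * (1 * l2n G) + l2n (T (Suc m)) * (12 * K * l2n G)"
      by (intro add_mono mult_left_mono 2 3 l2n_nonneg)
    with 1 show ?thesis by (simp add: algebra_simps)
  qed
  have "(\<lambda>m. l2n (T (Suc m)) * ((1 + 12 * K) * l2n G)) \<longlonglongrightarrow> 0"
    by (rule tendsto_mult_left_zero[OF LIMSEQ_Suc[OF T_lim]])
  then have "(\<lambda>m. \<bar>l2ip F G\<bar>) \<longlonglongrightarrow> 0"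
    by (rule Lim_null_comparison[rotated]) (use bound in simp)
  then show ?thesis by (simp add: LIMSEQ_const_iff)
qed

section \<open>The variational problem\<close>

lemma H1_dot_iff_wgrad: "U \<in> H1_dot \<longleftrightarrow> (\<exists>G. wgrad U G)"
  by (auto simp: H1_dot_def wgrad_def)

lemma wgrad_weak_grad: "U \<in> H1_dot \<Longrightarrow> wgrad U (weak_grad U)"
  using someI_ex[of "\<lambda>G. G \<in> L2 \<and> has_weak_gradient U G"]
  unfolding H1_dot_def weak_grad_def wgrad_def by blast

lemma dirichlet_eq_l2ip: "dirichlet U = l2ip (weak_grad U) (weak_grad U)"
  by (simp add: dirichlet_def l2ip_def power2_norm_eq_inner)

text \<open>Frees the inner products from the choice of representatives, so that
  \<open>weak_grad\<close> can be exchanged for any explicit gradient.\<close>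

lemma wgrad_l2ip_cong:
  fixes U V :: "plane \<Rightarrow> real"
  assumes "wgrad U G" "wgrad U G'" "wgrad V H" "wgrad V H'"
  shows "l2ip G H = l2ip G' H'"
  by (rule l2ip_cong_AE[OF wgrad_unique_AE[OF assms(1,2)] wgrad_unique_AE[OF assms(3,4)]])
    (rule wgrad_L2, fact)+

lemma dirichlet_wgrad:
  fixes U :: "plane \<Rightarrow> real"
  assumes "wgrad U G" shows "dirichlet U = l2ip G G"
proof -
  have "wgrad U (weak_grad U)" using assms wgrad_weak_grad H1_dot_iff_wgrad by blast
  then show ?thesis unfolding dirichlet_eq_l2ip by (intro wgrad_l2ip_cong[of U _ _ U] assms)
qed

lemma wgrad_cong_gradient:
  fixes U :: "plane \<Rightarrow> real"
  assumes U: "wgrad U G" and eq: "AE x in lebesgue. G x = H x" and H: "H \<in> L2"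
  shows "wgrad U H"
proof (rule wgradI[OF wgrad_L2_loc[OF U] H])
  fix \<phi> :: "plane \<Rightarrow> real" and i assume \<phi>: "\<phi> \<in> test_functions"
  have "l2ip \<phi> (\<lambda>x. G x $ i) = l2ip \<phi> (\<lambda>x. H x $ i)"
    using eq by (intro l2ip_cong_AE L2_vec_nth(1) wgrad_L2[OF U] H test_L2 \<phi>) auto
  then show "(\<integral>x. partial_deriv i \<phi> x * U x \<partial>lebesgue) = - (\<integral>x. \<phi> x * H x $ i \<partial>lebesgue)"
    using wgrad_eq[OF U \<phi>, of i] by (simp add: l2ip_def)
qed

lemma wgrad_eq_up_to_const:
  fixes U V :: "plane \<Rightarrow> real"
  assumes "wgrad U G" "wgrad V G" shows "eq_up_to_const U V"
proof -
  obtain c where "AE x in lebesgue. U x - V x = c"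
    using wgrad_zero_const[OF wgrad_diff[OF assms]] by auto
  then have "AE x in lebesgue. U x = V x + c" by eventually_elim simp
  then show ?thesis by (auto simp: eq_up_to_const_def)
qed

lemma H1I: "wgrad U G \<Longrightarrow> U \<in> L2 \<Longrightarrow> U \<in> H1"
  by (auto simp: H1_def H1_dot_iff_wgrad)

lemma test_H1: "\<phi> \<in> test_functions \<Longrightarrow> \<phi> \<in> H1"
  by (rule H1I[OF wgrad_test test_L2])

lemma H1_norm_le:
  assumes "wgrad U G" shows "H1_norm U \<le> l2n U + l2n G"
proof -
  have "H1_norm U = sqrt ((l2n U)\<^sup>2 + (l2n G)\<^sup>2)"
    using dirichlet_wgrad[OF assms] unfolding H1_norm_def l2n_sq by (simp add: l2ip_def power2_eq_square)
  also have "\<dots> \<le> l2n U + l2n G" by (rule sqrt_sum_squares_le_sum) (rule l2n_nonneg)+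
  finally show ?thesis .
qed

section \<open>The source as a bounded functional of the gradient\<close>

locale compact_source =
  fixes f :: "(plane \<Rightarrow> real) \<Rightarrow> real"
  assumes f: "f \<in> H_minus1" and compact_support: "compact (dist_support f)"
    and vanishing_average: "pairing f (\<lambda>x. 1) = 0"
begin

definition cutoff :: "plane \<Rightarrow> real" where
  "cutoff = (SOME \<zeta>. cutoff_on (dist_support f) \<zeta>)"

lemma cutoff_on_cutoff: "cutoff_on (dist_support f) cutoff"
  unfolding cutoff_def by (rule someI_ex[OF cutoff_on_ex[OF compact_support]])

lemma cutoff_test: "cutoff \<in> test_functions"
  using cutoff_on_cutoff by (simp add: cutoff_on_def)

lemma pairing_eq: "pairing f \<psi> = f (\<lambda>x. cutoff x * \<psi> x)"
  by (simp add: pairing_def cutoff_def)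

lemma f_add: "U \<in> H1 \<Longrightarrow> V \<in> H1 \<Longrightarrow> f (\<lambda>x. U x + V x) = f U + f V"
  and f_scale: "U \<in> H1 \<Longrightarrow> f (\<lambda>x. c * U x) = c * f U"
  using f by (auto simp: H_minus1_def)

lemma cutoff_mult_H1: "wgrad \<psi> G \<Longrightarrow> (\<lambda>x. cutoff x * \<psi> x) \<in> H1"
  using wgrad_mult(1,2)[OF _ cutoff_test] by (rule H1I)

lemma pairing_add:
  "wgrad \<psi> G \<Longrightarrow> wgrad \<theta> H \<Longrightarrow> pairing f (\<lambda>x. \<psi> x + \<theta> x) = pairing f \<psi> + pairing f \<theta>"
  using f_add[OF cutoff_mult_H1 cutoff_mult_H1] by (simp add: pairing_eq distrib_left)

lemma pairing_scale: "wgrad \<psi> G \<Longrightarrow> pairing f (\<lambda>x. c * \<psi> x) = c * pairing f \<psi>"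
  using f_scale[OF cutoff_mult_H1] by (simp add: pairing_eq mult.left_commute)

text \<open>The vanishing average annihilates constants; hence \<open>pairing f\<close> depends on
  the gradient only, and a potential may be normalized freely inside it.\<close>

lemma pairing_sub_const:
  assumes "wgrad \<psi> G" shows "pairing f (\<lambda>x. \<psi> x - c) = pairing f \<psi>"
proof -
  have "pairing f (\<lambda>x. c * 1) = 0"
    using pairing_scale[OF wgrad_const, of c 1] vanishing_average by simp
  then have "pairing f (\<lambda>x. - c) = 0"
    using pairing_scale[OF wgrad_const, of "-1" c] by simp
  then show ?thesis using pairing_add[OF assms wgrad_const, of "- c"] by simp
qed

text \<open>\<psi> is replaced by its deviation from the mean over a ball that contains the support
  of the cutoff. There the Poincare inequality controls the deviation, so that the
  \<open>H1_norm\<close> of its product with the cutoff is bounded by the gradient of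
  \<psi>.\<close>

lemma pairing_bound:
  obtains C where "C \<ge> 0" "\<And>\<psi> G. wgrad \<psi> G \<Longrightarrow> \<bar>pairing f \<psi>\<bar> \<le> C * l2n G"
proof -
  obtain C where C: "\<And>U. U \<in> H1 \<Longrightarrow> \<bar>f U\<bar> \<le> C * H1_norm U"
    using f unfolding H_minus1_def mem_Collect_eq by blast
  obtain B where B: "B > 0" "\<And>x. \<bar>cutoff x\<bar> \<le> B" using test_bounded[OF cutoff_test] by blast
  obtain K where K: "K \<ge> 0" and grad_K: "\<And>x. norm (grad cutoff x) \<le> K"
    using test_grad_bounded[OF cutoff_test] by blast
  obtain r where r: "r > 0" "\<And>x. x \<in> supp cutoff \<Longrightarrow> norm x < r"
    using compact_imp_bounded[OF test_compact[OF cutoff_test]] unfolding bounded_pos_less by blast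
  have out: "cutoff x = 0" "grad cutoff x = 0" if "\<not> norm x < r" for x
    using that r(2)[of x] not_in_suppD[of x cutoff] frechet_zero_outside_supp[of x cutoff]
    by (auto simp: grad_def vec_eq_iff partial_deriv_def)
  \<comment> \<open>The first summand bounds the cut-off deviation, the bracket the two terms of its
    Leibniz rule; 4 r is the Poincare constant of the ball.\<close>
  let ?M = "B * (4 * r) + (B + K * (4 * r))"
  have M: "?M \<ge> 0" using B(1) K r(1) by simp
  show ?thesis
  proof
    show "\<bar>C\<bar> * ?M \<ge> 0" using M by simp
    fix \<psi> and G :: "plane \<Rightarrow> real^2" assume w: "wgrad \<psi> G"
    let ?c = "ball_mean r \<psi>"
    have w': "wgrad (\<lambda>x. \<psi> x - ?c) G" by (rule wgrad_sub_const[OF w])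
    let ?E = "\<lambda>x. indicator (ball 0 r) x *\<^sub>R (\<psi> x - ?c)"
    have EL: "?E \<in> L2" by (rule L2_loc_cut[OF wgrad_L2_loc[OF w']])
    have E: "l2n ?E \<le> 4 * r * l2n G" by (rule poincare_ball[OF w r(1)])
    let ?U = "\<lambda>x. cutoff x * (\<psi> x - ?c)"
    note pr = wgrad_mult[OF w' cutoff_test]
    have 1: "l2n ?U \<le> B * l2n ?E"
    proof (rule L2_compare_scaled(2)[OF EL L2_measurable[OF pr(2)]])
      show "norm (?U x) \<le> B * norm (?E x)" for x
        using out[of x] mult_right_mono[OF B(2)[of x], of "\<bar>\<psi> x - ?c\<bar>"] by (cases "norm x < r") (auto simp: abs_mult)
    qed (use B in simp)
    have 2: "l2n (\<lambda>x. cutoff x *\<^sub>R G x) \<le> B * l2n G"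
      by (rule L2_mult_bounded(2)[OF wgrad_L2[OF w] test_measurable[OF cutoff_test] B(2)])
    have 3: "l2n (\<lambda>x. (\<psi> x - ?c) *\<^sub>R grad cutoff x) \<le> K * l2n ?E"
    proof (rule L2_compare_scaled(2)[OF EL L2_measurable[OF pr(3)] K])
      show "norm ((\<psi> x - ?c) *\<^sub>R grad cutoff x) \<le> K * norm (?E x)" for x
        using out[of x] mult_right_mono[OF grad_K[of x], of "\<bar>\<psi> x - ?c\<bar>"]
        by (cases "norm x < r") (auto simp: mult.commute)
    qed
    have "l2n (\<lambda>x. cutoff x *\<^sub>R G x + (\<psi> x - ?c) *\<^sub>R grad cutoff x) \<le> B * l2n G + K * l2n ?E"
      using l2n_add_le[OF test_L2_loc_mult(1)[OF cutoff_test L2_imp_L2_loc[OF wgrad_L2[OF w]]] pr(3)] 2 3 by linarith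
    then have "H1_norm ?U \<le> B * l2n ?E + (B * l2n G + K * l2n ?E)"
      using H1_norm_le[OF pr(1)] 1 by linarith
    also have "\<dots> \<le> B * (4 * r * l2n G) + (B * l2n G + K * (4 * r * l2n G))"
      using B(1) K E by (intro add_mono mult_left_mono) auto
    also have "\<dots> = ?M * l2n G" by (simp add: algebra_simps)
    finally have U: "H1_norm ?U \<le> ?M * l2n G" .
    have "\<bar>pairing f \<psi>\<bar> = \<bar>f ?U\<bar>"
      using pairing_sub_const[OF w, of ?c] by (simp add: pairing_eq)
    also have "\<dots> \<le> C * H1_norm ?U" by (rule C[OF H1I[OF pr(1,2)]])
    also have "\<dots> \<le> \<bar>C\<bar> * (?M * l2n G)"
    proof (rule mult_mono[OF abs_ge_self U])
      show "0 \<le> H1_norm ?U" by (simp add: H1_norm_def dirichlet_def)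
    qed simp
    finally show "\<bar>pairing f \<psi>\<bar> \<le> \<bar>C\<bar> * ?M * l2n G" by (simp add: mult.assoc)
  qed
qed

lemma pairing_unique:
  assumes "wgrad \<psi> G" "wgrad \<theta> G" shows "pairing f \<psi> = pairing f \<theta>"
proof -
  obtain C where C: "\<And>\<psi> G. wgrad \<psi> G \<Longrightarrow> \<bar>pairing f \<psi>\<bar> \<le> C * l2n G" using pairing_bound by blast
  have "\<bar>pairing f (\<lambda>x. \<psi> x + -1 * \<theta> x)\<bar> \<le> C * l2n (\<lambda>x. 0 :: real^2)"
    using C[OF wgrad_diff[OF assms]] by simp
  also have "l2n (\<lambda>x. 0 :: real^2) = 0" by (simp add: l2n_def l2ip_def)
  finally show ?thesis
    using pairing_add[OF assms(1) wgrad_scale[OF assms(2), of "-1"]] pairing_scale[OF assms(2), of "-1"] by simp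
qed

text \<open>The part of \<phi> that the cutoff removes is supported away from
  \<open>dist_support f\<close>, in the union of the open sets on which \<open>f\<close> vanishes. A
  partition of unity reduces it to those sets one at a time.\<close>

lemma pairing_test:
  assumes \<phi>: "\<phi> \<in> test_functions" shows "pairing f \<phi> = f \<phi>"
proof -
  obtain W where W: "open W" "dist_support f \<subseteq> W" "\<And>x. x \<in> W \<Longrightarrow> cutoff x = 1"
    using cutoff_on_cutoff by (auto simp: cutoff_on_def)
  define \<theta> where "\<theta> x = \<phi> x * (1 - cutoff x)" for x
  have \<theta>: "\<theta> \<in> test_functions"
    unfolding \<theta>_def[abs_def] by (intro test_mult \<phi> Ck_diff Ck_const test_Ck cutoff_test)
  let ?\<W> = "{W. open W \<and> (\<forall>\<phi>\<in>test_functions. supp \<phi> \<subseteq> W \<longrightarrow> f \<phi> = 0)}"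
  have "supp \<theta> \<subseteq> - W"
    by (rule supp_subset) (use W in \<open>auto simp: \<theta>_def\<close>)
  then have "supp \<theta> \<subseteq> \<Union>?\<W>" using W(2) unfolding dist_support_def by blast
  then have "f \<theta> = 0"
    by (rule test_function_localization[OF \<theta>]) (auto intro: f_add test_H1)
  moreover have "(\<lambda>x. cutoff x * \<phi> x) \<in> test_functions" by (intro test_mult cutoff_test test_Ck \<phi>)
  then have "f (\<lambda>x. cutoff x * \<phi> x + \<theta> x) = pairing f \<phi> + f \<theta>"
    using f_add[OF test_H1 test_H1[OF \<theta>]] by (simp add: pairing_eq)
  moreover have "(\<lambda>x. cutoff x * \<phi> x + \<theta> x) = \<phi>" by (simp add: \<theta>_def fun_eq_iff algebra_simps)
  ultimately show ?thesis by simp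
qed

end

section \<open>Pairs of fields as one field in a product space, and projection onto
  gradients\<close>

lemma L2_Pair:
  assumes "F \<in> L2" "G \<in> L2" shows "(\<lambda>x. (F x, G x)) \<in> L2"
  using assms by (auto simp: L2_iff inner_prod_def intro!: borel_measurable_Pair)

lemma
  fixes H :: "plane \<Rightarrow> 'b::euclidean_space \<times> 'c::euclidean_space"
  assumes H: "H \<in> L2"
  shows L2_fst: "(\<lambda>x. fst (H x)) \<in> L2" and l2n_fst_le: "l2n (\<lambda>x. fst (H x)) \<le> l2n H"
    and L2_snd: "(\<lambda>x. snd (H x)) \<in> L2" and l2n_snd_le: "l2n (\<lambda>x. snd (H x)) \<le> l2n H"
proof -
  have m: "(\<lambda>x. fst (H x)) \<in> borel_measurable lebesgue" "(\<lambda>x. snd (H x)) \<in> borel_measurable lebesgue"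
    by (rule measurable_compose[OF L2_measurable[OF H] borel_measurable_continuous_onI], intro continuous_intros)+
  have le: "norm (fst p) \<le> 1 * norm p" "norm (snd p) \<le> 1 * norm p" for p :: "'b \<times> 'c"
    using norm_fst_le[of "fst p" "snd p"] norm_snd_le[of "snd p" "fst p"] by simp_all
  show "(\<lambda>x. fst (H x)) \<in> L2" "l2n (\<lambda>x. fst (H x)) \<le> l2n H"
    using L2_compare_scaled[OF H m(1) _ le(1)] by simp_all
  show "(\<lambda>x. snd (H x)) \<in> L2" "l2n (\<lambda>x. snd (H x)) \<le> l2n H"
    using L2_compare_scaled[OF H m(2) _ le(2)] by simp_all
qed

lemma l2ip_prod:
  assumes "H \<in> L2" "K \<in> L2"
  shows "l2ip H K = l2ip (\<lambda>x. fst (H x)) (\<lambda>x. fst (K x)) + l2ip (\<lambda>x. snd (H x)) (\<lambda>x. snd (K x))"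
  using L2_integrable_inner[OF assms[THEN L2_fst]] L2_integrable_inner[OF assms[THEN L2_snd]]
  by (simp add: l2ip_def inner_prod_def)

lemma l2n_fst_snd_tendsto:
  assumes "\<And>n. H n \<in> L2" "K \<in> L2" "(\<lambda>n. l2n (\<lambda>x. H n x - K x)) \<longlonglongrightarrow> 0"
  shows "(\<lambda>n. l2n (\<lambda>x. fst (H n x) - fst (K x))) \<longlonglongrightarrow> 0" "(\<lambda>n. l2n (\<lambda>x. snd (H n x) - snd (K x))) \<longlonglongrightarrow> 0"
  using l2n_fst_le[OF L2_diff[OF assms(1,2)]] l2n_snd_le[OF L2_diff[OF assms(1,2)]]
  by (auto intro!: Lim_null_comparison[OF always_eventually assms(3)] simp: abs_of_nonneg[OF l2n_nonneg])

lemma weak_div_real: "weak_div F \<phi> = - l2ip F (grad \<phi>)"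
  by (simp add: weak_div_def l2ip_def inner_vec_def grad_def mult.commute)

text \<open>\<open>k\<close> is the orthogonal projection of \<open>X\<close> onto the gradients,
  the gradient part of its Helmholtz decomposition. The space of gradients is closed by
  \<open>wgrad_complete\<close>.\<close>

lemma riesz_gradients:
  fixes X :: "plane \<Rightarrow> real^2"
  assumes X: "X \<in> L2"
  obtains w k where "wgrad w k" "\<And>u h. wgrad u h \<Longrightarrow> l2ip X h = l2ip k h"
proof -
  define S where "S = {h. \<exists>u. wgrad u (h :: plane \<Rightarrow> real^2)}"
  have SL: "S \<subseteq> L2" by (auto simp: S_def wgrad_L2)
  obtain k where k: "k \<in> S" "\<And>h. h \<in> S \<Longrightarrow> l2ip X h = l2ip k h"
  proof (rule riesz_representation_L2[of S "l2ip X" "l2n X"])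
    show "(\<lambda>x. 0) \<in> S" using wgrad_const[of 0] by (auto simp: S_def)
    show "(\<lambda>x. h x + k x) \<in> S" if "h \<in> S" "k \<in> S" for h k
      using that unfolding S_def by (blast intro: wgrad_add)
    show "(\<lambda>x. c *\<^sub>R h x) \<in> S" if "h \<in> S" for c h
      using that unfolding S_def by (blast intro: wgrad_scale)
    show "g \<in> S" if h: "\<And>n. h n \<in> S" and g: "g \<in> L2" "(\<lambda>n. l2n (\<lambda>x. h n x - g x)) \<longlonglongrightarrow> 0"
      for h :: "nat \<Rightarrow> plane \<Rightarrow> real^2" and g
    proof -
      obtain U where "\<And>n. wgrad (U n) (h n)" using h unfolding S_def mem_Collect_eq by metis
      from wgrad_complete[OF this g] show ?thesis by (simp add: S_def)
    qed
  qed (use SL X in \<open>auto simp: l2ip_add l2ip_scaleR l2ip_Cauchy_Schwarz subset_iff\<close>)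
  then show ?thesis using that unfolding S_def mem_Collect_eq by blast
qed

section \<open>The constrained maximization\<close>

locale dissipative_problem = compact_source f for f +
  fixes A :: "plane \<Rightarrow> real" and \<eta> :: real
  assumes A_measurable: "A \<in> borel_measurable lebesgue" and A_bound: "\<And>x. \<bar>A x\<bar> \<le> 1"
    and \<eta>_pos: "\<eta> > 0"
begin

lemma A_L2: "F \<in> L2 \<Longrightarrow> (\<lambda>x. A x *\<^sub>R F x) \<in> L2"
  by (rule L2_mult_bounded(1)[OF _ A_measurable A_bound])

text \<open>A condition on the fields alone, with the common minus sign of \<open>weak_div\<close>
  dropped. Being linear and stable under limits, it cuts a closed subspace out of the pairs of
  gradients.\<close>

definition constraint :: "(plane \<Rightarrow> real^2) \<Rightarrow> (plane \<Rightarrow> real^2) \<Rightarrow> bool" where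
  "constraint g1 g2 \<longleftrightarrow> (\<forall>\<phi>\<in>test_functions.
     l2ip (\<lambda>x. A x *\<^sub>R g2 x) (grad \<phi>) + \<eta> * l2ip g1 (grad \<phi>) = 0)"

lemma constraint_cong:
  assumes "wgrad v g1" "wgrad v h1" "wgrad \<psi> g2" "wgrad \<psi> h2"
  shows "constraint g1 g2 \<longleftrightarrow> constraint h1 h2"
proof -
  have "l2ip g1 (grad \<phi>) = l2ip h1 (grad \<phi>)"
    "l2ip (\<lambda>x. A x *\<^sub>R g2 x) (grad \<phi>) = l2ip (\<lambda>x. A x *\<^sub>R h2 x) (grad \<phi>)" if "\<phi> \<in> test_functions" for \<phi>
  proof -
    note t = wgrad_test[OF that]
    show "l2ip g1 (grad \<phi>) = l2ip h1 (grad \<phi>)" by (rule wgrad_l2ip_cong[OF assms(1,2) t t])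
    show "l2ip (\<lambda>x. A x *\<^sub>R g2 x) (grad \<phi>) = l2ip (\<lambda>x. A x *\<^sub>R h2 x) (grad \<phi>)"
      using wgrad_unique_AE[OF assms(3,4)]
      by (intro l2ip_cong_AE A_L2 wgrad_L2[OF assms(3)] wgrad_L2[OF assms(4)] wgrad_L2[OF t]) auto
  qed
  then show ?thesis by (simp add: constraint_def)
qed

text \<open>Replaces the chosen gradients by arbitrary representatives, which
  \<open>constraint\<close> cannot tell apart by \<open>constraint_cong\<close>.\<close>

lemma admissible_iff:
  "(v, \<psi>) \<in> admissible A \<eta> \<longleftrightarrow> (\<exists>g1 g2. wgrad v g1 \<and> wgrad \<psi> g2 \<and> constraint g1 g2)"
proof -
  have "(\<forall>\<phi>\<in>test_functions. weak_div (\<lambda>x. A x *s weak_grad \<psi> x) \<phi> + \<eta> * weak_div (weak_grad v) \<phi> = 0)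
    \<longleftrightarrow> constraint (weak_grad v) (weak_grad \<psi>)"
    unfolding constraint_def weak_div_real scalar_mult_eq_scaleR
    by (intro ball_cong refl) (simp add: algebra_simps, linarith)
  then have "(v, \<psi>) \<in> admissible A \<eta> \<longleftrightarrow> v \<in> H1_dot \<and> \<psi> \<in> H1_dot \<and> constraint (weak_grad v) (weak_grad \<psi>)"
    by (simp add: admissible_def)
  also have "\<dots> \<longleftrightarrow> (\<exists>g1 g2. wgrad v g1 \<and> wgrad \<psi> g2 \<and> constraint g1 g2)"
  proof
    assume "v \<in> H1_dot \<and> \<psi> \<in> H1_dot \<and> constraint (weak_grad v) (weak_grad \<psi>)"
    then show "\<exists>g1 g2. wgrad v g1 \<and> wgrad \<psi> g2 \<and> constraint g1 g2"
      using wgrad_weak_grad[of v] wgrad_weak_grad[of \<psi>] by blast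
  next
    assume "\<exists>g1 g2. wgrad v g1 \<and> wgrad \<psi> g2 \<and> constraint g1 g2"
    then obtain g1 g2 where g: "wgrad v g1" "wgrad \<psi> g2" "constraint g1 g2" by blast
    then have H: "v \<in> H1_dot" "\<psi> \<in> H1_dot" using H1_dot_iff_wgrad by blast+
    then show "v \<in> H1_dot \<and> \<psi> \<in> H1_dot \<and> constraint (weak_grad v) (weak_grad \<psi>)"
      using constraint_cong[OF g(1) wgrad_weak_grad[OF H(1)] g(2) wgrad_weak_grad[OF H(2)]] g(3) by blast
  qed
  finally show ?thesis .
qed

text \<open>As \<open>pairing f \<psi>\<close> depends only on the gradient of \<open>\<psi>\<close>, it is a functional on the space of
  constrained pairs of gradients.\<close>

lemma riesz_pair:
  obtains g1 g2 v \<psi> where "wgrad v g1" "wgrad \<psi> g2" "constraint g1 g2"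
    "\<And>v' \<psi>' h1 h2. wgrad v' h1 \<Longrightarrow> wgrad \<psi>' h2 \<Longrightarrow> constraint h1 h2 \<Longrightarrow>
       pairing f \<psi>' = \<eta> * (l2ip g1 h1 + l2ip g2 h2)"
proof -
  define S where "S = {H. (\<exists>v. wgrad v (\<lambda>x. fst (H x))) \<and> (\<exists>\<psi>. wgrad \<psi> (\<lambda>x. snd (H x)))
    \<and> constraint (\<lambda>x. fst (H x)) (\<lambda>x. snd (H x))}"
  define L where "L H = pairing f (SOME \<psi>. wgrad \<psi> (\<lambda>x. snd (H x :: (real^2) \<times> (real^2)))) / \<eta>" for H
  have L_eq: "L H = pairing f \<psi> / \<eta>" if "wgrad \<psi> (\<lambda>x. snd (H x))" for H \<psi>
    unfolding L_def using pairing_unique[OF someI[of "\<lambda>\<psi>. wgrad \<psi> (\<lambda>x. snd (H x))", OF that] that] by simp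
  have SL: "H \<in> L2" if "H \<in> S" for H
    using that L2_Pair[of "\<lambda>x. fst (H x)" "\<lambda>x. snd (H x)"] by (auto simp: S_def wgrad_L2)
  obtain C where C: "C \<ge> 0" "\<And>\<psi> G. wgrad \<psi> G \<Longrightarrow> \<bar>pairing f \<psi>\<bar> \<le> C * l2n G" using pairing_bound by blast
  obtain g where g: "g \<in> S" "\<And>h. h \<in> S \<Longrightarrow> L h = l2ip g h"
  proof (rule riesz_representation_L2[of S L "C / \<eta>"])
    show "S \<subseteq> L2" using SL by blast
    show "(\<lambda>x. 0) \<in> S" using wgrad_const[of 0] by (auto simp: S_def constraint_def l2ip_def)
    show "(\<lambda>x. h x + k x) \<in> S" if "h \<in> S" "k \<in> S" for h k
    proof -
      note hk = SL[OF that(1), THEN L2_fst] SL[OF that(1), THEN L2_snd] SL[OF that(2), THEN L2_fst] SL[OF that(2), THEN L2_snd]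
      have "constraint (\<lambda>x. fst (h x + k x)) (\<lambda>x. snd (h x + k x))"
        unfolding constraint_def
      proof
        fix \<phi> assume \<phi>: "\<phi> \<in> test_functions"
        have "l2ip (\<lambda>x. A x *\<^sub>R snd (h x)) (grad \<phi>) + \<eta> * l2ip (\<lambda>x. fst (h x)) (grad \<phi>) = 0"
          "l2ip (\<lambda>x. A x *\<^sub>R snd (k x)) (grad \<phi>) + \<eta> * l2ip (\<lambda>x. fst (k x)) (grad \<phi>) = 0"
          using that \<phi> by (auto simp: S_def constraint_def)
        then show "l2ip (\<lambda>x. A x *\<^sub>R snd (h x + k x)) (grad \<phi>) + \<eta> * l2ip (\<lambda>x. fst (h x + k x)) (grad \<phi>) = 0"
          by (simp add: scaleR_add_right l2ip_add hk A_L2 wgrad_L2[OF wgrad_test[OF \<phi>]] distrib_left)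
      qed
      then show ?thesis using that unfolding S_def by (auto dest: wgrad_add)
    qed
    show "(\<lambda>x. c *\<^sub>R h x) \<in> S" if "h \<in> S" for c h
    proof -
      have "constraint (\<lambda>x. fst (c *\<^sub>R h x)) (\<lambda>x. snd (c *\<^sub>R h x))"
        unfolding constraint_def
      proof
        fix \<phi> assume "\<phi> \<in> test_functions"
        then have *: "l2ip (\<lambda>x. A x *\<^sub>R snd (h x)) (grad \<phi>) + \<eta> * l2ip (\<lambda>x. fst (h x)) (grad \<phi>) = 0"
          using that by (auto simp: S_def constraint_def)
        have "l2ip (\<lambda>x. A x *\<^sub>R snd (c *\<^sub>R h x)) (grad \<phi>) + \<eta> * l2ip (\<lambda>x. fst (c *\<^sub>R h x)) (grad \<phi>)
          = c * (l2ip (\<lambda>x. A x *\<^sub>R snd (h x)) (grad \<phi>) + \<eta> * l2ip (\<lambda>x. fst (h x)) (grad \<phi>))"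
          using l2ip_scaleR(1)[of c "\<lambda>x. A x *\<^sub>R snd (h x)"]
          by (simp add: l2ip_scaleR mult.commute[of _ c] distrib_left)
        then show "l2ip (\<lambda>x. A x *\<^sub>R snd (c *\<^sub>R h x)) (grad \<phi>) + \<eta> * l2ip (\<lambda>x. fst (c *\<^sub>R h x)) (grad \<phi>) = 0"
          using * by simp
      qed
      then show ?thesis using that unfolding S_def by (auto dest: wgrad_scale)
    qed
    show "g \<in> S" if h: "\<And>n. h n \<in> S" and g: "g \<in> L2" "(\<lambda>n. l2n (\<lambda>x. h n x - g x)) \<longlonglongrightarrow> 0"
      for h :: "nat \<Rightarrow> plane \<Rightarrow> (real^2) \<times> (real^2)" and g
    proof -
      note hL = SL[OF h]
      note lim = l2n_fst_snd_tendsto[OF hL g]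
      obtain V where "\<And>n. wgrad (V n) (\<lambda>x. fst (h n x))" using h unfolding S_def mem_Collect_eq by metis
      from wgrad_complete[OF this L2_fst[OF g(1)] lim(1)] have 1: "\<exists>v. wgrad v (\<lambda>x. fst (g x))" .
      obtain P where "\<And>n. wgrad (P n) (\<lambda>x. snd (h n x))" using h unfolding S_def mem_Collect_eq by metis
      from wgrad_complete[OF this L2_snd[OF g(1)] lim(2)] have 2: "\<exists>\<psi>. wgrad \<psi> (\<lambda>x. snd (g x))" .
      have "constraint (\<lambda>x. fst (g x)) (\<lambda>x. snd (g x))"
        unfolding constraint_def
      proof
        fix \<phi> assume \<phi>: "\<phi> \<in> test_functions"
        note t = wgrad_L2[OF wgrad_test[OF \<phi>]]
        \<comment> \<open>\<open>l2ip_tendsto\<close> wants the converging field as second argument,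
          so the fixed gradient, together with the symmetric factor \<open>A\<close>, is moved to
          the first place.\<close>
        have swap: "l2ip (\<lambda>x. A x *\<^sub>R grad \<phi> x) F + \<eta> * l2ip (grad \<phi>) F'
          = l2ip (\<lambda>x. A x *\<^sub>R F x) (grad \<phi>) + \<eta> * l2ip F' (grad \<phi>)" for F F'
          by (simp add: l2ip_def inner_commute)
        have "(\<lambda>n. l2ip (\<lambda>x. A x *\<^sub>R grad \<phi> x) (\<lambda>x. snd (h n x)) + \<eta> * l2ip (grad \<phi>) (\<lambda>x. fst (h n x)))
          \<longlonglongrightarrow> l2ip (\<lambda>x. A x *\<^sub>R grad \<phi> x) (\<lambda>x. snd (g x)) + \<eta> * l2ip (grad \<phi>) (\<lambda>x. fst (g x))"
          by (intro tendsto_add tendsto_mult tendsto_const l2ip_tendsto lim A_L2 t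
            L2_fst[OF g(1)] L2_snd[OF g(1)] L2_fst[OF hL] L2_snd[OF hL])
        moreover have "l2ip (\<lambda>x. A x *\<^sub>R grad \<phi> x) (\<lambda>x. snd (h n x)) + \<eta> * l2ip (grad \<phi>) (\<lambda>x. fst (h n x)) = 0" for n
          unfolding swap using h[of n] \<phi> by (simp add: S_def constraint_def)
        ultimately have "l2ip (\<lambda>x. A x *\<^sub>R grad \<phi> x) (\<lambda>x. snd (g x)) + \<eta> * l2ip (grad \<phi>) (\<lambda>x. fst (g x)) = 0"
          by (simp add: LIMSEQ_const_iff)
        then show "l2ip (\<lambda>x. A x *\<^sub>R snd (g x)) (grad \<phi>) + \<eta> * l2ip (\<lambda>x. fst (g x)) (grad \<phi>) = 0"
          unfolding swap .
      qed
      with 1 2 show ?thesis by (simp add: S_def)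
    qed
    show "L (\<lambda>x. h x + k x) = L h + L k" if hS: "h \<in> S" "k \<in> S" for h k
    proof -
      obtain \<psi> \<theta> where *: "wgrad \<psi> (\<lambda>x. snd (h x))" "wgrad \<theta> (\<lambda>x. snd (k x))" using hS by (auto simp: S_def)
      have "wgrad (\<lambda>x. \<psi> x + \<theta> x) (\<lambda>x. snd (h x + k x))" using wgrad_add[OF *] by simp
      from L_eq[OF this] show ?thesis by (simp add: L_eq[OF *(1)] L_eq[OF *(2)] pairing_add[OF *] add_divide_distrib)
    qed
    show "L (\<lambda>x. c *\<^sub>R h x) = c * L h" if hS: "h \<in> S" for c h
    proof -
      obtain \<psi> where *: "wgrad \<psi> (\<lambda>x. snd (h x))" using hS by (auto simp: S_def)
      have "wgrad (\<lambda>x. c * \<psi> x) (\<lambda>x. snd (c *\<^sub>R h x))" using wgrad_scale[OF *] by simp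
      from L_eq[OF this] show ?thesis by (simp add: L_eq[OF *] pairing_scale[OF *])
    qed
    show "\<bar>L h\<bar> \<le> C / \<eta> * l2n h" if hS: "h \<in> S" for h
    proof -
      obtain \<psi> where *: "wgrad \<psi> (\<lambda>x. snd (h x))" using hS by (auto simp: S_def)
      have "\<bar>pairing f \<psi>\<bar> \<le> C * l2n h"
        using C(2)[OF *] mult_left_mono[OF l2n_snd_le[OF SL[OF hS]] C(1)] by linarith
      then show ?thesis using \<eta>_pos by (simp add: L_eq[OF *] divide_right_mono)
    qed
  qed (rule that)
  obtain v \<psi> where rep: "wgrad v (\<lambda>x. fst (g x))" "wgrad \<psi> (\<lambda>x. snd (g x))" "constraint (\<lambda>x. fst (g x)) (\<lambda>x. snd (g x))"
    using g(1) by (auto simp: S_def)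
  have "pairing f \<psi>' = \<eta> * (l2ip (\<lambda>x. fst (g x)) h1 + l2ip (\<lambda>x. snd (g x)) h2)"
    if "wgrad v' h1" "wgrad \<psi>' h2" "constraint h1 h2" for v' \<psi>' h1 h2
  proof -
    have H: "(\<lambda>x. (h1 x, h2 x)) \<in> S" using that by (auto simp: S_def)
    have "pairing f \<psi>' = \<eta> * L (\<lambda>x. (h1 x, h2 x))" using L_eq[of \<psi>' "\<lambda>x. (h1 x, h2 x)"] that \<eta>_pos by simp
    also have "\<dots> = \<eta> * (l2ip (\<lambda>x. fst (g x)) h1 + l2ip (\<lambda>x. snd (g x)) h2)"
      using g(2)[OF H] l2ip_prod[OF SL[OF g(1)] SL[OF H]] by simp
    finally show ?thesis .
  qed
  then show ?thesis by (rule that[OF rep])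
qed

text \<open>The Riesz representer of \<open>pairing f\<close> divided by \<eta>. With this scaling
  the cross terms in \<open>J\<close> are exactly those that complete the square in
  \<open>J_eq\<close>.\<close>

definition representer :: "(plane \<Rightarrow> real^2) \<Rightarrow> (plane \<Rightarrow> real^2) \<Rightarrow> bool" where
  "representer g1 g2 \<longleftrightarrow> (\<exists>v. wgrad v g1) \<and> (\<exists>\<psi>. wgrad \<psi> g2) \<and> constraint g1 g2 \<and>
     (\<forall>v \<psi> h1 h2. wgrad v h1 \<longrightarrow> wgrad \<psi> h2 \<longrightarrow> constraint h1 h2 \<longrightarrow>
        pairing f \<psi> = \<eta> * (l2ip g1 h1 + l2ip g2 h2))"

lemma representer_ex: "\<exists>g1 g2. representer g1 g2"
  by (rule riesz_pair) (unfold representer_def, blast)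

lemma representer_L2: "representer g1 g2 \<Longrightarrow> g1 \<in> L2" "representer g1 g2 \<Longrightarrow> g2 \<in> L2"
  by (auto simp: representer_def wgrad_L2)

lemma J_eq:
  assumes rep: "representer g1 g2" and v: "wgrad v h1" and \<psi>: "wgrad \<psi> h2" and con: "constraint h1 h2"
  shows "J \<eta> f v \<psi> = \<eta> / 2 * (l2ip g1 g1 + l2ip g2 g2)
    - \<eta> / 2 * (l2ip (\<lambda>x. h1 x - g1 x) (\<lambda>x. h1 x - g1 x) + l2ip (\<lambda>x. h2 x - g2 x) (\<lambda>x. h2 x - g2 x))"
proof -
  have sq: "l2ip (\<lambda>x. h x - g x) (\<lambda>x. h x - g x) = l2ip h h - 2 * l2ip g h + l2ip g g"
    if "h \<in> L2" "g \<in> L2" for h g :: "plane \<Rightarrow> real^2"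
    using that by (simp add: l2ip_diff L2_diff l2ip_commute[of h g])
  have "pairing f \<psi> = \<eta> * (l2ip g1 h1 + l2ip g2 h2)"
    using rep v \<psi> con unfolding representer_def by blast
  then show ?thesis
    unfolding J_def dirichlet_wgrad[OF v] dirichlet_wgrad[OF \<psi>]
      sq[OF wgrad_L2[OF v] representer_L2(1)[OF rep]] sq[OF wgrad_L2[OF \<psi>] representer_L2(2)[OF rep]]
    by (simp add: algebra_simps)
qed

lemma maximizing_pair_iff:
  assumes rep: "representer g1 g2"
  shows "maximizing_pair A \<eta> f v \<psi> \<longleftrightarrow> wgrad v g1 \<and> wgrad \<psi> g2"
proof -
  let ?M = "\<eta> / 2 * (l2ip g1 g1 + l2ip g2 g2)"
  let ?X = "{J \<eta> f v' \<psi>' | v' \<psi>'. (v', \<psi>') \<in> admissible A \<eta>}"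
  note gL = representer_L2[OF rep]
  have con: "constraint g1 g2" using rep by (simp add: representer_def)
  have at_g: "J \<eta> f v \<psi> = ?M" if "wgrad v g1" "wgrad \<psi> g2" for v \<psi>
    using J_eq[OF rep that con] by (simp add: l2ip_def)
  have le: "J \<eta> f v \<psi> \<le> ?M" if adm: "(v, \<psi>) \<in> admissible A \<eta>" for v \<psi>
  proof -
    obtain h1 h2 where h: "wgrad v h1" "wgrad \<psi> h2" "constraint h1 h2"
      using adm unfolding admissible_iff by blast
    have "0 \<le> \<eta> / 2 * (l2ip (\<lambda>x. h1 x - g1 x) (\<lambda>x. h1 x - g1 x) + l2ip (\<lambda>x. h2 x - g2 x) (\<lambda>x. h2 x - g2 x))"
      using \<eta>_pos by (intro mult_nonneg_nonneg add_nonneg_nonneg l2ip_self_nonneg) simp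
    then show ?thesis using J_eq[OF rep h] by linarith
  qed
  obtain v0 \<psi>0 where 0: "wgrad v0 g1" "wgrad \<psi>0 g2" using rep by (auto simp: representer_def)
  then have "(v0, \<psi>0) \<in> admissible A \<eta>" using con admissible_iff by blast
  then have mem: "?M \<in> ?X" unfolding mem_Collect_eq using at_g[OF 0, symmetric] by blast
  have ub: "x \<le> ?M" if "x \<in> ?X" for x using that le by blast
  have bdd: "bdd_above ?X" using ub by (rule bdd_aboveI)
  have Sup: "Sup ?X = ?M" by (rule cSup_eq_maximum[OF mem ub])
  show ?thesis
  proof
    assume "maximizing_pair A \<eta> f v \<psi>"
    then have adm: "(v, \<psi>) \<in> admissible A \<eta>" and eq: "J \<eta> f v \<psi> = ?M"
      unfolding maximizing_pair_def Sup by blast+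
    obtain h1 h2 where h: "wgrad v h1" "wgrad \<psi> h2" "constraint h1 h2"
      using adm unfolding admissible_iff by blast
    have "l2ip (\<lambda>x. h1 x - g1 x) (\<lambda>x. h1 x - g1 x) + l2ip (\<lambda>x. h2 x - g2 x) (\<lambda>x. h2 x - g2 x) = 0"
      using J_eq[OF rep h] eq \<eta>_pos by simp
    then have z: "l2ip (\<lambda>x. h1 x - g1 x) (\<lambda>x. h1 x - g1 x) = 0" "l2ip (\<lambda>x. h2 x - g2 x) (\<lambda>x. h2 x - g2 x) = 0"
      using l2ip_self_nonneg[of "\<lambda>x. h1 x - g1 x"] l2ip_self_nonneg[of "\<lambda>x. h2 x - g2 x"] by linarith+
    have "AE x in lebesgue. h1 x = g1 x" "AE x in lebesgue. h2 x = g2 x"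
      using l2ip_self_zero_AE[OF L2_diff[OF wgrad_L2[OF h(1)] gL(1)] z(1)]
        l2ip_self_zero_AE[OF L2_diff[OF wgrad_L2[OF h(2)] gL(2)] z(2)] by simp_all
    then show "wgrad v g1 \<and> wgrad \<psi> g2"
      using wgrad_cong_gradient[OF h(1) _ gL(1)] wgrad_cong_gradient[OF h(2) _ gL(2)] by blast
  next
    assume *: "wgrad v g1 \<and> wgrad \<psi> g2"
    then have "(v, \<psi>) \<in> admissible A \<eta>" using con admissible_iff by blast
    then show "maximizing_pair A \<eta> f v \<psi>"
      unfolding maximizing_pair_def Sup using at_g * bdd by blast
  qed
qed

text \<open>A field \<open>k\<close> with \<open>\<eta> k = - A \<nabla> \<phi>\<close> modulo fields orthogonal to gradients makes \<open>(k, \<nabla> \<phi>)\<close> admissible.\<close>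

lemma representer_equation:
  assumes rep: "representer g1 g2" and \<phi>: "\<phi> \<in> test_functions"
  shows "l2ip (\<lambda>x. A x *\<^sub>R g1 x) (grad \<phi>) - \<eta> * l2ip g2 (grad \<phi>) = - f \<phi>"
proof -
  note t = wgrad_test[OF \<phi>]
  obtain w k where k: "wgrad w k" "\<And>u h. wgrad u h \<Longrightarrow> l2ip (\<lambda>x. A x *\<^sub>R grad \<phi> x) h = l2ip k h"
    using riesz_gradients[OF A_L2[OF wgrad_L2[OF t]]] by blast
  let ?k = "\<lambda>x. (- 1 / \<eta>) *\<^sub>R k x"
  have w: "wgrad (\<lambda>x. (- 1 / \<eta>) * w x) ?k" by (rule wgrad_scale[OF k(1)])
  have "constraint ?k (grad \<phi>)"
    unfolding constraint_def
  proof
    fix \<phi>' assume "\<phi>' \<in> test_functions"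
    from k(2)[OF wgrad_test[OF this]]
    show "l2ip (\<lambda>x. A x *\<^sub>R grad \<phi> x) (grad \<phi>') + \<eta> * l2ip ?k (grad \<phi>') = 0"
      using \<eta>_pos by (simp only: l2ip_scaleR) simp
  qed
  then have "pairing f \<phi> = \<eta> * (l2ip g1 ?k + l2ip g2 (grad \<phi>))"
    using rep w t unfolding representer_def by blast
  also have "\<dots> = - l2ip k g1 + \<eta> * l2ip g2 (grad \<phi>)"
    unfolding l2ip_scaleR using \<eta>_pos by (simp add: l2ip_commute[of g1 k] right_diff_distrib)
  \<comment> \<open>\<open>g1\<close> is itself a gradient, so against it the projection
    \<open>k\<close> may be replaced by the projected field.\<close>
  also have "l2ip k g1 = l2ip (\<lambda>x. A x *\<^sub>R grad \<phi> x) g1"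
    using rep k(2) unfolding representer_def by metis
  also have "\<dots> = l2ip (\<lambda>x. A x *\<^sub>R g1 x) (grad \<phi>)"
    by (simp add: l2ip_def inner_commute)
  finally show ?thesis by (simp add: pairing_test[OF \<phi>])
qed

lemma homogeneous_unique:
  assumes w: "wgrad p d1" "wgrad q d2"
    and 1: "\<And>\<phi>. \<phi> \<in> test_functions \<Longrightarrow> l2ip (\<lambda>x. A x *\<^sub>R d1 x) (grad \<phi>) - \<eta> * l2ip d2 (grad \<phi>) = 0"
    and 2: "\<And>\<phi>. \<phi> \<in> test_functions \<Longrightarrow> l2ip (\<lambda>x. A x *\<^sub>R d2 x) (grad \<phi>) + \<eta> * l2ip d1 (grad \<phi>) = 0"
  shows "AE x in lebesgue. d1 x = 0" "AE x in lebesgue. d2 x = 0"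
proof -
  note d = wgrad_L2[OF w(1)] wgrad_L2[OF w(2)]
  note AL = A_L2[OF d(1)] A_L2[OF d(2)]
  have e1: "l2ip (\<lambda>x. A x *\<^sub>R d1 x - \<eta> *\<^sub>R d2 x) h = l2ip (\<lambda>x. A x *\<^sub>R d1 x) h - \<eta> * l2ip d2 h"
    and e2: "l2ip (\<lambda>x. A x *\<^sub>R d2 x + \<eta> *\<^sub>R d1 x) h = l2ip (\<lambda>x. A x *\<^sub>R d2 x) h + \<eta> * l2ip d1 h" if "h \<in> L2" for h
    using that by (simp_all add: l2ip_diff l2ip_add l2ip_scaleR AL d L2_scaleR)
  have "l2ip (\<lambda>x. A x *\<^sub>R d1 x - \<eta> *\<^sub>R d2 x) d2 = 0"
    by (rule orthogonal_gradients[OF L2_diff[OF AL(1) L2_scaleR[OF d(2)]] _ w(2)])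
      (simp add: e1 1 wgrad_L2[OF wgrad_test])
  moreover have "l2ip (\<lambda>x. A x *\<^sub>R d2 x + \<eta> *\<^sub>R d1 x) d1 = 0"
    by (rule orthogonal_gradients[OF L2_add[OF AL(2) L2_scaleR[OF d(1)]] _ w(1)])
      (simp add: e2 2 wgrad_L2[OF wgrad_test])
  \<comment> \<open>Symmetry of multiplication by the real \<open>A\<close>: subtracting the first
    tested equation from the second leaves \<eta> times the two squared norms.\<close>
  moreover have "l2ip (\<lambda>x. A x *\<^sub>R d1 x) d2 = l2ip (\<lambda>x. A x *\<^sub>R d2 x) d1"
    by (simp add: l2ip_def inner_commute)
  ultimately have "\<eta> * (l2ip d1 d1 + l2ip d2 d2) = 0"
    by (simp add: e1 e2 d distrib_left)
  then have "l2ip d1 d1 = 0" "l2ip d2 d2 = 0"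
    using \<eta>_pos l2ip_self_nonneg[of d1] l2ip_self_nonneg[of d2] by auto
  then show "AE x in lebesgue. d1 x = 0" "AE x in lebesgue. d2 x = 0"
    using l2ip_self_zero_AE d by blast+
qed

end

section \<open>Complex functions through real and imaginary parts\<close>

definition Re_vec :: "complex^2 \<Rightarrow> real^2" where "Re_vec z = (\<chi> i. Re (z $ i))"
definition Im_vec :: "complex^2 \<Rightarrow> real^2" where "Im_vec z = (\<chi> i. Im (z $ i))"
definition Complex_vec :: "real^2 \<Rightarrow> real^2 \<Rightarrow> complex^2" where
  "Complex_vec a b = (\<chi> i. Complex (a $ i) (b $ i))"

lemma L2_complex_iff:
  fixes F :: "plane \<Rightarrow> complex"
  shows "F \<in> L2 \<longleftrightarrow> (\<lambda>x. Re (F x)) \<in> L2 \<and> (\<lambda>x. Im (F x)) \<in> L2"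
proof
  assume F: "F \<in> L2"
  note [measurable] = L2_measurable[OF F]
  have m: "(\<lambda>x. Re (F x)) \<in> borel_measurable lebesgue" "(\<lambda>x. Im (F x)) \<in> borel_measurable lebesgue"
    by measurable
  show "(\<lambda>x. Re (F x)) \<in> L2 \<and> (\<lambda>x. Im (F x)) \<in> L2"
    using L2_compare_scaled(1)[OF F m(1), of 1] L2_compare_scaled(1)[OF F m(2), of 1] by (simp add: abs_Re_le_cmod abs_Im_le_cmod)
next
  assume *: "(\<lambda>x. Re (F x)) \<in> L2 \<and> (\<lambda>x. Im (F x)) \<in> L2"
  then have "(\<lambda>x. Complex (Re (F x)) (Im (F x))) \<in> borel_measurable lebesgue"
    unfolding Complex_eq
    by (intro borel_measurable_add borel_measurable_times borel_measurable_const measurable_compose[OF _ borel_measurable_of_real])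
      (auto simp: L2_measurable)
  moreover have "integrable lebesgue (\<lambda>x. Re (F x) * Re (F x) + Im (F x) * Im (F x))"
    using * by (simp add: L2_iff)
  ultimately show "F \<in> L2" by (simp add: L2_iff inner_complex_def)
qed

lemma L2_loc_complex_iff:
  fixes F :: "plane \<Rightarrow> complex"
  shows "F \<in> L2_loc \<longleftrightarrow> (\<lambda>x. Re (F x)) \<in> L2_loc \<and> (\<lambda>x. Im (F x)) \<in> L2_loc"
proof
  assume F: "F \<in> L2_loc"
  have "(\<lambda>x. indicator (ball 0 (real r)) x *\<^sub>R Re (F x)) \<in> L2"
    "(\<lambda>x. indicator (ball 0 (real r)) x *\<^sub>R Im (F x)) \<in> L2" for r :: nat
    using L2_loc_cut[OF F, of "real r"] unfolding L2_complex_iff by simp_all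
  then show "(\<lambda>x. Re (F x)) \<in> L2_loc \<and> (\<lambda>x. Im (F x)) \<in> L2_loc"
    using L2_loc_measurable[OF F] by (intro conjI L2_locI_cut) auto
next
  assume *: "(\<lambda>x. Re (F x)) \<in> L2_loc \<and> (\<lambda>x. Im (F x)) \<in> L2_loc"
  then have "(\<lambda>x. Complex (Re (F x)) (Im (F x))) \<in> borel_measurable lebesgue"
    unfolding Complex_eq
    by (intro borel_measurable_add borel_measurable_times borel_measurable_const measurable_compose[OF _ borel_measurable_of_real])
      (auto simp: L2_loc_measurable)
  moreover have "(\<lambda>x. indicator (ball 0 (real r)) x *\<^sub>R F x) \<in> L2" for r :: nat
    unfolding L2_complex_iff using * L2_loc_cut[of _ "real r"] by fastforce
  ultimately show "F \<in> L2_loc" by (intro L2_locI_cut) simp_all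
qed

lemma L2_Re_Im_vec_iff:
  fixes G :: "plane \<Rightarrow> complex^2"
  shows "G \<in> L2 \<longleftrightarrow> (\<lambda>x. Re_vec (G x)) \<in> L2 \<and> (\<lambda>x. Im_vec (G x)) \<in> L2"
proof
  assume "G \<in> L2"
  from L2_vec_nth(1)[OF this] show "(\<lambda>x. Re_vec (G x)) \<in> L2 \<and> (\<lambda>x. Im_vec (G x)) \<in> L2"
    unfolding L2_complex_iff Re_vec_def Im_vec_def by (intro conjI vec_L2) blast+
next
  assume *: "(\<lambda>x. Re_vec (G x)) \<in> L2 \<and> (\<lambda>x. Im_vec (G x)) \<in> L2"
  have "(\<lambda>x. G x $ i) \<in> L2" for i
    using L2_vec_nth(1)[of "\<lambda>x. Re_vec (G x)" i] L2_vec_nth(1)[of "\<lambda>x. Im_vec (G x)" i] *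
    unfolding L2_complex_iff by (simp add: Re_vec_def Im_vec_def)
  from vec_L2[of "\<lambda>i x. G x $ i", OF this] show "G \<in> L2" by simp
qed

text \<open>Test functions are real, so the defining identity splits into components once the
  integrands are integrable. Membership in \<open>L2_loc\<close> and \<open>L2\<close> ensures this,
  and where it fails both sides are false.\<close>

lemma wgrad_complex:
  fixes u :: "plane \<Rightarrow> complex"
  shows "wgrad u G \<longleftrightarrow> wgrad (\<lambda>x. Re (u x)) (\<lambda>x. Re_vec (G x)) \<and> wgrad (\<lambda>x. Im (u x)) (\<lambda>x. Im_vec (G x))"
proof (cases "u \<in> L2_loc \<and> G \<in> L2")
  case True
  then have uL: "u \<in> L2_loc" and GL: "G \<in> L2" by auto
  have "(\<integral>x. partial_deriv i \<phi> x *\<^sub>R u x \<partial>lebesgue) = - (\<integral>x. \<phi> x *\<^sub>R (G x $ i) \<partial>lebesgue) \<longleftrightarrow>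
     (\<integral>x. partial_deriv i \<phi> x * Re (u x) \<partial>lebesgue) = - (\<integral>x. \<phi> x * Re_vec (G x) $ i \<partial>lebesgue) \<and>
     (\<integral>x. partial_deriv i \<phi> x * Im (u x) \<partial>lebesgue) = - (\<integral>x. \<phi> x * Im_vec (G x) $ i \<partial>lebesgue)"
    if \<phi>: "\<phi> \<in> test_functions" for \<phi> i
  proof -
    have i1: "integrable lebesgue (\<lambda>x. partial_deriv i \<phi> x *\<^sub>R u x)"
      by (intro test_L2_loc_mult(2) test_partial_deriv \<phi> uL)
    have i2: "integrable lebesgue (\<lambda>x. \<phi> x *\<^sub>R (G x $ i))"
      by (intro test_L2_loc_mult(2) \<phi> L2_imp_L2_loc L2_vec_nth(1) GL)
    show ?thesis
      using integral_Re[OF i1] integral_Im[OF i1] integral_Re[OF i2] integral_Im[OF i2]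
      by (simp add: complex_eq_iff Re_vec_def Im_vec_def)
  qed
  then show ?thesis
    using True L2_Re_Im_vec_iff[of G] L2_loc_complex_iff[of u]
    by (simp add: wgrad_def has_weak_gradient_def) blast
next
  case False
  then show ?thesis using L2_Re_Im_vec_iff[of G] L2_loc_complex_iff[of u] by (auto simp: wgrad_def)
qed

lemma Re_Im_Complex_vec [simp]: "Re_vec (Complex_vec a b) = a" "Im_vec (Complex_vec a b) = b"
  by (simp_all add: Re_vec_def Im_vec_def Complex_vec_def vec_eq_iff)

lemma H1_dot_complex_iff:
  fixes u :: "plane \<Rightarrow> complex"
  shows "u \<in> H1_dot \<longleftrightarrow> (\<lambda>x. Re (u x)) \<in> H1_dot \<and> (\<lambda>x. Im (u x)) \<in> H1_dot"
proof
  assume "(\<lambda>x. Re (u x)) \<in> H1_dot \<and> (\<lambda>x. Im (u x)) \<in> H1_dot"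
  then obtain g1 g2 where "wgrad (\<lambda>x. Re (u x)) g1" "wgrad (\<lambda>x. Im (u x)) g2"
    using H1_dot_iff_wgrad by metis
  then have "wgrad u (\<lambda>x. Complex_vec (g1 x) (g2 x))" by (simp add: wgrad_complex)
  then show "u \<in> H1_dot" using H1_dot_iff_wgrad by blast
next
  assume "u \<in> H1_dot"
  from wgrad_weak_grad[OF this] show "(\<lambda>x. Re (u x)) \<in> H1_dot \<and> (\<lambda>x. Im (u x)) \<in> H1_dot"
    unfolding wgrad_complex H1_dot_iff_wgrad by blast
qed

lemma l2ip_complex_vec:
  fixes G :: "plane \<Rightarrow> complex^2"
  assumes "G \<in> L2"
  shows "l2ip G G = l2ip (\<lambda>x. Re_vec (G x)) (\<lambda>x. Re_vec (G x)) + l2ip (\<lambda>x. Im_vec (G x)) (\<lambda>x. Im_vec (G x))"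
proof -
  have "(\<lambda>x. Re_vec (G x)) \<in> L2" "(\<lambda>x. Im_vec (G x)) \<in> L2" using assms L2_Re_Im_vec_iff by blast+
  moreover have "G x \<bullet> G x = Re_vec (G x) \<bullet> Re_vec (G x) + Im_vec (G x) \<bullet> Im_vec (G x)" for x
    by (simp add: inner_vec_def Re_vec_def Im_vec_def inner_complex_def sum.distrib)
  ultimately show ?thesis by (simp add: l2ip_def L2_iff)
qed

context dissipative_problem
begin

text \<open>Expansion of (A + i \<eta>) (g1 + i g2). As the right-hand side \<open>f\<close> of the
  equation is real, the imaginary part becomes the constraint, and the real part the equation that
  contains \<open>f\<close>.\<close>

lemma weak_div_complex:
  fixes G :: "plane \<Rightarrow> complex^2"
  assumes G: "G \<in> L2" and \<phi>: "\<phi> \<in> test_functions"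
    and a: "a = (\<lambda>x. complex_of_real (A x) + \<i> * complex_of_real \<eta>)"
    and g: "g1 = (\<lambda>x. Re_vec (G x))" "g2 = (\<lambda>x. Im_vec (G x))"
  shows "weak_div (\<lambda>x. a x *s G x) \<phi> =
    Complex (- (l2ip (\<lambda>x. A x *\<^sub>R g1 x) (grad \<phi>) - \<eta> * l2ip g2 (grad \<phi>)))
      (- (l2ip (\<lambda>x. A x *\<^sub>R g2 x) (grad \<phi>) + \<eta> * l2ip g1 (grad \<phi>)))"
proof -
  have gL: "g1 \<in> L2" "g2 \<in> L2" using G L2_Re_Im_vec_iff g by blast+
  note t = wgrad_L2[OF wgrad_test[OF \<phi>]]
  let ?r = "\<lambda>x. (A x *\<^sub>R g1 x) \<bullet> grad \<phi> x - \<eta> * (g2 x \<bullet> grad \<phi> x)"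
  let ?s = "\<lambda>x. (A x *\<^sub>R g2 x) \<bullet> grad \<phi> x + \<eta> * (g1 x \<bullet> grad \<phi> x)"
  note ints = L2_integrable_inner[OF A_L2[OF gL(1)] t] L2_integrable_inner[OF A_L2[OF gL(2)] t]
    L2_integrable_inner[OF gL(1) t] L2_integrable_inner[OF gL(2) t]
  have r: "integrable lebesgue ?r" by (intro Bochner_Integration.integrable_diff integrable_mult_right ints)
  have s: "integrable lebesgue ?s" by (intro Bochner_Integration.integrable_add integrable_mult_right ints)
  have "(\<Sum>i\<in>UNIV. partial_deriv i \<phi> x *\<^sub>R ((a x *s G x) $ i)) = complex_of_real (?r x) + \<i> * complex_of_real (?s x)" for x
    by (simp add: complex_eq_iff a g inner_vec_def grad_def Re_vec_def Im_vec_def sum_subtractf sum.distrib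
      sum_negf sum_distrib_left algebra_simps)
  then have "weak_div (\<lambda>x. a x *s G x) \<phi> = - (\<integral>x. complex_of_real (?r x) + \<i> * complex_of_real (?s x) \<partial>lebesgue)"
    unfolding weak_div_def by (simp only:)
  also have "(\<integral>x. complex_of_real (?r x) + \<i> * complex_of_real (?s x) \<partial>lebesgue)
    = complex_of_real (\<integral>x. ?r x \<partial>lebesgue) + \<i> * complex_of_real (\<integral>x. ?s x \<partial>lebesgue)"
    by (subst Bochner_Integration.integral_add)
      (use integrable_of_real[OF r, where 'a = complex] integrable_of_real[OF s, where 'a = complex] in
        \<open>simp_all only: integral_complex_of_real integral_mult_right_zero integrable_mult_right\<close>)
  also have "(\<integral>x. ?r x \<partial>lebesgue) = l2ip (\<lambda>x. A x *\<^sub>R g1 x) (grad \<phi>) - \<eta> * l2ip g2 (grad \<phi>)"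
    unfolding l2ip_def using ints by (subst Bochner_Integration.integral_diff) auto
  also have "(\<integral>x. ?s x \<partial>lebesgue) = l2ip (\<lambda>x. A x *\<^sub>R g2 x) (grad \<phi>) + \<eta> * l2ip g1 (grad \<phi>)"
    unfolding l2ip_def using ints by (subst Bochner_Integration.integral_add) auto
  finally show ?thesis by (simp add: complex_eq_iff)
qed

text \<open>A function whose gradient is the representer solves both parts, by
  \<open>representer_equation\<close> and the constraint. Any other solution differs from it by a
  solution of the homogeneous system, whose gradient vanishes almost everywhere.\<close>

lemma solves_iff:
  assumes rep: "representer g1 g2"
    and a: "a = (\<lambda>x. complex_of_real (A x) + \<i> * complex_of_real \<eta>)"
  shows "solves a f u \<longleftrightarrow> wgrad (\<lambda>x. Re (u x)) g1 \<and> wgrad (\<lambda>x. Im (u x)) g2"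
proof (cases "u \<in> H1_dot")
  case False
  then have "\<not> (wgrad (\<lambda>x. Re (u x)) g1 \<and> wgrad (\<lambda>x. Im (u x)) g2)"
    using H1_dot_complex_iff[of u] H1_dot_iff_wgrad by blast
  with False show ?thesis unfolding solves_def by blast
next
  case True
  define h1 where "h1 = (\<lambda>x. Re_vec (weak_grad u x))"
  define h2 where "h2 = (\<lambda>x. Im_vec (weak_grad u x))"
  have w: "wgrad u (weak_grad u)" by (rule wgrad_weak_grad[OF True])
  then have h: "wgrad (\<lambda>x. Re (u x)) h1" "wgrad (\<lambda>x. Im (u x)) h2"
    unfolding wgrad_complex h1_def h2_def by blast+
  have sol: "solves a f u \<longleftrightarrow> (\<forall>\<phi>\<in>test_functions.
      l2ip (\<lambda>x. A x *\<^sub>R h1 x) (grad \<phi>) - \<eta> * l2ip h2 (grad \<phi>) = - f \<phi> \<and>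
      l2ip (\<lambda>x. A x *\<^sub>R h2 x) (grad \<phi>) + \<eta> * l2ip h1 (grad \<phi>) = 0)"
    unfolding solves_def using True
    by (simp add: weak_div_complex[OF wgrad_L2[OF w] _ a h1_def h2_def] complex_eq_iff minus_equation_iff[of "f _"])
      (intro ball_cong refl, linarith)
  have con: "constraint g1 g2" using rep by (simp add: representer_def)
  show ?thesis
  proof
    assume "solves a f u"
    note eqs = this[unfolded sol, rule_format]
    obtain v \<psi> where g: "wgrad v g1" "wgrad \<psi> g2" using rep by (auto simp: representer_def)
    have L: "h1 \<in> L2" "h2 \<in> L2" "g1 \<in> L2" "g2 \<in> L2" using h g by (simp_all add: wgrad_L2)
    note AL = L[THEN A_L2]
    have hom: "l2ip (\<lambda>x. A x *\<^sub>R (h1 x - g1 x)) (grad \<phi>) - \<eta> * l2ip (\<lambda>x. h2 x - g2 x) (grad \<phi>) = 0"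
      "l2ip (\<lambda>x. A x *\<^sub>R (h2 x - g2 x)) (grad \<phi>) + \<eta> * l2ip (\<lambda>x. h1 x - g1 x) (grad \<phi>) = 0"
      if \<phi>: "\<phi> \<in> test_functions" for \<phi>
    proof -
      note t = wgrad_L2[OF wgrad_test[OF \<phi>]]
      note eq = eqs[OF \<phi>] representer_equation[OF rep \<phi>]
      have 0: "l2ip (\<lambda>x. A x *\<^sub>R g2 x) (grad \<phi>) + \<eta> * l2ip g1 (grad \<phi>) = 0"
        using con \<phi> by (simp add: constraint_def)
      show "l2ip (\<lambda>x. A x *\<^sub>R (h1 x - g1 x)) (grad \<phi>) - \<eta> * l2ip (\<lambda>x. h2 x - g2 x) (grad \<phi>) = 0"
        using eq by (simp add: scaleR_diff_right l2ip_diff L AL t right_diff_distrib)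
      show "l2ip (\<lambda>x. A x *\<^sub>R (h2 x - g2 x)) (grad \<phi>) + \<eta> * l2ip (\<lambda>x. h1 x - g1 x) (grad \<phi>) = 0"
        using eq 0 by (simp add: scaleR_diff_right l2ip_diff L AL t right_diff_distrib)
    qed
    have "AE x in lebesgue. h1 x - g1 x = 0" "AE x in lebesgue. h2 x - g2 x = 0"
      using homogeneous_unique[OF wgrad_diff[OF h(1) g(1)] wgrad_diff[OF h(2) g(2)] hom] by blast+
    then show "wgrad (\<lambda>x. Re (u x)) g1 \<and> wgrad (\<lambda>x. Im (u x)) g2"
      using wgrad_cong_gradient[OF h(1) _ L(3)] wgrad_cong_gradient[OF h(2) _ L(4)] by simp
  next
    assume g: "wgrad (\<lambda>x. Re (u x)) g1 \<and> wgrad (\<lambda>x. Im (u x)) g2"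
    show "solves a f u"
      unfolding sol
    proof (intro ballI conjI)
      fix \<phi> assume \<phi>: "\<phi> \<in> test_functions"
      note t = wgrad_test[OF \<phi>]
      have e: "l2ip h1 (grad \<phi>) = l2ip g1 (grad \<phi>)" "l2ip h2 (grad \<phi>) = l2ip g2 (grad \<phi>)"
        using wgrad_l2ip_cong[OF h(1) _ t t] wgrad_l2ip_cong[OF h(2) _ t t] g by blast+
      have AE: "AE x in lebesgue. h1 x = g1 x" "AE x in lebesgue. h2 x = g2 x"
        using wgrad_unique_AE[OF h(1)] wgrad_unique_AE[OF h(2)] g by blast+
      have Ae: "l2ip (\<lambda>x. A x *\<^sub>R h1 x) (grad \<phi>) = l2ip (\<lambda>x. A x *\<^sub>R g1 x) (grad \<phi>)"
        "l2ip (\<lambda>x. A x *\<^sub>R h2 x) (grad \<phi>) = l2ip (\<lambda>x. A x *\<^sub>R g2 x) (grad \<phi>)"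
        using AE g h by (auto intro!: l2ip_cong_AE A_L2 wgrad_L2[OF t] intro: wgrad_L2)
      show "l2ip (\<lambda>x. A x *\<^sub>R h1 x) (grad \<phi>) - \<eta> * l2ip h2 (grad \<phi>) = - f \<phi>"
        unfolding e Ae by (rule representer_equation[OF rep \<phi>])
      show "l2ip (\<lambda>x. A x *\<^sub>R h2 x) (grad \<phi>) + \<eta> * l2ip h1 (grad \<phi>) = 0"
        unfolding e Ae using con \<phi> by (simp add: constraint_def)
    qed
  qed
qed

text \<open>At the representer the squared distance in \<open>J_eq\<close> is zero, and what remains
  is \<eta> / 2 times the sum of the Dirichlet integrals of the two components.\<close>

lemma energy_eq_J:
  assumes rep: "representer g1 g2" and "wgrad v g1" "wgrad \<psi> g2"
  shows "energy \<eta> (\<lambda>x. complex_of_real (v x) + \<i> * complex_of_real (\<psi> x)) = J \<eta> f v \<psi>"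
proof -
  let ?u = "\<lambda>x. complex_of_real (v x) + \<i> * complex_of_real (\<psi> x)"
  have "?u \<in> H1_dot" unfolding H1_dot_complex_iff H1_dot_iff_wgrad using assms by auto
  then have w: "wgrad ?u (weak_grad ?u)" by (rule wgrad_weak_grad)
  then have h: "wgrad v (\<lambda>x. Re_vec (weak_grad ?u x))" "wgrad \<psi> (\<lambda>x. Im_vec (weak_grad ?u x))"
    unfolding wgrad_complex by simp_all
  have "dirichlet ?u = l2ip g1 g1 + l2ip g2 g2"
    unfolding dirichlet_eq_l2ip l2ip_complex_vec[OF wgrad_L2[OF w]]
    using wgrad_l2ip_cong[OF h(1) assms(2) h(1) assms(2)] wgrad_l2ip_cong[OF h(2) assms(3) h(2) assms(3)] by simp
  moreover have "constraint g1 g2" using rep by (simp add: representer_def)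
  ultimately show ?thesis
    using J_eq[OF rep assms(2,3)] by (simp add: energy_def l2ip_def)
qed

end

theorem lemma2p2:
  fixes R \<eta> :: real and \<Sigma> :: "plane set"
    and A :: "plane \<Rightarrow> real" and a :: "plane \<Rightarrow> complex"
    and f :: "(plane \<Rightarrow> real) \<Rightarrow> real"
  assumes "R > 1"
    and "\<Sigma> \<in> sets lebesgue" and "\<Sigma> \<subseteq> ball 0 1"
    and "A = coeff_A R \<Sigma>"
    and "\<eta> > 0"
    and "a = (\<lambda>x. complex_of_real (A x) + \<i> * complex_of_real \<eta>)"
    and "f \<in> H_minus1" and "compact (dist_support f)" and "pairing f (\<lambda>x. 1) = 0"
  shows "(\<exists>v \<psi>. maximizing_pair A \<eta> f v \<psi>) \<and>
    (\<forall>v \<psi>. maximizing_pair A \<eta> f v \<psi> \<longrightarrow>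
       (\<forall>v' \<psi>'. maximizing_pair A \<eta> f v' \<psi>' \<longrightarrow> eq_up_to_const v' v \<and> eq_up_to_const \<psi>' \<psi>) \<and>
       (let u = (\<lambda>x. complex_of_real (v x) + \<i> * complex_of_real (\<psi> x)) in
          solves a f u \<and>
          (\<forall>u'. solves a f u' \<longrightarrow> eq_up_to_const u' u) \<and>
          energy \<eta> u = J \<eta> f v \<psi>))"
proof -
  interpret dissipative_problem f A \<eta>
  proof
    show "A \<in> borel_measurable lebesgue"
    proof -
      note [measurable] = assms(2)
      show ?thesis unfolding assms(4) coeff_A_def[abs_def] by measurable
    qed
    show "\<bar>A x\<bar> \<le> 1" for x by (simp add: assms(4) coeff_A_def)
  qed (use assms in auto)
  obtain g1 g2 where rep: "representer g1 g2" using representer_ex by blast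
  \<comment> \<open>Both equivalences refer to the same pair \<open>g1\<close>, \<open>g2\<close>.
    Maximizers and solutions are thus compared through it, and equal gradients differ in their
    potentials by constants.\<close>
  note max_iff = maximizing_pair_iff[OF rep] and sol_iff = solves_iff[OF rep assms(6)]
  obtain v0 \<psi>0 where "wgrad v0 g1" "wgrad \<psi>0 g2" using rep by (auto simp: representer_def)
  then have ex: "\<exists>v \<psi>. maximizing_pair A \<eta> f v \<psi>" unfolding max_iff by blast
  have main: "(\<forall>v' \<psi>'. maximizing_pair A \<eta> f v' \<psi>' \<longrightarrow> eq_up_to_const v' v \<and> eq_up_to_const \<psi>' \<psi>) \<and>
       (let u = (\<lambda>x. complex_of_real (v x) + \<i> * complex_of_real (\<psi> x)) in
          solves a f u \<and> (\<forall>u'. solves a f u' \<longrightarrow> eq_up_to_const u' u) \<and> energy \<eta> u = J \<eta> f v \<psi>)"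
    if "maximizing_pair A \<eta> f v \<psi>" for v \<psi>
  proof -
    from that have w: "wgrad v g1" "wgrad \<psi> g2" unfolding max_iff by blast+
    let ?u = "\<lambda>x. complex_of_real (v x) + \<i> * complex_of_real (\<psi> x)"
    have "eq_up_to_const u' ?u" if "solves a f u'" for u'
    proof -
      from that have "wgrad (\<lambda>x. Re (u' x)) g1" "wgrad (\<lambda>x. Im (u' x)) g2" unfolding sol_iff by blast+
      from wgrad_eq_up_to_const[OF this(1) w(1)] wgrad_eq_up_to_const[OF this(2) w(2)]
      obtain c d where "AE x in lebesgue. Re (u' x) = v x + c" "AE x in lebesgue. Im (u' x) = \<psi> x + d"
        unfolding eq_up_to_const_def by blast
      then have "AE x in lebesgue. u' x = ?u x + Complex c d"
        by eventually_elim (simp add: complex_eq_iff)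
      then show ?thesis unfolding eq_up_to_const_def by blast
    qed
    moreover have "solves a f ?u" unfolding sol_iff using w by simp
    moreover have "energy \<eta> ?u = J \<eta> f v \<psi>" by (rule energy_eq_J[OF rep w])
    moreover have "eq_up_to_const v' v \<and> eq_up_to_const \<psi>' \<psi>" if "maximizing_pair A \<eta> f v' \<psi>'" for v' \<psi>'
      using that w wgrad_eq_up_to_const unfolding max_iff by blast
    ultimately show ?thesis by (simp add: Let_def)
  qed
  show ?thesis using ex main by blast
qed

end
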